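(* Let $B_1^2 \subset \mathbb{R}^2$ be the unit ball, let $a>1$ and $q\ge 2$. Then the embedding $$\left(H^1_{0,\mathrm{rad}}(B_1^2)\right)^{\perp} \hookrightarrow L^q\left(B_1^2;\ |x|^{-2}\left(\log\frac{a}{|x|}\right)^{-1-\frac q2}dx\right)$$ is compact.
   Context: $B_1^2=\{x\in\mathbb{R}^2: |x|<1\}$. $H_0^1(B_1^2)$ is the completion of $C_0^\infty(B_1^2)$ with respect to the norm $\|\nabla u\|_{L^2}$; it is a Hilbert space with inner product $(u,v)=\int_{B_1^2}\nabla u\cdot\nabla v\,dx$. $H^1_{0,\mathrm{rad}}(B_1^2)$ is the closed subspace of radial functions in $H_0^1(B_1^2)$, and $(H^1_{0,\mathrm{rad}}(B_1^2))^\perp$ is its orthogonal complement in $H_0^1(B_1^2)$. $L^q(B_1^2; w\,dx)$ is the weighted Lebesgue space with norm $\left(\int_{B_1^2}|u|^q w\,dx\right)^{1/q}$. An embedding $X\hookrightarrow Y$ is compact if it is continuous and every bounded sequence in $X$ has a subsequence converging in $Y$. *)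

theory Defs
  imports "HOL-Analysis.Analysis"
begin

text \<open>Elements are functions rather than classes modulo a.e. equality, so \<open>lp_norm\<close> is a
  seminorm. For a weight \<open>w\<close>, the space \<open>L\<^sup>p(w dx)\<close> is \<open>lp_space\<close> over \<open>density\<close>.\<close>

definition lp_space ::
    "real \<Rightarrow> 'a measure \<Rightarrow> ('a \<Rightarrow> 'b::{banach, second_countable_topology}) set" where
  "lp_space p M = {u \<in> borel_measurable M. integrable M (\<lambda>x. norm (u x) powr p)}"

definition lp_norm ::
    "real \<Rightarrow> 'a measure \<Rightarrow> ('a \<Rightarrow> 'b::{banach, second_countable_topology}) \<Rightarrow> real" where
  "lp_norm p M u = (\<integral>x. norm (u x) powr p \<partial>M) powr (1 / p)"

abbreviation unit_disc :: "(real^2) set" where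
  "unit_disc \<equiv> ball 0 1"

abbreviation disc_measure :: "(real^2) measure" where
  "disc_measure \<equiv> lebesgue_on unit_disc"

definition partial :: "2 \<Rightarrow> (real^2 \<Rightarrow> real) \<Rightarrow> real^2 \<Rightarrow> real" where
  "partial i f x = frechet_derivative f (at x) (axis i 1)"

definition grad :: "(real^2 \<Rightarrow> real) \<Rightarrow> real^2 \<Rightarrow> real^2" where
  "grad f x = (\<chi> i. partial i f x)"

primrec C_k :: "nat \<Rightarrow> (real^2 \<Rightarrow> real) \<Rightarrow> bool" where
  "C_k 0 f \<longleftrightarrow> continuous_on UNIV f"
| "C_k (Suc k) f \<longleftrightarrow> (\<forall>x. f differentiable (at x)) \<and> (\<forall>i. C_k k (partial i f))"

text \<open>Functions in \<open>C\<^sub>0\<^sup>\<infinity>\<close> of the disc, extended by zero to the whole plane.\<close>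

definition test_functions :: "(real^2 \<Rightarrow> real) set" where
  "test_functions =
     {f. (\<forall>k. C_k k f) \<and> compact (closure {x. f x \<noteq> 0}) \<and> closure {x. f x \<noteq> 0} \<subseteq> unit_disc}"

text \<open>The completion of the test functions in the norm \<open>\<parallel>\<nabla>u\<parallel>\<close> of \<open>L\<^sup>2\<close>, realised
  as a space of functions: by the Poincare inequality on the disc, a sequence of test functions
  that is Cauchy in this norm also converges in \<open>L\<^sup>2\<close>, and its \<open>L\<^sup>2\<close> limit \<open>u\<close>
  determines the limit \<open>g\<close> of the gradients (up to null sets). Values of \<open>u\<close> and \<open>g\<close> outside
  the disc are irrelevant.\<close>

definition has_h01_grad :: "(real^2 \<Rightarrow> real) \<Rightarrow> (real^2 \<Rightarrow> real^2) \<Rightarrow> bool" where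
  "has_h01_grad u g \<longleftrightarrow>
     u \<in> lp_space 2 disc_measure \<and> g \<in> lp_space 2 disc_measure \<and>
     (\<exists>\<phi> :: nat \<Rightarrow> real^2 \<Rightarrow> real. (\<forall>n. \<phi> n \<in> test_functions) \<and>
        (\<lambda>n. lp_norm 2 disc_measure (\<lambda>x. \<phi> n x - u x)) \<longlonglongrightarrow> 0 \<and>
        (\<lambda>n. lp_norm 2 disc_measure (\<lambda>x. grad (\<phi> n) x - g x)) \<longlonglongrightarrow> 0)"

definition H01 :: "(real^2 \<Rightarrow> real) set" where
  "H01 = {u. \<exists>g. has_h01_grad u g}"

definition h01_grad :: "(real^2 \<Rightarrow> real) \<Rightarrow> real^2 \<Rightarrow> real^2" where
  "h01_grad u = (SOME g. has_h01_grad u g)"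

definition h01_inner :: "(real^2 \<Rightarrow> real) \<Rightarrow> (real^2 \<Rightarrow> real) \<Rightarrow> real" where
  "h01_inner u v = (\<integral>x. h01_grad u x \<bullet> h01_grad v x \<partial>disc_measure)"

definition h01_norm :: "(real^2 \<Rightarrow> real) \<Rightarrow> real" where
  "h01_norm u = sqrt (h01_inner u u)"

text \<open>Radial means having a radial representative, as functions matter only up to null sets.\<close>

definition H01_rad :: "(real^2 \<Rightarrow> real) set" where
  "H01_rad = {u \<in> H01. \<exists>f :: real \<Rightarrow> real. AE x in disc_measure. u x = f (norm x)}"

definition H01_rad_perp :: "(real^2 \<Rightarrow> real) set" where
  "H01_rad_perp = {u \<in> H01. \<forall>v \<in> H01_rad. h01_inner u v = 0}"

definition log_weight :: "real \<Rightarrow> real \<Rightarrow> real^2 \<Rightarrow> real" where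
  "log_weight a q x = norm x powr (-2) * ln (a / norm x) powr (-1 - q / 2)"

definition weighted_disc_measure :: "real \<Rightarrow> real \<Rightarrow> (real^2) measure" where
  "weighted_disc_measure a q = density disc_measure (\<lambda>x. ennreal (log_weight a q x))"

text \<open>The embedding is the inclusion of function spaces. The two functions \<open>nX\<close> and \<open>nY\<close> are
  the (semi)norms of \<open>X\<close> and \<open>Y\<close>.\<close>

definition compact_embedding ::
    "('a \<Rightarrow> real) set \<Rightarrow> (('a \<Rightarrow> real) \<Rightarrow> real) \<Rightarrow>
     ('a \<Rightarrow> real) set \<Rightarrow> (('a \<Rightarrow> real) \<Rightarrow> real) \<Rightarrow> bool" where
  "compact_embedding X nX Y nY \<longleftrightarrow>
     X \<subseteq> Y \<and>
     (\<forall>u\<in>X. \<forall>e>0. \<exists>d>0. \<forall>v\<in>X. nX (\<lambda>x. v x - u x) < d \<longrightarrow> nY (\<lambda>x. v x - u x) < e) \<and>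
     (\<forall>s :: nat \<Rightarrow> 'a \<Rightarrow> real.
        (\<forall>n. s n \<in> X) \<and> (\<exists>C. \<forall>n. nX (s n) \<le> C) \<longrightarrow>
        (\<exists>r :: nat \<Rightarrow> nat. strict_mono r \<and>
           (\<exists>v\<in>Y. (\<lambda>n. nY (\<lambda>x. s (r n) x - v x)) \<longlonglongrightarrow> 0)))"

end

theory Submission
  imports Defs "HOL-Complex_Analysis.Great_Picard"
begin

text \<open>
  In the coordinates \<open>x = exp (-t) (cos \<theta>, sin \<theta>)\<close> the disc becomes the half strip \<open>t > 0\<close>, the
  Dirichlet integral is conformally invariant, and \<open>|x|\<^sup>-\<^sup>2 dx\<close> becomes \<open>dt d\<theta>\<close>, so that the weight
  turns into \<open>(ln a + t) powr (-1 - q/2)\<close>, which is bounded and tends to \<open>0\<close>. An element of the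
  orthogonal complement is a limit of test functions with zero mean over \<open>\<theta>\<close>. Such a function \<open>V\<close>
  vanishes somewhere on every circle and at \<open>t = 0\<close>, so \<open>V\<^sup>2\<^sup>k\<close> is at most the product of the integral
  of \<open>|\<partial>\<^sub>\<theta> V\<^sup>k|\<close> over \<open>\<theta>\<close> and the integral of \<open>|\<partial>\<^sub>t V\<^sup>k|\<close> over \<open>t\<close>; by induction on \<open>k\<close> all even
  unweighted \<open>L\<^sup>p\<close> norms on the half strip are controlled by the energy. The part \<open>t > T\<close> is then small
  because the weight is, and on \<open>t < T\<close> the Poincare inequality on the cells of a fine grid reduces
  compactness to the convergence of finitely many cell means.
\<close>

section \<open>Calculus on intervals\<close>

text \<open>The weight is critical: for nonzero \<open>V\<close> depending on t alone and supported
  away from t = 0, passing from V(t) to c^(-1/2) V(c t) keeps the energy, while the weighted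
  integral of |V|^q tends to a positive limit as c tends to 0. Compactness thus fails on radial
  functions; zero angular mean restores it by bounding unweighted integrals by the energy.
  Orthogonality, however, is an abstract condition on a limit \<open>u\<close>, while the estimates
  need zero mean on each circle for smooth functions. The angular mean is an energy-orthogonal
  projection, so the means of the approximants converge to a radial element of the Sobolev space;
  testing \<open>u\<close> against that very element forces their energy to 0, and they can be
  subtracted. As \<open>h01_grad\<close> is a choice, this needs gradients to be unique up to null
  sets. The estimates are made for smooth functions on bounded rectangles, where continuity gives
  integrability, and pass to the disc by monotone convergence. The constants are not homogeneous in
  the energy; their continuity and vanishing at 0 suffice.\<close>

abbreviation continuous2 :: "(real \<Rightarrow> real \<Rightarrow> real) \<Rightarrow> bool" where
  "continuous2 G \<equiv> continuous_on UNIV (\<lambda>p. G (fst p) (snd p))"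

lemma continuous2_compose:
  assumes "continuous2 G" "continuous_on S f" "continuous_on S g"
  shows "continuous_on S (\<lambda>x. G (f x) (g x))"
  using continuous_on_compose2[OF assms(1) continuous_on_Pair[OF assms(2,3)]] by simp

lemma continuous2_left: "continuous2 G \<Longrightarrow> continuous_on S (G t)"
  using continuous2_compose[of G S "\<lambda>_. t" "\<lambda>x. x"] by simp

lemma continuous2_right: "continuous2 G \<Longrightarrow> continuous_on S (\<lambda>t. G t \<theta>)"
  using continuous2_compose[of G S "\<lambda>x. x" "\<lambda>_. \<theta>"] by simp

lemma continuous2_flip: "continuous2 G \<Longrightarrow> continuous2 (\<lambda>\<theta> t. G t \<theta>)"
  by (rule continuous2_compose[of G UNIV snd fst]) (auto intro!: continuous_intros)

lemma cont_int_left: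
  assumes "continuous2 G"
  shows "continuous_on S (\<lambda>t. integral {a..b} (G t))"
proof -
  have "continuous_on (S \<times> cbox a b) (\<lambda>(t, \<theta>). G t \<theta>)"
    using continuous_on_subset[OF assms] by (auto simp: case_prod_beta)
  from integral_continuous_on_param[OF this] show ?thesis by (simp add: cbox_interval)
qed

lemma integral_swap2:
  assumes "continuous2 G"
  shows "integral {a..b} (\<lambda>t. integral {c..d} (G t)) = integral {c..d} (\<lambda>\<theta>. integral {a..b} (\<lambda>t. G t \<theta>))"
proof -
  have "continuous_on (cbox (a,c) (b,d)) (\<lambda>(t, \<theta>). G t \<theta>)"
    using continuous_on_subset[OF assms] by (auto simp: case_prod_beta)
  from integral_swap_continuous[OF this] show ?thesis by (simp add: cbox_interval)
qed

lemmas cont_integrable = integrable_continuous_interval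

lemma abs_integral_le:
  fixes f :: "real \<Rightarrow> real"
  assumes "continuous_on {a..b} f"
  shows "\<bar>integral {a..b} f\<bar> \<le> integral {a..b} (\<lambda>x. \<bar>f x\<bar>)"
  using integral_norm_bound_integral[of f "{a..b}" "\<lambda>x. \<bar>f x\<bar>"] assms
  by (auto intro!: cont_integrable continuous_intros)

lemma integral_subinterval_le:
  fixes f :: "real \<Rightarrow> real"
  assumes "continuous_on {a..b} f" "\<And>x. x \<in> {a..b} \<Longrightarrow> 0 \<le> f x" "a \<le> c" "d \<le> b"
  shows "integral {c..d} f \<le> integral {a..b} f" using assms by (intro integral_subset_le)
    (auto intro!: cont_integrable intro: continuous_on_subset)

text \<open>The integral runs over the whole interval, not from \<open>x\<close> to
  \<open>y\<close>, so one of the points may be a zero or a mean value point of \<open>f\<close>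
  whose position is unknown.\<close>

lemma abs_diff_le_integral:
  fixes f f' :: "real \<Rightarrow> real"
  assumes f: "\<And>x. (f has_real_derivative f' x) (at x)" and f': "continuous_on UNIV f'"
    and "x \<in> {a..b}" "y \<in> {a..b}"
  shows "\<bar>f x - f y\<bar> \<le> integral {a..b} (\<lambda>x. \<bar>f' x\<bar>)"
  using assms(3,4)
proof (induction x y rule: linorder_wlog)
  case (le x y)
  have "(f' has_integral f y - f x) {x..y}" using le f by (intro fundamental_theorem_of_calculus)
      (auto simp flip: has_real_derivative_iff_has_vector_derivative intro: has_field_derivative_at_within)
  then have "\<bar>f x - f y\<bar> = \<bar>integral {x..y} f'\<bar>" by (simp add: integral_unique)
  also have "\<dots> \<le> integral {x..y} (\<lambda>x. \<bar>f' x\<bar>)"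
    by (intro abs_integral_le continuous_on_subset[OF f']) auto
  also have "\<dots> \<le> integral {a..b} (\<lambda>x. \<bar>f' x\<bar>)"
    using le by (intro integral_subinterval_le continuous_intros continuous_on_subset[OF f']) auto
  finally show ?case .
next
  case (sym x y)
  then show ?case by (simp add: abs_minus_commute)
qed

text \<open>The variance identity. Nonnegativity of its left side is Cauchy-Schwarz against the
  constant 1, and an upper bound for the left side is a Poincare inequality; both are read off
  below.\<close>

lemma integral_sq_deviation:
  fixes f :: "real \<Rightarrow> real"
  assumes "continuous_on {a..b} f" "a < b"
  shows "integral {a..b} (\<lambda>x. (f x - integral {a..b} f / (b - a))\<^sup>2)
    = integral {a..b} (\<lambda>x. (f x)\<^sup>2) - (integral {a..b} f)\<^sup>2 / (b - a)" proof -
  define m where "m = integral {a..b} f / (b - a)"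
  have "integral {a..b} (\<lambda>x. (f x - m)\<^sup>2) = integral {a..b} (\<lambda>x. (f x)\<^sup>2 - 2 * m * f x + m\<^sup>2)"
    by (rule integral_cong) (simp add: power2_diff algebra_simps)
  also have "\<dots> = integral {a..b} (\<lambda>x. (f x)\<^sup>2) - 2 * m * integral {a..b} f + m\<^sup>2 * (b - a)"
    using assms by (subst integral_add integral_diff integral_mult_right;
        (intro cont_integrable continuous_intros)?; simp)+
  also have "\<dots> = integral {a..b} (\<lambda>x. (f x)\<^sup>2) - (integral {a..b} f)\<^sup>2 / (b - a)"
  proof -
    have "m * (b - a) = integral {a..b} f" using assms(2) by (simp add: m_def)
    then have "m\<^sup>2 * (b - a) = m * integral {a..b} f" by (simp add: power2_eq_square mult.assoc)
    then show ?thesis by (simp add: m_def power2_eq_square)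
  qed
  finally show ?thesis unfolding m_def .
qed

lemma integral_sq_le:
  fixes f :: "real \<Rightarrow> real"
  assumes "continuous_on {a..b} f" "a \<le> b"
  shows "(integral {a..b} f)\<^sup>2 \<le> (b - a) * integral {a..b} (\<lambda>x. (f x)\<^sup>2)"
proof (cases "a = b")
  case False
  with assms have "0 \<le> integral {a..b} (\<lambda>x. (f x - integral {a..b} f / (b - a))\<^sup>2)"
    by (intro integral_nonneg cont_integrable continuous_intros) auto
  then have "(integral {a..b} f)\<^sup>2 / (b - a) \<le> integral {a..b} (\<lambda>x. (f x)\<^sup>2)"
    using False assms by (simp only: integral_sq_deviation)
  with False assms(2) show ?thesis by (simp add: field_simps)
qed simp

lemma integral_mean_attained:
  fixes f :: "real \<Rightarrow> real"
  assumes "continuous_on {a..b} f" "a < b"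
  obtains \<xi> where "\<xi> \<in> {a..b}" "f \<xi> = integral {a..b} f / (b - a)"
proof -
  have "\<exists>\<xi>\<in>{a<..<b}. integral {a..b} f - integral {a..a} f = f \<xi> * (b - a)"
    using integral_has_real_derivative[OF assms(1)]
    by (intro mvt_simple[OF assms(2)]) (auto simp: has_field_derivative_def)
  then obtain \<xi> where "\<xi> \<in> {a<..<b}" "integral {a..b} f = f \<xi> * (b - a)" by auto
  with assms(2) show ?thesis by (intro that[of \<xi>]) auto
qed

text \<open>\<open>f\<close> attains its mean at some \<xi>, so the squared deviation is at most
  \<open>h\<close> times the integral of the squared derivative; integrating over length
  \<open>h\<close> gives the second factor \<open>h\<close>. The mean term is kept on the right
  because these numbers are what the compactness argument follows.\<close>

lemma Poincare_interval:
  fixes f f' :: "real \<Rightarrow> real"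
  assumes f: "\<And>x. (f has_real_derivative f' x) (at x)" and f': "continuous_on UNIV f'" and "0 < h"
  shows "integral {a..a+h} (\<lambda>x. (f x)\<^sup>2) \<le>
    (integral {a..a+h} f)\<^sup>2 / h + h\<^sup>2 * integral {a..a+h} (\<lambda>x. (f' x)\<^sup>2)" proof -
  have cf: "continuous_on S f" for S
    using f by (meson DERIV_continuous_on has_field_derivative_at_within)
  have cf': "continuous_on S f'" for S using f' continuous_on_subset by blast
  let ?m = "integral {a..a+h} f / h"
  obtain \<xi> where \<xi>: "\<xi> \<in> {a..a+h}" "f \<xi> = ?m"
    using integral_mean_attained[of a "a+h" f] cf assms by auto
  have "(f x - ?m)\<^sup>2 \<le> h * integral {a..a+h} (\<lambda>x. (f' x)\<^sup>2)" if "x \<in> {a..a+h}" for x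
  proof -
    have "\<bar>f x - ?m\<bar>\<^sup>2 \<le> (integral {a..a+h} (\<lambda>x. \<bar>f' x\<bar>))\<^sup>2"
      using abs_diff_le_integral[OF f f' that \<xi>(1)] by (intro power_mono) (auto simp: \<xi>)
    also have "\<dots> \<le> (a + h - a) * integral {a..a+h} (\<lambda>x. \<bar>f' x\<bar>\<^sup>2)"
      using assms by (intro integral_sq_le continuous_intros cf') auto
    finally show ?thesis by simp
  qed
  then have "integral {a..a+h} (\<lambda>x. (f x - ?m)\<^sup>2)
    \<le> integral {a..a+h} (\<lambda>_. h * integral {a..a+h} (\<lambda>x. (f' x)\<^sup>2))"
    by (intro integral_le cont_integrable continuous_intros cf)
  then show ?thesis
    using integral_sq_deviation[OF cf, of a "a+h"] assms by (simp add: power2_eq_square algebra_simps)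
qed

lemma sum_integral_cells:
  fixes g :: "real \<Rightarrow> real"
  assumes g: "continuous_on UNIV g" and "0 < h"
  shows "(\<Sum>j<n. integral {real j*h..real j*h+h} g) = integral {0..real n*h} g"
proof (induction n)
  case (Suc n)
  have "integral {0..real n*h} g + integral {real n*h..real n*h+h} g = integral {0..real n*h+h} g"
    using \<open>0 < h\<close> by (intro Henstock_Kurzweil_Integration.integral_combine cont_integrable
        continuous_on_subset[OF g]) auto
  with Suc show ?case by (simp add: distrib_right add.commute)
qed simp

text \<open>Compactness in one variable: refining the grid makes the factor \<open>h\<^sup>2\<close>
  small, and what is left of \<open>f\<close> is \<open>n\<close> numbers.\<close>

lemma Poincare_subdivided:
  fixes f f' :: "real \<Rightarrow> real"
  assumes f: "\<And>x. (f has_real_derivative f' x) (at x)" and f': "continuous_on UNIV f'" and h: "0 < h"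
  shows "integral {0..real n*h} (\<lambda>x. (f x)\<^sup>2) \<le>
    (\<Sum>j<n. (integral {real j*h..real j*h+h} f)\<^sup>2 / h) + h\<^sup>2 * integral {0..real n*h} (\<lambda>x. (f' x)\<^sup>2)"
proof -
  have "continuous_on UNIV f"
    using f by (meson DERIV_continuous_on has_field_derivative_at_within)
  then have c: "continuous_on UNIV (\<lambda>x. (f x)\<^sup>2)" "continuous_on UNIV (\<lambda>x. (f' x)\<^sup>2)"
    by (intro continuous_intros f'; simp)+
  have "(\<Sum>j<n. integral {real j*h..real j*h+h} (\<lambda>x. (f x)\<^sup>2)) \<le>
    (\<Sum>j<n. (integral {real j*h..real j*h+h} f)\<^sup>2 / h
      + h\<^sup>2 * integral {real j*h..real j*h+h} (\<lambda>x. (f' x)\<^sup>2))"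
    by (intro sum_mono Poincare_interval assms)
  then show ?thesis
    by (simp add: sum.distrib sum_distrib_left[symmetric] sum_integral_cells[OF _ h] c)
qed

section \<open>Functions on the half strip\<close>

text \<open>Only bounded rectangles, where continuity gives integrability; the limit of large
  \<open>T\<close> is taken in \<open>nn_integral_half_strip\<close>. For negative \<open>T\<close>
  the domain is empty and the value 0.\<close>

definition strip_int :: "real \<Rightarrow> (real \<Rightarrow> real \<Rightarrow> real) \<Rightarrow> real" where
  "strip_int T G = integral {0..T} (\<lambda>t. integral {0..2*pi} (G t))"

lemma strip_int_mono:
  assumes "continuous2 F" "continuous2 G"
    and "\<And>t \<theta>. t \<in> {0..T} \<Longrightarrow> \<theta> \<in> {0..2*pi} \<Longrightarrow> F t \<theta> \<le> G t \<theta>"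
  shows "strip_int T F \<le> strip_int T G" unfolding strip_int_def
  by (intro integral_le cont_integrable cont_int_left continuous2_left
      assms)

lemma strip_int_nonneg:
  assumes "continuous2 F" "\<And>t \<theta>. t \<in> {0..T} \<Longrightarrow> \<theta> \<in> {0..2*pi} \<Longrightarrow> 0 \<le> F t \<theta>"
  shows "0 \<le> strip_int T F"
  using strip_int_mono[of "\<lambda>_ _. 0" F T] assms by (simp add: strip_int_def)

lemma strip_int_add:
  assumes "continuous2 F" "continuous2 G"
  shows "strip_int T (\<lambda>t \<theta>. F t \<theta> + G t \<theta>) = strip_int T F + strip_int T G"
  unfolding strip_int_def by (subst integral_add[symmetric])
     (intro cont_integrable cont_int_left assms integral_cong
        integral_add continuous2_left)+

lemma strip_int_cmult:
  "strip_int T (\<lambda>t \<theta>. c * F t \<theta>) = c * strip_int T F" unfolding strip_int_def by simp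

lemma strip_int_extend_le:
  assumes "continuous2 F" "\<And>t \<theta>. t \<in> {0..T'} \<Longrightarrow> \<theta> \<in> {0..2*pi} \<Longrightarrow> 0 \<le> F t \<theta>" "T \<le> T'"
  shows "strip_int T F \<le> strip_int T' F" unfolding strip_int_def using assms
  by (intro integral_subinterval_le cont_int_left integral_nonneg
      cont_integrable continuous2_left) auto

section \<open>Poincare inequality on a grid of square cells\<close>

abbreviation cell_integral :: "(real \<Rightarrow> real \<Rightarrow> real) \<Rightarrow> real \<Rightarrow> nat \<Rightarrow> nat \<Rightarrow> real" where
  "cell_integral F h i j \<equiv>
    integral {real i*h..real i*h+h} (\<lambda>t. integral {real j*h..real j*h+h} (F t))"

locale strip_fn =
  fixes V Vt V\<theta> :: "real \<Rightarrow> real \<Rightarrow> real"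
  assumes cont [continuous_intros]: "continuous2 V" "continuous2 Vt" "continuous2 V\<theta>"
    and deriv_t: "((\<lambda>t. V t \<theta>) has_real_derivative Vt t \<theta>) (at t)"
    and deriv_\<theta>: "(V t has_real_derivative V\<theta> t \<theta>) (at \<theta>)"
    and boundary: "V 0 \<theta> = 0"
begin

definition energy :: "real \<Rightarrow> real" where
  "energy T = strip_int T (\<lambda>t \<theta>. (Vt t \<theta>)\<^sup>2 + (V\<theta> t \<theta>)\<^sup>2)"

lemma energy_split:
  "energy T = strip_int T (\<lambda>t \<theta>. (Vt t \<theta>)\<^sup>2) + strip_int T (\<lambda>t \<theta>. (V\<theta> t \<theta>)\<^sup>2)"
  unfolding energy_def by (intro strip_int_add continuous_intros)

lemma energy_parts_nonneg:
  "0 \<le> strip_int T (\<lambda>t \<theta>. (Vt t \<theta>)\<^sup>2)" "0 \<le> strip_int T (\<lambda>t \<theta>. (V\<theta> t \<theta>)\<^sup>2)"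
  by (intro strip_int_nonneg continuous_intros; simp)+

text \<open>The one-dimensional inequality is used twice: in \<theta> for fixed t, leaving the
  integrals \<open>m j t\<close> over angular segments, then in t for each \<open>m j\<close>. The
  derivative of \<open>m j\<close> is the same integral of \<open>Vt\<close>, and Cauchy-Schwarz on
  a segment of length \<open>h\<close> bounds its square by \<open>h\<close> times an energy term,
  so both directions end with the factor \<open>h\<^sup>2\<close>.\<close>

lemma strip_Poincare:
  assumes "0 < N" and h: "h = 2*pi / real N"
  shows "strip_int (real M*h) (\<lambda>t \<theta>. (V t \<theta>)\<^sup>2) \<le> (\<Sum>j<N. \<Sum>i<M. (cell_integral V h i j)\<^sup>2 / h\<^sup>2)
    + h\<^sup>2 * energy (real M*h)" proof - have h0: "0 < h" using assms by simp
  have Nh: "real N * h = 2*pi" using assms by simp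
  define m where "m = (\<lambda>j t. integral {real j*h..real j*h+h} (V t))"
  define m' where "m' = (\<lambda>j t. integral {real j*h..real j*h+h} (Vt t))"
  have cm: "continuous_on S (m j)" "continuous_on S (m' j)" for j S
    unfolding m_def m'_def by (intro cont_int_left cont)+
  have dm: "(m j has_real_derivative m' j t) (at t)" for j t unfolding m_def m'_def
    using leibniz_rule_field_derivative[of UNIV "real j*h" "real j*h+h" V Vt t] deriv_t
    by (auto simp: cbox_interval case_prod_beta intro!: cont continuous2_left
        cont_integrable continuous_on_subset[OF cont(2)])
  let ?T = "real M*h"
  have "strip_int ?T (\<lambda>t \<theta>. (V t \<theta>)\<^sup>2) \<le>
     integral {0..?T} (\<lambda>t. (\<Sum>j<N. (m j t)\<^sup>2 / h) + h\<^sup>2 * integral {0..2*pi} (\<lambda>\<theta>. (V\<theta> t \<theta>)\<^sup>2))"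
    unfolding strip_int_def
  proof (intro integral_le cont_integrable continuous_intros
      cont_int_left cm)
    fix t
    show "integral {0..2*pi} (\<lambda>\<theta>. (V t \<theta>)\<^sup>2) \<le> (\<Sum>j<N. (m j t)\<^sup>2 / h) + h\<^sup>2 * integral {0..2*pi} (\<lambda>\<theta>. (V\<theta> t \<theta>)\<^sup>2)"
      using Poincare_subdivided[OF deriv_\<theta> _ h0, of t N] continuous2_left[OF cont(3)] Nh
      by (simp add: m_def)
  qed (use h0 in auto)
  also have "\<dots> = (\<Sum>j<N. integral {0..?T} (\<lambda>t. (m j t)\<^sup>2) / h) + h\<^sup>2 * strip_int ?T (\<lambda>t \<theta>. (V\<theta> t \<theta>)\<^sup>2)"
    unfolding strip_int_def using h0 by (subst integral_add integral_sum;
        auto intro!: cont_integrable continuous_intros cont_int_left cm)+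
  also have "(\<Sum>j<N. integral {0..?T} (\<lambda>t. (m j t)\<^sup>2) / h) \<le>
     (\<Sum>j<N. (\<Sum>i<M. (integral {real i*h..real i*h+h} (m j))\<^sup>2 / h\<^sup>2) + h * integral {0..?T} (\<lambda>t. (m' j t)\<^sup>2))"
  proof (intro sum_mono)
    fix j
    have "integral {0..?T} (\<lambda>t. (m j t)\<^sup>2) / h \<le> ((\<Sum>i<M. (integral {real i*h..real i*h+h} (m j))\<^sup>2 / h)
       + h\<^sup>2 * integral {0..?T} (\<lambda>t. (m' j t)\<^sup>2)) / h"
      using h0 by (intro divide_right_mono Poincare_subdivided[OF dm cm(2)]) auto
    also have "\<dots> = (\<Sum>i<M. (integral {real i*h..real i*h+h} (m j))\<^sup>2 / h\<^sup>2) + h * integral {0..?T} (\<lambda>t. (m' j t)\<^sup>2)"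
      using h0 by (simp add: add_divide_distrib sum_divide_distrib power2_eq_square)
    finally show "integral {0..?T} (\<lambda>t. (m j t)\<^sup>2) / h \<le>
      (\<Sum>i<M. (integral {real i*h..real i*h+h} (m j))\<^sup>2 / h\<^sup>2) + h * integral {0..?T} (\<lambda>t. (m' j t)\<^sup>2)" .
  qed
  also have "\<dots> = (\<Sum>j<N. \<Sum>i<M. (integral {real i*h..real i*h+h} (m j))\<^sup>2 / h\<^sup>2)
     + h * (\<Sum>j<N. integral {0..?T} (\<lambda>t. (m' j t)\<^sup>2))" by (simp add: sum.distrib sum_distrib_left)
  also have "(\<Sum>j<N. integral {0..?T} (\<lambda>t. (m' j t)\<^sup>2)) = integral {0..?T} (\<lambda>t. \<Sum>j<N. (m' j t)\<^sup>2)"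
    by (rule integral_sum[symmetric])
       (auto intro!: cont_integrable continuous_intros cm)
  also have "\<dots> \<le> integral {0..?T} (\<lambda>t. h * integral {0..2*pi} (\<lambda>\<theta>. (Vt t \<theta>)\<^sup>2))"
  proof (intro integral_le cont_integrable continuous_intros
      cont_int_left cm)
    fix t
    have "(m' j t)\<^sup>2 \<le> h * integral {real j*h..real j*h+h} (\<lambda>\<theta>. (Vt t \<theta>)\<^sup>2)" for j
      using integral_sq_le[OF continuous2_left[OF cont(2)], of "real j*h" "real j*h+h" t] h0
      by (simp add: m'_def)
    then have "(\<Sum>j<N. (m' j t)\<^sup>2) \<le> h * (\<Sum>j<N. integral {real j*h..real j*h+h} (\<lambda>\<theta>. (Vt t \<theta>)\<^sup>2))"
      by (auto simp: sum_distrib_left intro: sum_mono)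
    also have "(\<Sum>j<N. integral {real j*h..real j*h+h} (\<lambda>\<theta>. (Vt t \<theta>)\<^sup>2))
      = integral {0..real N*h} (\<lambda>\<theta>. (Vt t \<theta>)\<^sup>2)"
      by (intro sum_integral_cells h0 continuous_intros continuous2_left cont)
    finally show "(\<Sum>j<N. (m' j t)\<^sup>2) \<le> h * integral {0..2*pi} (\<lambda>\<theta>. (Vt t \<theta>)\<^sup>2)" by (simp add: Nh)
  qed
  also have "\<dots> = h * strip_int ?T (\<lambda>t \<theta>. (Vt t \<theta>)\<^sup>2)" by (simp add: strip_int_def)
  finally show ?thesis
    using h0 unfolding energy_split m_def by (simp add: algebra_simps power2_eq_square)
qed

text \<open>Cauchy-Schwarz over a segment of length \<open>h\<close> in each variable produces the
  factor \<open>h\<^sup>2\<close> that the left side divides out, so the bound does not deteriorate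
  as the mesh shrinks. It keeps the cell means of an energy-bounded sequence bounded, as extracting
  a convergent subsequence requires.\<close>

lemma cell_integral_bound:
  assumes "0 < N" and h: "h = 2*pi / real N" and "i < M" "j < N"
  shows "(cell_integral V h i j)\<^sup>2 / h\<^sup>2 \<le> strip_int (real M*h) (\<lambda>t \<theta>. (V t \<theta>)\<^sup>2)"
proof -
  have h0: "0 < h" using assms by simp
  have Nh: "real N * h = 2*pi" using assms by simp
  have sub: "real i*h+h \<le> real M*h" "real j*h+h \<le> 2*pi"
  proof -
    have "real (Suc i) * h \<le> real M*h" "real (Suc j) * h \<le> real N*h"
      using assms h0 by (intro mult_right_mono; simp)+
    then show "real i*h+h \<le> real M*h" "real j*h+h \<le> 2*pi" by (simp_all add: Nh distrib_right add.commute)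
  qed
  have "(cell_integral V h i j)\<^sup>2
     \<le> h * integral {real i*h..real i*h+h} (\<lambda>t. (integral {real j*h..real j*h+h} (V t))\<^sup>2)"
    using integral_sq_le[OF cont_int_left[OF cont(1)], of "real i*h" "real i*h+h"] h0 by simp
  also have "\<dots> \<le> h * integral {real i*h..real i*h+h} (\<lambda>t. h * integral {0..2*pi} (\<lambda>\<theta>. (V t \<theta>)\<^sup>2))"
  proof (intro mult_left_mono integral_le cont_integrable continuous_intros cont_int_left)
    fix t
    have "(integral {real j*h..real j*h+h} (V t))\<^sup>2 \<le> h * integral {real j*h..real j*h+h} (\<lambda>\<theta>. (V t \<theta>)\<^sup>2)"
      using integral_sq_le[OF continuous2_left[OF cont(1)], of "real j*h" "real j*h+h" t] h0 by simp
    also have "\<dots> \<le> h * integral {0..2*pi} (\<lambda>\<theta>. (V t \<theta>)\<^sup>2)"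
      using h0 sub by (intro mult_left_mono integral_subinterval_le continuous_intros continuous2_left cont) auto
    finally show "(integral {real j*h..real j*h+h} (V t))\<^sup>2 \<le> h * integral {0..2*pi} (\<lambda>\<theta>. (V t \<theta>)\<^sup>2)" .
  qed (use h0 in auto)
  also have "\<dots> = h\<^sup>2 * integral {real i*h..real i*h+h} (\<lambda>t. integral {0..2*pi} (\<lambda>\<theta>. (V t \<theta>)\<^sup>2))"
    by (simp add: power2_eq_square)
  also have "\<dots> \<le> h\<^sup>2 * strip_int (real M*h) (\<lambda>t \<theta>. (V t \<theta>)\<^sup>2)"
    unfolding strip_int_def using h0 sub
    by (intro mult_left_mono integral_subinterval_le continuous_intros cont_int_left
        integral_nonneg cont_integrable continuous2_left) auto
  finally show ?thesis using h0 by (simp add: field_simps)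
qed

end

section \<open>Functions with zero mean on every circle: Wirtinger inequality and even
  powers\<close>

locale mean_zero_strip_fn = strip_fn +
  assumes mean_zero: "integral {0..2*pi} (V t) = 0"
begin

text \<open>\<open>Poincare_interval\<close> on one full period: the mean term is zero, and
  \<open>h = 2*pi\<close> gives the constant.\<close>

lemma strip_Wirtinger: "strip_int T (\<lambda>t \<theta>. (V t \<theta>)\<^sup>2) \<le> 4 * pi\<^sup>2 * energy T"
proof -
  have "strip_int T (\<lambda>t \<theta>. (V t \<theta>)\<^sup>2) \<le> integral {0..T} (\<lambda>t. 4 * pi\<^sup>2 * integral {0..2*pi} (\<lambda>\<theta>. (V\<theta> t \<theta>)\<^sup>2))"
    unfolding strip_int_def
  proof (intro integral_le cont_integrable continuous_intros cont_int_left)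
    fix t
    show "integral {0..2*pi} (\<lambda>\<theta>. (V t \<theta>)\<^sup>2) \<le> 4 * pi\<^sup>2 * integral {0..2*pi} (\<lambda>\<theta>. (V\<theta> t \<theta>)\<^sup>2)"
      using Poincare_interval[OF deriv_\<theta>, of t "2*pi" 0] continuous2_left[OF cont(3)]
      by (simp add: mean_zero power2_eq_square)
  qed
  also have "\<dots> = 4 * pi\<^sup>2 * strip_int T (\<lambda>t \<theta>. (V\<theta> t \<theta>)\<^sup>2)" by (simp add: strip_int_def)
  also have "\<dots> \<le> 4 * pi\<^sup>2 * energy T"
    using energy_parts_nonneg[of T] by (intro mult_left_mono) (auto simp: energy_split)
  finally show ?thesis .
qed

text \<open>A Gagliardo type argument for the power \<open>W\<close> of \<open>V\<close>. The bound
  \<open>A t * B \<theta>\<close> for the square of \<open>W\<close> separates the variables, so the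
  double integral factors into two integrals of first derivatives of \<open>W\<close>. By AM-GM each
  is at most \<open>k / 2\<close> times the sum of a lower power integral and the energy; the
  product of the two gives the constant, and the exponent drops by 2.\<close>

lemma strip_power_step:
  assumes "0 < k"
  shows "strip_int T (\<lambda>t \<theta>. V t \<theta> ^ (2*k)) \<le>
    (real k)\<^sup>2 / 4 * (strip_int T (\<lambda>t \<theta>. V t \<theta> ^ (2*(k-1))) + energy T)\<^sup>2" proof -
  define W where "W = (\<lambda>t \<theta>. V t \<theta> ^ k)"
  define Wt where "Wt = (\<lambda>t \<theta>. real k * (V t \<theta> ^ (k-1) * Vt t \<theta>))"
  define W\<theta> where "W\<theta> = (\<lambda>t \<theta>. real k * (V t \<theta> ^ (k-1) * V\<theta> t \<theta>))"
  have cW [continuous_intros]: "continuous2 W" "continuous2 Wt" "continuous2 W\<theta>"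
    unfolding W_def Wt_def W\<theta>_def by (intro continuous_intros)+
  have dW: "((\<lambda>t. W t \<theta>) has_real_derivative Wt t \<theta>) (at t)"
    "(W t has_real_derivative W\<theta> t \<theta>) (at \<theta>)" for t \<theta> unfolding W_def Wt_def W\<theta>_def
    using DERIV_power[OF deriv_t[of \<theta> t], of k] DERIV_power[OF deriv_\<theta>[of t \<theta>], of k]
    by (simp_all add: mult.commute)
  define A where "A = (\<lambda>t. integral {0..2*pi} (\<lambda>\<theta>. \<bar>W\<theta> t \<theta>\<bar>))"
  define B where "B = (\<lambda>\<theta>. integral {0..T} (\<lambda>t. \<bar>Wt t \<theta>\<bar>))"
  have cA: "continuous_on S A" for S unfolding A_def by (intro cont_int_left continuous_intros)
  have cB: "continuous_on S B" for S unfolding B_def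
    using cont_int_left[OF continuous2_flip[OF continuous_on_rabs[OF cW(2)]], of S 0 T] by simp
  have A0: "0 \<le> A t" for t
    unfolding A_def by (intro integral_nonneg cont_integrable continuous_intros continuous2_left) auto
  have B0: "0 \<le> B t" for t
    unfolding B_def by (intro integral_nonneg cont_integrable continuous_intros continuous2_right) auto
  \<comment> \<open>The mean over the circle is 0, so \<open>V t\<close> vanishes somewhere on it,
    and so does its positive power. In \<open>WB\<close> the zero is the boundary point t = 0
    instead.\<close>
  have WA: "\<bar>W t \<theta>\<bar> \<le> A t" if "\<theta> \<in> {0..2*pi}" for t \<theta>
  proof -
    obtain \<xi> where \<xi>: "\<xi> \<in> {0..2*pi}" "V t \<xi> = 0"
      using integral_mean_attained[of 0 "2*pi" "V t"] continuous2_left[OF cont(1)] by (auto simp: mean_zero)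
    have "\<bar>W t \<theta> - W t \<xi>\<bar> \<le> A t"
      unfolding A_def using that \<xi> by (intro abs_diff_le_integral dW continuous2_left cW)
    then show ?thesis using \<xi> assms by (simp add: W_def zero_power)
  qed
  have WB: "\<bar>W t \<theta>\<bar> \<le> B \<theta>" if "t \<in> {0..T}" for t \<theta>
  proof -
    have "\<bar>W t \<theta> - W 0 \<theta>\<bar> \<le> B \<theta>"
      unfolding B_def using that by (intro abs_diff_le_integral dW continuous2_right cW) auto
    then show ?thesis using assms by (simp add: W_def boundary zero_power)
  qed
  have "strip_int T (\<lambda>t \<theta>. V t \<theta> ^ (2*k)) \<le> strip_int T (\<lambda>t \<theta>. A t * B \<theta>)"
  proof (rule strip_int_mono)
    show "continuous2 (\<lambda>t \<theta>. A t * B \<theta>)"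
      by (intro continuous_intros continuous_on_compose2[OF cA[of UNIV]] continuous_on_compose2[OF cB[of UNIV]]) auto
    fix t \<theta> assume "t \<in> {0..T}" "\<theta> \<in> {0..2*pi}"
    then have "\<bar>W t \<theta>\<bar> * \<bar>W t \<theta>\<bar> \<le> A t * B \<theta>" by (intro mult_mono WA WB A0) auto
    then show "V t \<theta> ^ (2*k) \<le> A t * B \<theta>"
      by (simp add: W_def power_mult mult.commute[of 2] power2_eq_square flip: abs_mult)
  qed (intro continuous_intros)
  also have "\<dots> = integral {0..T} A * integral {0..2*pi} B" by (simp add: strip_int_def)
  also have "\<dots> \<le> (real k / 2 * (strip_int T (\<lambda>t \<theta>. V t \<theta> ^ (2*(k-1))) + energy T))
      * (real k / 2 * (strip_int T (\<lambda>t \<theta>. V t \<theta> ^ (2*(k-1))) + energy T))" proof -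
    have amgm: "real k * \<bar>x ^ (k-1) * y\<bar> \<le> real k / 2 * (x ^ (2*(k-1)) + y\<^sup>2)" for x y :: real
    proof -
      have "2 * \<bar>x ^ (k-1)\<bar> * \<bar>y\<bar> \<le> (x ^ (k-1))\<^sup>2 + y\<^sup>2"
        using sum_squares_bound[of "\<bar>x ^ (k-1)\<bar>" "\<bar>y\<bar>"] by simp
      then have "real k / 2 * (2 * \<bar>x ^ (k-1)\<bar> * \<bar>y\<bar>) \<le> real k / 2 * ((x ^ (k-1))\<^sup>2 + y\<^sup>2)"
        by (intro mult_left_mono) auto
      then show ?thesis by (simp add: abs_mult power_mult mult.commute[of 2])
    qed
    have key: "strip_int T (\<lambda>t \<theta>. \<bar>real k * (V t \<theta> ^ (k-1) * Z t \<theta>)\<bar>)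
       \<le> real k / 2 * (strip_int T (\<lambda>t \<theta>. V t \<theta> ^ (2*(k-1))) + strip_int T (\<lambda>t \<theta>. (Z t \<theta>)\<^sup>2))"
      if Z: "continuous2 Z" for Z
    proof -
      have "strip_int T (\<lambda>t \<theta>. \<bar>real k * (V t \<theta> ^ (k-1) * Z t \<theta>)\<bar>)
         \<le> strip_int T (\<lambda>t \<theta>. real k / 2 * (V t \<theta> ^ (2*(k-1)) + (Z t \<theta>)\<^sup>2))"
        using amgm by (intro strip_int_mono continuous_intros Z) (auto simp: abs_mult)
      also have "\<dots> = real k / 2 * (strip_int T (\<lambda>t \<theta>. V t \<theta> ^ (2*(k-1))) + strip_int T (\<lambda>t \<theta>. (Z t \<theta>)\<^sup>2))"
        by (simp only: strip_int_cmult)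
           (subst strip_int_add; (intro continuous_intros Z)?; simp)
      finally show ?thesis .
    qed
    have "integral {0..T} A = strip_int T (\<lambda>t \<theta>. \<bar>real k * (V t \<theta> ^ (k-1) * V\<theta> t \<theta>)\<bar>)"
      unfolding A_def strip_int_def W\<theta>_def ..
    also have "\<dots> \<le> real k / 2 * (strip_int T (\<lambda>t \<theta>. V t \<theta> ^ (2*(k-1))) + energy T)"
      using key[OF cont(3)] energy_parts_nonneg[of T]
      by (elim order_trans, intro mult_left_mono) (auto simp: energy_split)
    finally have 1: "integral {0..T} A \<le> \<dots>" .
    \<comment> \<open>\<open>B\<close> integrates over t first; swapping the order turns its
      integral into one over the rectangle.\<close>
    have "integral {0..2*pi} B = strip_int T (\<lambda>t \<theta>. \<bar>real k * (V t \<theta> ^ (k-1) * Vt t \<theta>)\<bar>)"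
      unfolding B_def strip_int_def Wt_def
      by (rule integral_swap2[symmetric]) (intro continuous_intros)
    also have "\<dots> \<le> real k / 2 * (strip_int T (\<lambda>t \<theta>. V t \<theta> ^ (2*(k-1))) + energy T)"
      using key[OF cont(2)] energy_parts_nonneg[of T]
      by (elim order_trans, intro mult_left_mono) (auto simp: energy_split)
    finally have 2: "integral {0..2*pi} B \<le> \<dots>" .
    have "0 \<le> integral {0..2*pi} B" "0 \<le> integral {0..T} A"
      by (intro integral_nonneg cont_integrable cA cB A0 B0)+
    with 1 2 show ?thesis by (intro mult_mono) auto
  qed
  finally show ?thesis by (simp add: power2_eq_square mult_ac)
qed

end

text \<open>Bounds the integral of \<open>V\<close> to the power \<open>2 * Suc k\<close> for energy
  at most \<open>e\<close>. Index 0 is the square, handled by \<open>strip_Wirtinger\<close>, so the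
  step to \<open>Suc k\<close> uses \<open>strip_power_step\<close> with \<open>k + 2\<close>,
  whence the factor. It is a polynomial in \<open>e\<close> without constant term.\<close>

primrec pow_const :: "nat \<Rightarrow> real \<Rightarrow> real" where
  "pow_const 0 e = 4 * pi\<^sup>2 * e"
| "pow_const (Suc k) e = (real k + 2)\<^sup>2 / 4 * (pow_const k e + e)\<^sup>2"

lemma pow_const_nonneg: "0 \<le> e \<Longrightarrow> 0 \<le> pow_const k e"
  by (induction k) auto

lemma pow_const_0: "pow_const k 0 = 0"
  by (induction k) auto

lemma isCont_pow_const: "isCont (pow_const k) e"
  by (induction k) (auto intro!: continuous_intros)

lemma (in mean_zero_strip_fn) strip_power_bound:
  assumes "energy T \<le> e"
  shows "strip_int T (\<lambda>t \<theta>. V t \<theta> ^ (2 * Suc k)) \<le> pow_const k e"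
proof (induction k)
  case 0
  have "strip_int T (\<lambda>t \<theta>. (V t \<theta>)\<^sup>2) \<le> 4 * pi\<^sup>2 * energy T" by (rule strip_Wirtinger)
  also have "\<dots> \<le> 4 * pi\<^sup>2 * e" using assms by (intro mult_left_mono) auto
  finally show ?case by (simp add: eval_nat_numeral)
next
  case (Suc k)
  have "strip_int T (\<lambda>t \<theta>. V t \<theta> ^ (2 * Suc (Suc k))) \<le>
      (real (Suc (Suc k)))\<^sup>2 / 4 * (strip_int T (\<lambda>t \<theta>. V t \<theta> ^ (2 * Suc k)) + energy T)\<^sup>2"
    using strip_power_step[of "Suc (Suc k)" T] by simp
  also have "\<dots> \<le> (real (Suc (Suc k)))\<^sup>2 / 4 * (pow_const k e + e)\<^sup>2"
    using Suc assms energy_parts_nonneg[of T]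
    by (intro mult_left_mono power_mono add_mono add_nonneg_nonneg strip_int_nonneg continuous_intros)
       (auto simp: energy_split zero_le_even_power simp del: power_Suc mult_Suc_right)
  finally show ?case by (simp add: algebra_simps)
qed

section \<open>Conformal polar coordinates\<close>

lemma mem_box_vec2: "x \<in> box l u \<longleftrightarrow> l$1 < x$1 \<and> x$1 < u$1 \<and> l$2 < x$2 \<and> x$2 < u$2"
  for x l u :: "real^2" by (auto simp: mem_box_cart forall_2)

lemma prod_Basis_vec2: "(\<Prod>b\<in>Basis. f (x \<bullet> b)) = f (x$1) * f (x$2)" for x :: "real^2" and f :: "real \<Rightarrow> real"
proof -
  have B: "(Basis :: (real^2) set) = {axis 1 1, axis 2 1}" by (auto simp: Basis_vec_def UNIV_2)
  have "axis 1 1 \<noteq> (axis 2 1 :: real^2)" by (simp add: axis_eq_axis)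
  then show ?thesis unfolding B by (subst prod.insert) (simp_all add: inner_axis)
qed

text \<open>Iterated integrals live on pairs and the Jacobian formula on \<open>real^2\<close>; this
  identification preserves Lebesgue measure (\<open>distr_vec2\<close>) and links the two.\<close>

definition vec2 :: "real \<times> real \<Rightarrow> real^2" where
  "vec2 p = vector [fst p, snd p]"

lemma vec2_nth [simp]: "vec2 p $ 1 = fst p" "vec2 p $ 2 = snd p"
  by (simp_all add: vec2_def)

lemma continuous_on_vec2 [continuous_intros]:
  assumes "continuous_on S f" "continuous_on S g"
  shows "continuous_on S (\<lambda>x. vec2 (f x, g x))"
proof -
  have "vec2 (f x, g x) = f x *\<^sub>R axis 1 1 + g x *\<^sub>R axis 2 1" for x
    by (simp add: vec_eq_iff forall_2 axis_def)
  with assms show ?thesis by (simp add: continuous_intros)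
qed

lemma borel_measurable_vec2 [measurable]: "vec2 \<in> borel_measurable borel"
  using continuous_on_vec2[OF continuous_on_fst[OF continuous_on_id] continuous_on_snd[OF continuous_on_id], of UNIV]
  by (intro borel_measurable_continuous_onI) simp

lemma distr_vec2: "distr lborel borel vec2 = lborel"
proof (rule lborel_eqI[symmetric])
  fix l u :: "real^2"
  assume le: "\<And>b. b \<in> Basis \<Longrightarrow> l \<bullet> b \<le> u \<bullet> b"
  have le12: "l $ i \<le> u $ i" for i
    using le[of "axis i 1"] by (auto simp: Basis_vec_def inner_axis)
  have "p \<in> vec2 -` box l u \<longleftrightarrow> p \<in> box (l$1, l$2) (u$1, u$2)" for p
    unfolding vimage_eq mem_box_vec2 by (cases p) (auto simp: mem_box Basis_prod_def)
  then have "vec2 -` box l u = box (l$1, l$2) (u$1, u$2)" by blast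
  then have "emeasure (distr lborel borel vec2) (box l u) = emeasure lborel (box (l$1, l$2) (u$1, u$2))"
    by (simp add: emeasure_distr)
  also have "\<dots> = (u$1 - l$1) * (u$2 - l$2)" using le12 by (subst emeasure_lborel_box)
      (auto simp: Basis_prod_def prod.union_disjoint inner_diff_left image_constant_conv)
  also have "\<dots> = (\<Prod>b\<in>Basis. (u - l) \<bullet> b)" using prod_Basis_vec2[of "\<lambda>x. x" "u - l"] by simp
  finally show "emeasure (distr lborel borel vec2) (box l u) = (\<Prod>b\<in>Basis. (u - l) \<bullet> b)" .
qed simp

lemma nn_integral_vec2:
  assumes [measurable]: "F \<in> borel_measurable borel"
  shows "(\<integral>\<^sup>+x. F x \<partial>lborel) = (\<integral>\<^sup>+s. \<integral>\<^sup>+t. F (vec2 (s, t)) \<partial>lborel \<partial>lborel)"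
proof -
  have "(\<integral>\<^sup>+x. F x \<partial>lborel) = (\<integral>\<^sup>+p. F (vec2 p) \<partial>(lborel \<Otimes>\<^sub>M lborel))"
    by (subst distr_vec2[symmetric], subst nn_integral_distr) (auto simp: lborel_prod)
  also have "\<dots> = (\<integral>\<^sup>+s. \<integral>\<^sup>+t. F (vec2 (s, t)) \<partial>lborel \<partial>lborel)"
    by (subst lborel.nn_integral_fst[symmetric]) (auto simp: lborel_prod)
  finally show ?thesis .
qed

definition polar :: "real \<Rightarrow> real \<Rightarrow> real^2" where
  "polar t \<theta> = vec2 (exp (-t) * cos \<theta>, exp (-t) * sin \<theta>)"

lemma polar_nth [simp]: "polar t \<theta> $ 1 = exp (-t) * cos \<theta>" "polar t \<theta> $ 2 = exp (-t) * sin \<theta>"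
  by (simp_all add: polar_def)

lemma norm_vec2: "norm x = sqrt ((x$1)\<^sup>2 + (x$2)\<^sup>2)" for x :: "real^2"
  by (simp add: norm_vec_def L2_set_def UNIV_2)

lemma norm_polar [simp]: "norm (polar t \<theta>) = exp (-t)"
proof -
  have "(exp (-t) * cos \<theta>)\<^sup>2 + (exp (-t) * sin \<theta>)\<^sup>2 = (exp (-t))\<^sup>2 * ((sin \<theta>)\<^sup>2 + (cos \<theta>)\<^sup>2)"
    by (simp only: power_mult_distrib distrib_left add.commute)
  then show ?thesis by (simp add: norm_vec2)
qed

lemma continuous_on_polar [continuous_intros]:
  fixes S :: "'a::t2_space set"
  shows "continuous_on S f \<Longrightarrow> continuous_on S g \<Longrightarrow> continuous_on S (\<lambda>x. polar (f x) (g x))"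
  unfolding polar_def by (intro continuous_intros)

lemma polar_inj_on: "inj_on (\<lambda>p::real^2. polar (p$1) (p$2)) {p. 0 < p$2 \<and> p$2 < 2*pi}"
proof (rule inj_onI, clarsimp)
  fix x y :: "real^2"
  assume *: "0 < x$2" "x$2 < 2*pi" "0 < y$2" "y$2 < 2*pi"
    and eq: "polar (x$1) (x$2) = polar (y$1) (y$2)"
  have 1: "x$1 = y$1" using arg_cong[OF eq, of norm] by simp
  with eq have "sin (x$2) = sin (y$2) \<and> cos (x$2) = cos (y$2)" by (simp add: vec_eq_iff forall_2)
  then obtain n :: int where n: "x$2 = y$2 + 2*pi*n" unfolding sin_cos_eq_iff by blast
  with * have "2*pi*n < 2*pi*1" "2*pi*(-1) < 2*pi*n" by linarith+
  then have "real_of_int n < 1" "-1 < real_of_int n"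
    using mult_less_cancel_left_pos[of "2*pi" "real_of_int n" 1]
      mult_less_cancel_left_pos[of "2*pi" "-1" "real_of_int n"] by simp_all
  then have "n = 0" by linarith
  with 1 n show "x = y" by (simp add: vec_eq_iff forall_2)
qed

lemma polar_exists_angle:
  assumes "x \<noteq> 0"
  obtains \<theta> where "0 \<le> \<theta>" "\<theta> < 2*pi" "x = polar (- ln (norm x)) \<theta>"
proof -
  define r where "r = norm x"
  have r: "0 < r" using assms by (simp add: r_def)
  have "r\<^sup>2 = (x$1)\<^sup>2 + (x$2)\<^sup>2" by (simp add: r_def norm_vec2)
  then have "(x$1 / r)\<^sup>2 + (x$2 / r)\<^sup>2 = r\<^sup>2 / r\<^sup>2"
    by (simp only: power_divide add_divide_distrib)
  then have "(x$1 / r)\<^sup>2 + (x$2 / r)\<^sup>2 = 1" using r by simp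
  then obtain \<theta> where \<theta>: "0 \<le> \<theta>" "\<theta> < 2*pi" "x$1 / r = cos \<theta>" "x$2 / r = sin \<theta>"
    using sincos_total_2pi by blast
  have "x = polar (- ln r) \<theta>" using r \<theta>(3,4) by (simp add: vec_eq_iff forall_2 field_simps)
  then show ?thesis unfolding r_def by (rule that[OF \<theta>(1,2)])
qed

text \<open>Only the ray of angle 0 has to be left out; removing the whole line keeps the
  exceptional set null and makes \<theta> nonzero because \<open>sin \<theta>\<close> is.\<close>

lemma polar_surj:
  assumes "x \<in> unit_disc" "x$2 \<noteq> 0"
  obtains t \<theta> where "0 < t" "0 < \<theta>" "\<theta> < 2*pi" "x = polar t \<theta>"
proof -
  have x: "x \<noteq> 0" using assms by auto
  then obtain \<theta> where \<theta>: "0 \<le> \<theta>" "\<theta> < 2*pi" "x = polar (- ln (norm x)) \<theta>"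
    by (rule polar_exists_angle)
  have "x $ 2 = exp (- (- ln (norm x))) * sin \<theta>"
    using arg_cong[OF \<theta>(3), of "\<lambda>x. x $ 2"] by (simp only: polar_nth)
  then have "\<theta> \<noteq> 0" using assms(2) by auto
  with x \<theta>(1) assms(1) have "0 < - ln (norm x)" "0 < \<theta>" by auto
  then show ?thesis using \<theta>(2,3) by (rule that)
qed

definition half_strip :: "(real^2) set" where
  "half_strip = {p. 0 < p$1 \<and> 0 < p$2 \<and> p$2 < 2*pi}"

lemma half_strip_borel [measurable]: "half_strip \<in> sets borel"
  unfolding half_strip_def by measurable

definition polar_deriv :: "real^2 \<Rightarrow> real^2 \<Rightarrow> real^2" where
  "polar_deriv p h = vec2 (- (exp (-p$1) * cos (p$2) * h$1) - exp (-p$1) * sin (p$2) * h$2,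
     - (exp (-p$1) * sin (p$2) * h$1) + exp (-p$1) * cos (p$2) * h$2)"

lemma has_derivative_vec2:
  assumes "(f has_derivative f') F" "(g has_derivative g') F"
  shows "((\<lambda>x. vec2 (f x, g x)) has_derivative (\<lambda>h. vec2 (f' h, g' h))) F"
proof -
  have *: "vec2 (a, b) = a *\<^sub>R axis 1 1 + b *\<^sub>R axis 2 1" for a b
    by (simp add: vec_eq_iff forall_2 axis_def)
  show ?thesis unfolding * using assms by (intro derivative_intros)
qed

lemma polar_has_derivative:
  "((\<lambda>p. polar (p$1) (p$2)) has_derivative polar_deriv p) (at p within S)"
  unfolding polar_def polar_deriv_def by (rule has_derivative_vec2; rule has_derivative_eq_rhs)
     (auto intro!: derivative_eq_intros bounded_linear.has_derivative[OF bounded_linear_vec_nth]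
       simp: algebra_simps)

text \<open>The map reverses orientation, as the radius decreases in t, hence the absolute value.
  The Jacobian is the squared radius, which is what cancels the factor |x|^(-2) of the
  weight.\<close>

lemma det_polar_deriv: "\<bar>det (matrix (polar_deriv p))\<bar> = exp (-2 * p$1)"
proof -
  have "det (matrix (polar_deriv p)) = - ((exp (-p$1))\<^sup>2 * ((sin (p$2))\<^sup>2 + (cos (p$2))\<^sup>2))"
    by (simp add: det_2 matrix_def polar_deriv_def axis_def power2_eq_square algebra_simps
        del: sin_cos_squared_add sin_cos_squared_add2 sin_cos_squared_add3)
  also have "\<dots> = - exp (-2 * p$1)" by (simp flip: exp_add exp_double)
  finally show ?thesis by simp
qed

text \<open>Proved for sets, where the formula for the measure of an injective differentiable image
  applies; \<open>nn_integral_disc_polar\<close> turns it into an equality of measures and so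
  reaches every nonnegative Borel function.\<close>

lemma emeasure_polar_image:
  assumes "A \<in> sets borel"
  shows "emeasure lborel (A \<inter> unit_disc)
    = (\<integral>\<^sup>+p. indicator half_strip p * indicator A (polar (p$1) (p$2)) * ennreal (exp (-2 * p$1)) \<partial>lborel)"
proof -
  let ?P = "\<lambda>p::real^2. polar (p$1) (p$2)"
  have cP: "continuous_on UNIV ?P" by (intro continuous_intros)
  then have [measurable]: "?P \<in> borel_measurable borel" by (rule borel_measurable_continuous_onI)
  define S where "S = half_strip \<inter> ?P -` A"
  have S_borel: "S \<in> sets borel"
    unfolding S_def using measurable_sets[OF \<open>?P \<in> borel_measurable borel\<close> assms] by (auto simp: half_strip_borel)
  then have S: "S \<in> sets lebesgue" by auto
  have inj: "inj_on ?P S" by (rule inj_on_subset[OF polar_inj_on]) (auto simp: S_def half_strip_def)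
  have sub: "?P ` S \<subseteq> A \<inter> unit_disc" by (auto simp: S_def half_strip_def)
  have img: "?P ` S \<in> sets lebesgue" by (rule differentiable_image_in_sets_lebesgue[OF S])
       (auto simp: differentiable_on_def differentiable_def intro: polar_has_derivative)
  \<comment> \<open>What the image misses lies on the horizontal axis, a null set.\<close>
  have diff: "A \<inter> unit_disc - ?P ` S \<subseteq> {x. x$2 = 0}"
  proof
    fix x assume x: "x \<in> A \<inter> unit_disc - ?P ` S"
    show "x \<in> {x. x$2 = 0}"
    proof (rule ccontr)
      assume "x \<notin> {x. x$2 = 0}"
      then obtain t \<theta> where *: "0 < t" "0 < \<theta>" "\<theta> < 2*pi" "x = polar t \<theta>"
        using x polar_surj[of x thesis] by auto
      then have "vec2 (t, \<theta>) \<in> S" using x by (auto simp: S_def half_strip_def)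
      then have "?P (vec2 (t, \<theta>)) \<in> ?P ` S" by (rule imageI)
      with x * show False by simp
    qed
  qed
  have "negligible {x::real^2. x$2 = 0}" by (rule negligible_standard_hyperplane_cart)
  then have N: "A \<inter> unit_disc - ?P ` S \<in> null_sets lebesgue"
    using diff negligible_subset negligible_iff_null_sets by blast
  have fin: "emeasure lebesgue (?P ` S) < \<infinity>"
  proof -
    have "emeasure lebesgue (?P ` S) \<le> emeasure lebesgue unit_disc"
      using sub by (intro emeasure_mono) auto
    also have "\<dots> < \<infinity>" using emeasure_lborel_ball_finite by simp
    finally show ?thesis .
  qed
  have lm: "?P ` S \<in> lmeasurable" using img fin by (simp add: fmeasurable_def)
  then have int: "(\<lambda>p. exp (-2 * p$1)) integrable_on S"
    using measurable_differentiable_image_eq[OF S polar_has_derivative inj] by (simp add: det_polar_deriv)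
  have meas: "measure lebesgue (?P ` S) = integral S (\<lambda>p. exp (-2 * p$1))"
    using measure_differentiable_image_eq[OF S polar_has_derivative inj] int by (simp add: det_polar_deriv)
  have "emeasure lborel (A \<inter> unit_disc) = emeasure lebesgue (A \<inter> unit_disc)" using assms by simp
  also have "\<dots> = emeasure lebesgue (?P ` S \<union> (A \<inter> unit_disc - ?P ` S))"
    using sub by (intro arg_cong[of _ _ "emeasure lebesgue"]) auto
  also have "\<dots> = emeasure lebesgue (?P ` S)" using img N by (rule emeasure_Un_null_set)
  also have "\<dots> = ennreal (integral S (\<lambda>p. exp (-2 * p$1)))"
    using fin meas by (simp add: emeasure_eq_ennreal_measure less_top)
  also have "\<dots> = (\<integral>\<^sup>+p. ennreal (exp (-2 * p$1)) * indicator S p \<partial>lborel)"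
    by (rule nn_integral_has_integral_lebesgue'[OF _ integrable_integral[OF int], symmetric]) simp
  also have "\<dots> = (\<integral>\<^sup>+p. indicator half_strip p * indicator A (?P p) * ennreal (exp (-2 * p$1)) \<partial>lborel)"
    by (intro nn_integral_cong) (auto simp: S_def indicator_def)
  finally show ?thesis .
qed

lemma borel_measurable_polar [measurable]:
  "f \<in> borel_measurable M \<Longrightarrow> g \<in> borel_measurable M \<Longrightarrow> (\<lambda>x. polar (f x) (g x)) \<in> borel_measurable M"
proof -
  assume [measurable]: "f \<in> borel_measurable M" "g \<in> borel_measurable M"
  have [measurable]: "(\<lambda>p. polar (fst p) (snd p)) \<in> borel_measurable borel"
    by (intro borel_measurable_continuous_onI continuous_intros)
  have "(\<lambda>x. polar (fst (f x, g x)) (snd (f x, g x))) \<in> borel_measurable M" by measurable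
  then show ?thesis by simp
qed

section \<open>Integrals over the disc as limits of integrals over rectangles\<close>

lemma nn_integral_disc_measure:
  assumes "F \<in> borel_measurable borel"
  shows "(\<integral>\<^sup>+x. F x \<partial>disc_measure) = (\<integral>\<^sup>+x\<in>unit_disc. F x \<partial>lborel)"
  using assms by (subst nn_integral_restrict_space) (auto simp: nn_integral_completion)

abbreviation strip_nn :: "(real \<Rightarrow> real \<Rightarrow> ennreal) \<Rightarrow> ennreal" where
  "strip_nn F \<equiv> \<integral>\<^sup>+t\<in>{0<..}. (\<integral>\<^sup>+\<theta>\<in>{0..2*pi}. F t \<theta> \<partial>lborel) \<partial>lborel"

lemma nn_integral_disc_polar:
  assumes [measurable]: "F \<in> borel_measurable borel"
  shows "(\<integral>\<^sup>+x. F x \<partial>disc_measure) = strip_nn (\<lambda>t \<theta>. F (polar t \<theta>) * ennreal (exp (-2*t)))"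
proof -
  let ?P = "\<lambda>p::real^2. polar (p$1) (p$2)"
  let ?w = "\<lambda>p::real^2. indicator half_strip p * ennreal (exp (-2 * p$1))"
  have ind: "(indicator unit_disc :: real^2 \<Rightarrow> ennreal) \<in> borel_measurable borel"
    by (rule borel_measurable_indicator) simp
  \<comment> \<open>The pushforward of exp(-2t) dt d\<theta> on the open half strip is Lebesgue
    measure on the disc.\<close>
  have eq: "density lborel (indicator unit_disc) = distr (density lborel ?w) borel ?P"
  proof (rule measure_eqI)
    fix A assume "A \<in> sets (density lborel (indicator unit_disc :: real^2 \<Rightarrow> ennreal))"
    then have [measurable]: "A \<in> sets borel" by simp
    have "emeasure (density lborel (indicator unit_disc)) A = emeasure lborel (A \<inter> unit_disc)"
      using emeasure_density[of "indicator unit_disc" lborel A] ind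
      by (simp add: Int_commute flip: indicator_inter_arith)
    also have "\<dots> = emeasure (distr (density lborel ?w) borel ?P) A"
    proof -
      have V: "?P -` A \<in> sets borel"
        by (rule measurable_sets_borel[of ?P borel A, simplified]) measurable
      show ?thesis using emeasure_polar_image[of A] V by (simp add: emeasure_distr emeasure_density)
           (auto simp: mult_ac indicator_def intro!: nn_integral_cong)
    qed
    finally show "emeasure (density lborel (indicator unit_disc)) A = \<dots>" .
  qed simp
  have "(\<integral>\<^sup>+x. F x \<partial>disc_measure) = (\<integral>\<^sup>+x. F x \<partial>density lborel (indicator unit_disc))"
    using nn_integral_density[of "indicator unit_disc" lborel F] ind
    by (simp add: nn_integral_disc_measure assms mult.commute)
  also have "\<dots> = (\<integral>\<^sup>+p. ?w p * F (?P p) \<partial>lborel)"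
    unfolding eq by (subst nn_integral_distr) (auto simp: nn_integral_density)
  also have "\<dots> = (\<integral>\<^sup>+t. \<integral>\<^sup>+\<theta>. ?w (vec2 (t, \<theta>)) * F (polar t \<theta>) \<partial>lborel \<partial>lborel)"
    by (subst nn_integral_vec2) auto
  also have "\<dots> = strip_nn (\<lambda>t \<theta>. F (polar t \<theta>) * ennreal (exp (-2*t)))"
  proof (intro nn_integral_cong)
    fix t :: real
    have "(\<integral>\<^sup>+\<theta>. ?w (vec2 (t, \<theta>)) * F (polar t \<theta>) \<partial>lborel)
      = (\<integral>\<^sup>+\<theta>. (F (polar t \<theta>) * ennreal (exp (-2*t)) * indicator {0..2*pi} \<theta>) * indicator {0<..} t \<partial>lborel)"
    proof (rule nn_integral_cong_AE)
      \<comment> \<open>The open angle interval of \<open>half_strip\<close> and the closed one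
        differ by two points.\<close>
      show "AE \<theta> in lborel. ?w (vec2 (t, \<theta>)) * F (polar t \<theta>)
        = (F (polar t \<theta>) * ennreal (exp (-2*t)) * indicator {0..2*pi} \<theta>) * indicator {0<..} t"
        using AE_lborel_singleton[of 0] AE_lborel_singleton[of "2*pi"]
        by eventually_elim (auto simp: half_strip_def indicator_def mult_ac)
    qed
    then show "(\<integral>\<^sup>+\<theta>. ?w (vec2 (t, \<theta>)) * F (polar t \<theta>) \<partial>lborel)
      = (\<integral>\<^sup>+\<theta>\<in>{0..2*pi}. F (polar t \<theta>) * ennreal (exp (-2*t)) \<partial>lborel) * indicator {0<..} t"
      by (subst (asm) nn_integral_multc) auto
  qed
  finally show ?thesis .
qed

lemma nn_integral_eq_strip_int:
  assumes G: "continuous2 G" and nonneg: "\<And>t \<theta>. 0 \<le> G t \<theta>"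
  shows "(\<integral>\<^sup>+\<theta>\<in>{0..2*pi}. ennreal (G t \<theta>) \<partial>lborel) = ennreal (integral {0..2*pi} (G t))" (is ?inner)
    and "(\<integral>\<^sup>+t\<in>{0..T}. ennreal (integral {0..2*pi} (G t)) \<partial>lborel) = ennreal (strip_int T G)"
proof -
  show ?inner by (intro nn_integral_has_integral_lebesgue' integrable_integral cont_integrable
        continuous2_left G nonneg)
  show "(\<integral>\<^sup>+t\<in>{0..T}. ennreal (integral {0..2*pi} (G t)) \<partial>lborel) = ennreal (strip_int T G)"
    unfolding strip_int_def
    by (intro nn_integral_has_integral_lebesgue' integrable_integral cont_integrable
        cont_int_left integral_nonneg continuous2_left G nonneg)
qed

text \<open>Monotone convergence over the rectangles up to \<open>n\<close>. It turns bounds uniform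
  in \<open>n\<close> into bounds over the whole disc before any integrability there is
  known.\<close>

lemma nn_integral_half_strip:
  assumes G: "continuous2 G" and nonneg: "\<And>t \<theta>. 0 \<le> G t \<theta>"
  shows "strip_nn (\<lambda>t \<theta>. ennreal (G t \<theta>)) = (SUP n. ennreal (strip_int (real n) G))"
proof -
  let ?g = "\<lambda>t. ennreal (integral {0..2*pi} (G t))"
  have [measurable]: "(\<lambda>t. integral {0..2*pi} (G t)) \<in> borel_measurable borel"
    by (intro borel_measurable_continuous_onI cont_int_left G)
  have "strip_nn (\<lambda>t \<theta>. ennreal (G t \<theta>)) = (\<integral>\<^sup>+t. ?g t * indicator {0<..} t \<partial>lborel)"
    by (simp add: nn_integral_eq_strip_int(1)[OF G nonneg])
  also have "\<dots> = (\<integral>\<^sup>+t. (SUP n. ?g t * indicator {0..real n} t) \<partial>lborel)"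
  proof (rule nn_integral_cong_AE)
    \<comment> \<open>The point t = 0 belongs to \<open>{0..real n}\<close> but not to
      \<open>{0<..}\<close>.\<close>
    show "AE t in lborel. ?g t * indicator {0<..} t = (SUP n. ?g t * indicator {0..real n} t)"
      using AE_lborel_singleton[of 0]
    proof eventually_elim
      fix t :: real assume "t \<noteq> 0"
      show "?g t * indicator {0<..} t = (SUP n. ?g t * indicator {0..real n} t)"
      proof (cases "t < 0")
        case True
        then show ?thesis by simp
      next
        case False
        obtain m :: nat where "t \<le> real m" using real_arch_simple by blast
        with False \<open>t \<noteq> 0\<close> show ?thesis
          by (intro antisym SUP_upper2[of m] SUP_least) (auto simp: indicator_def)
      qed
    qed
  qed
  also have "\<dots> = (SUP n. \<integral>\<^sup>+t. ?g t * indicator {0..real n} t \<partial>lborel)"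
    by (rule nn_integral_monotone_convergence_SUP)
       (auto simp: incseq_def le_fun_def indicator_def)
  also have "\<dots> = (SUP n. ennreal (strip_int (real n) G))"
    by (simp add: nn_integral_eq_strip_int(2)[OF G nonneg])
  finally show ?thesis .
qed

lemma nn_integral_half_strip_le:
  assumes "continuous2 G" "\<And>t \<theta>. 0 \<le> G t \<theta>" "\<And>n::nat. strip_int (real n) G \<le> B"
  shows "strip_nn (\<lambda>t \<theta>. ennreal (G t \<theta>)) \<le> ennreal B"
  unfolding nn_integral_half_strip[OF assms(1,2)] by (intro SUP_least ennreal_leI assms(3))

lemma integral_periodic_shift:
  fixes f :: "real \<Rightarrow> real"
  assumes f: "continuous_on UNIV f" and per: "\<And>x. f (x + p) = f x" and a: "0 \<le> a" "a \<le> p"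
  shows "integral {0..p} (\<lambda>x. f (a + x)) = integral {0..p} f"
proof -
  have cf: "f integrable_on {c..d}" for c d
    by (intro cont_integrable continuous_on_subset[OF f]) auto
  have "integral {0..p} (\<lambda>x. f (a + x)) = integral {a..p+a} f"
    using integral_shift_Icc_real[of 0 p f a] by (simp add: o_def)
  also have "\<dots> = integral {a..p} f + integral {p..p+a} f"
    using a by (intro Henstock_Kurzweil_Integration.integral_combine[symmetric] cf) auto
  also have "integral {p..p+a} f = integral {0..a} f"
    using integral_shift_Icc_real[of 0 a f p] per by (simp add: o_def add.commute)
  also have "integral {a..p} f + integral {0..a} f = integral {0..p} f"
    using Henstock_Kurzweil_Integration.integral_combine[OF a cf] by simp
  finally show ?thesis .
qed

section \<open>Rotational averages of smooth functions\<close>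

lemma grad_nth: "grad f x $ i = partial i f x"
  by (simp add: grad_def)

lemma grad_has_derivative:
  assumes "f differentiable (at x)"
  shows "(f has_derivative (\<lambda>h. grad f x \<bullet> h)) (at x)"
proof -
  have d: "(f has_derivative frechet_derivative f (at x)) (at x)"
    using assms by (simp add: frechet_derivative_works)
  interpret bounded_linear "frechet_derivative f (at x)"
    using d by (rule has_derivative_bounded_linear)
  have "frechet_derivative f (at x) h = grad f x \<bullet> h" for h
  proof -
    have "h = (h$1) *\<^sub>R axis 1 1 + (h$2) *\<^sub>R axis 2 1" by (simp add: vec_eq_iff forall_2 axis_def)
    then have "frechet_derivative f (at x) h = (h$1) * partial 1 f x + (h$2) * partial 2 f x"
      by (metis add scaleR partial_def real_scaleR_def)
    also have "\<dots> = grad f x \<bullet> h" by (simp add: inner_vec_def sum_2 grad_nth)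
    finally show ?thesis .
  qed
  then have "frechet_derivative f (at x) = (\<lambda>h. grad f x \<bullet> h)" by blast
  with d show ?thesis by simp
qed

lemma partial_eq:
  assumes "(f has_derivative f') (at x)"
  shows "partial i f x = f' (axis i 1)"
  unfolding partial_def using frechet_derivative_at[OF assms] by simp

lemma C_k_Suc_imp: "C_k (Suc k) f \<Longrightarrow> C_k k f"
proof (induction k arbitrary: f)
  case 0
  then have "isCont f x" for x using differentiable_imp_continuous_within[of f x UNIV] by simp
  then show ?case by (simp add: continuous_at_imp_continuous_on)
qed simp

lemma C_k_continuous_on: "C_k k f \<Longrightarrow> continuous_on S f"
proof (induction k)
  case 0
  then show ?case using continuous_on_subset by auto
qed (use C_k_Suc_imp in blast)

lemma C_k_lincomb: "C_k k f \<Longrightarrow> C_k k g \<Longrightarrow> C_k k (\<lambda>x. a * f x + b * g x)"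
proof (induction k arbitrary: f g)
  case 0
  then show ?case by (auto intro!: continuous_intros)
next
  case (Suc k)
  have d: "((\<lambda>x. a * f x + b * g x) has_derivative (\<lambda>h. a * (grad f x \<bullet> h) + b * (grad g x \<bullet> h))) (at x)" for x
    using Suc.prems by (auto intro!: derivative_intros grad_has_derivative)
  then have "partial i (\<lambda>x. a * f x + b * g x) = (\<lambda>x. a * partial i f x + b * partial i g x)" for i
    by (auto simp: partial_eq[OF d] inner_axis grad_nth)
  with Suc d show ?case by (auto simp: differentiable_def)
qed

lemma grad_lincomb:
  assumes "f differentiable (at x)" "g differentiable (at x)"
  shows "grad (\<lambda>x. a * f x + b * g x) x = a *\<^sub>R grad f x + b *\<^sub>R grad g x"
proof -
  have "((\<lambda>x. a * f x + b * g x) has_derivative (\<lambda>h. a * (grad f x \<bullet> h) + b * (grad g x \<bullet> h))) (at x)"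
    using assms by (intro derivative_intros grad_has_derivative)
  from partial_eq[OF this] show ?thesis by (simp add: vec_eq_iff grad_nth inner_axis)
qed

lemma continuous_on_grad:
  assumes "C_k (Suc k) f"
  shows "continuous_on S (grad f)"
proof -
  have "grad f = (\<lambda>x. partial 1 f x *\<^sub>R axis 1 1 + partial 2 f x *\<^sub>R axis 2 1)"
    by (simp add: fun_eq_iff vec_eq_iff forall_2 axis_def grad_nth)
  moreover have "continuous_on S (partial i f)" for i
    using assms C_k_continuous_on[of k "partial i f"] by simp
  ultimately show ?thesis by (simp add: continuous_intros)
qed

definition rot :: "real \<Rightarrow> real^2 \<Rightarrow> real^2" where
  "rot \<theta> x = vec2 (cos \<theta> * x$1 - sin \<theta> * x$2, sin \<theta> * x$1 + cos \<theta> * x$2)"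

lemma rot_polar: "rot \<theta> (polar t \<alpha>) = polar t (\<alpha> + \<theta>)"
  by (simp add: rot_def vec_eq_iff forall_2 cos_add sin_add algebra_simps)

lemma norm_rot [simp]: "norm (rot \<theta> x) = norm x"
proof -
  have "(cos \<theta> * x$1 - sin \<theta> * x$2)\<^sup>2 + (sin \<theta> * x$1 + cos \<theta> * x$2)\<^sup>2
    = ((sin \<theta>)\<^sup>2 + (cos \<theta>)\<^sup>2) * ((x$1)\<^sup>2 + (x$2)\<^sup>2)" unfolding power2_eq_square by algebra
  then show ?thesis by (simp add: norm_vec2 rot_def)
qed

lemma inner_rot: "v \<bullet> rot \<theta> h = rot (-\<theta>) v \<bullet> h"
  by (simp add: rot_def inner_vec_def sum_2 algebra_simps)

lemma continuous_on_rot [continuous_intros]: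
  fixes S :: "'a::t2_space set"
  shows "continuous_on S f \<Longrightarrow> continuous_on S g \<Longrightarrow> continuous_on S (\<lambda>x. rot (f x) (g x))"
  unfolding rot_def by (intro continuous_intros)

lemma bounded_linear_rot: "bounded_linear (rot \<theta>)"
  unfolding rot_def linear_conv_bounded_linear[symmetric]
  by (intro linearI) (auto simp: vec_eq_iff forall_2 algebra_simps)

text \<open>The coefficient \<open>c\<close> makes the class closed under differentiation: by
  \<open>partial_rot_avg\<close> a partial derivative is a sum of averages of the partial
  derivatives of \<open>f\<close>, with \<open>c\<close> multiplied by trigonometric functions.
  Smoothness then follows by induction with \<open>c\<close> arbitrary.\<close>

definition rot_avg :: "(real \<Rightarrow> real) \<Rightarrow> (real^2 \<Rightarrow> real) \<Rightarrow> real^2 \<Rightarrow> real" where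
  "rot_avg c f x = integral {0..2*pi} (\<lambda>\<theta>. c \<theta> * f (rot \<theta> x))"

lemma rot_avg_has_derivative:
  assumes f: "C_k (Suc 0) f" and c: "continuous_on UNIV c"
  shows "(rot_avg c f has_derivative
    (\<lambda>h. integral {0..2*pi} (\<lambda>\<theta>. c \<theta> * (grad f (rot \<theta> x) \<bullet> rot \<theta> h)))) (at x)" proof -
  note [continuous_intros] = continuous_on_compose2[OF C_k_continuous_on[OF f, of UNIV]]
    continuous_on_compose2[OF continuous_on_grad[OF f, of UNIV]]
    continuous_on_compose2[OF c] bounded_linear.continuous_on[OF bounded_linear_blinfun_inner_right]
  \<comment> \<open>Moving the rotation onto the gradient (\<open>inner_rot\<close>) writes the
    derivative as an inner product with a vector continuous in \<open>(x, \<theta>)\<close>, hence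
    as the continuous family of bounded functionals that the Leibniz rule takes.\<close>
  define F where "F = (\<lambda>x \<theta>. blinfun_inner_right (c \<theta> *\<^sub>R rot (-\<theta>) (grad f (rot \<theta> x))))"
  have F: "blinfun_apply (F x \<theta>) = (\<lambda>h. c \<theta> * (grad f (rot \<theta> x) \<bullet> rot \<theta> h))" for x \<theta>
    by (auto simp: F_def inner_rot)
  have Fc: "continuous_on (UNIV \<times> cbox 0 (2*pi)) (\<lambda>(x, \<theta>). F x \<theta>)"
    unfolding F_def case_prod_beta by (intro continuous_intros) auto
  have "((\<lambda>x. integral (cbox 0 (2*pi)) (\<lambda>\<theta>. c \<theta> * f (rot \<theta> x))) has_derivative
      integral (cbox 0 (2*pi)) (F x)) (at x within UNIV)" proof (rule leibniz_rule[OF _ _ Fc])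
    show "((\<lambda>x. c \<theta> * f (rot \<theta> x)) has_derivative blinfun_apply (F x \<theta>)) (at x within UNIV)" for x \<theta>
      unfolding F
      using f by (auto intro!: derivative_eq_intros has_derivative_compose[OF bounded_linear_imp_has_derivative[OF bounded_linear_rot] grad_has_derivative])
    show "(\<lambda>\<theta>. c \<theta> * f (rot \<theta> x)) integrable_on cbox 0 (2*pi)" for x
      by (intro integrable_continuous continuous_intros) auto
  qed auto
  moreover have "blinfun_apply (integral (cbox 0 (2*pi)) (F x)) =
     (\<lambda>h. integral {0..2*pi} (\<lambda>\<theta>. c \<theta> * (grad f (rot \<theta> x) \<bullet> rot \<theta> h)))" proof fix h
    have "F x integrable_on {0..2*pi}"
      unfolding F_def by (intro cont_integrable continuous_intros) auto
    then show "blinfun_apply (integral (cbox 0 (2*pi)) (F x)) h =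
      integral {0..2*pi} (\<lambda>\<theta>. c \<theta> * (grad f (rot \<theta> x) \<bullet> rot \<theta> h))"
      by (simp add: blinfun_apply_integral F cbox_interval)
  qed
  ultimately show ?thesis unfolding rot_avg_def[abs_def] by (simp add: cbox_interval)
qed

lemma partial_rot_avg:
  assumes f: "C_k (Suc 0) f" and c: "continuous_on UNIV c"
  shows "partial i (rot_avg c f) = (\<lambda>x. rot_avg (\<lambda>\<theta>. c \<theta> * (rot \<theta> (axis i 1) $ 1)) (partial 1 f) x
    + rot_avg (\<lambda>\<theta>. c \<theta> * (rot \<theta> (axis i 1) $ 2)) (partial 2 f) x)" proof fix x
  note [continuous_intros] = continuous_on_compose2[OF continuous_on_component]
    continuous_on_compose2[OF c]
  have p: "continuous_on UNIV (partial j f)" for j using f by simp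
  note [continuous_intros] = continuous_on_compose2[OF p]
  have *: "(\<lambda>\<theta>. c \<theta> * (rot \<theta> (axis i 1) $ j) * partial j f (rot \<theta> x)) integrable_on {0..2*pi}" for j
    by (intro cont_integrable continuous_intros) auto
  have "partial i (rot_avg c f) x = integral {0..2*pi} (\<lambda>\<theta>. c \<theta> * (grad f (rot \<theta> x) \<bullet> rot \<theta> (axis i 1)))"
    by (rule partial_eq[OF rot_avg_has_derivative[OF assms]])
  also have "\<dots> = integral {0..2*pi} (\<lambda>\<theta>. c \<theta> * (rot \<theta> (axis i 1) $ 1) * partial 1 f (rot \<theta> x)
      + c \<theta> * (rot \<theta> (axis i 1) $ 2) * partial 2 f (rot \<theta> x))"
    by (intro integral_cong) (simp add: inner_vec_def sum_2 grad_nth algebra_simps)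
  also have "\<dots> = rot_avg (\<lambda>\<theta>. c \<theta> * (rot \<theta> (axis i 1) $ 1)) (partial 1 f) x
    + rot_avg (\<lambda>\<theta>. c \<theta> * (rot \<theta> (axis i 1) $ 2)) (partial 2 f) x"
    unfolding rot_avg_def by (intro integral_add *)
  finally show "partial i (rot_avg c f) x = \<dots>" .
qed

lemma C_k_rot_avg: "C_k k f \<Longrightarrow> continuous_on UNIV c \<Longrightarrow> C_k k (rot_avg c f)"
proof (induction k arbitrary: f c)
  case 0
  then have "continuous_on UNIV f" by simp
  note [continuous_intros] = continuous_on_compose2[OF this] continuous_on_compose2[OF 0(2)]
  have "continuous_on UNIV (\<lambda>x. integral (cbox 0 (2*pi)) (\<lambda>\<theta>. c \<theta> * f (rot \<theta> x)))"
    by (intro integral_continuous_on_param) (auto simp: case_prod_beta intro!: continuous_intros)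
  then show ?case by (simp add: rot_avg_def[abs_def] cbox_interval)
next
  case (Suc k)
  have f: "C_k (Suc 0) f" using Suc.prems(1) C_k_continuous_on[of k] by auto
  have "C_k k (partial i (rot_avg c f))" for i
  proof -
    have "continuous_on UNIV (\<lambda>\<theta>. c \<theta> * (rot \<theta> (axis i 1) $ j))" for j
      by (intro continuous_intros Suc.prems(2))
    then have "C_k k (rot_avg (\<lambda>\<theta>. c \<theta> * (rot \<theta> (axis i 1) $ j)) (partial l f))" for j l
      using Suc.prems(1) by (intro Suc.IH) simp
    from C_k_lincomb[OF this this, of 1 1 1 1 2 2] show ?thesis
      by (simp add: partial_rot_avg[OF f Suc.prems(2)])
  qed
  moreover have "rot_avg c f differentiable (at x)" for x
    using rot_avg_has_derivative[OF f Suc.prems(2)] by (auto simp: differentiable_def)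
  ultimately show ?case by simp
qed

section \<open>Weighted estimates on the half strip\<close>

text \<open>Split at \<open>\<bar>s\<bar> = K\<close>: below,
  \<open>\<bar>s\<bar> powr (q - 2)\<close> is at most its value at \<open>K\<close>; above, one
  spare power of \<open>\<bar>s\<bar>\<close> pays for the factor \<open>1 / K\<close>, which is why
  \<open>q + 1\<close> is compared with the even exponent. With \<open>K = 1\<close> this is plain
  interpolation; for large \<open>K\<close> a bounded high power becomes negligible and only the
  square has to be made small.\<close>

lemma powr_le_squares_scaled:
  fixes s q K :: real
  assumes "2 \<le> q" "q + 1 \<le> real (2 * Suc k)" "1 \<le> K"
  shows "\<bar>s\<bar> powr q \<le> K powr (q - 2) * s\<^sup>2 + s ^ (2 * Suc k) / K"
proof (cases "s = 0")
  case False
  have 2: "\<bar>s\<bar> powr 2 = s\<^sup>2" using False by (simp add: powr_numeral)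
  have m: "\<bar>s\<bar> powr real (2 * Suc k) = s ^ (2 * Suc k)"
    using False by (subst powr_realpow) (auto simp: power_mult)
  have ge: "0 \<le> s ^ (2 * Suc k)" by (rule zero_le_even_power) simp
  show ?thesis
  proof (cases "\<bar>s\<bar> \<le> K")
    case True
    have "\<bar>s\<bar> powr q = \<bar>s\<bar> powr (q - 2) * \<bar>s\<bar> powr 2" by (subst powr_add[symmetric]) simp
    also have "\<dots> \<le> K powr (q - 2) * \<bar>s\<bar> powr 2"
      using True assms by (intro mult_right_mono powr_mono2) auto
    finally show ?thesis using 2 ge assms by (simp add: add_increasing2)
  next
    case c: False
    have "K * \<bar>s\<bar> powr q \<le> \<bar>s\<bar> * \<bar>s\<bar> powr q" using c by (intro mult_right_mono) auto
    also have "\<dots> = \<bar>s\<bar> powr (q + 1)" using False by (simp add: powr_add)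
    also have "\<dots> \<le> \<bar>s\<bar> powr real (2 * Suc k)" using c assms by (intro powr_mono) auto
    finally have "\<bar>s\<bar> powr q \<le> s ^ (2 * Suc k) / K" unfolding m using assms by (simp add: field_simps)
    then show ?thesis by (simp add: add_increasing)
  qed
qed simp

lemma continuous2_powr:
  "continuous2 V \<Longrightarrow> 0 < q \<Longrightarrow> continuous2 (\<lambda>t \<theta>. \<bar>V t \<theta>\<bar> powr q)"
  by (intro continuous_on_powr' continuous_intros) auto

lemma (in mean_zero_strip_fn) strip_powr_bound:
  assumes "energy T \<le> e" and q: "2 \<le> q" "q + 1 \<le> real (2 * Suc k)"
  shows "strip_int T (\<lambda>t \<theta>. \<bar>V t \<theta>\<bar> powr q) \<le> pow_const 0 e + pow_const k e"
proof -
  have "strip_int T (\<lambda>t \<theta>. \<bar>V t \<theta>\<bar> powr q)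
    \<le> strip_int T (\<lambda>t \<theta>. V t \<theta> ^ (2 * Suc 0) + V t \<theta> ^ (2 * Suc k))"
  proof (intro strip_int_mono continuous2_powr cont continuous_intros)
    show "\<bar>V t \<theta>\<bar> powr q \<le> V t \<theta> ^ (2 * Suc 0) + V t \<theta> ^ (2 * Suc k)" for t \<theta>
      using powr_le_squares_scaled[OF q, of 1 "V t \<theta>"] by (simp add: numeral_2_eq_2)
  qed (use q in auto)
  also have "\<dots> = strip_int T (\<lambda>t \<theta>. V t \<theta> ^ (2 * Suc 0)) + strip_int T (\<lambda>t \<theta>. V t \<theta> ^ (2 * Suc k))"
    by (intro strip_int_add continuous_intros cont)
  also have "\<dots> \<le> pow_const 0 e + pow_const k e" by (intro add_mono strip_power_bound assms)
  finally show ?thesis .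
qed

locale strip_weight =
  fixes w :: "real \<Rightarrow> real"
  assumes w_cont: "continuous_on UNIV w"
    and w_antimono: "\<And>s t. 0 \<le> s \<Longrightarrow> s \<le> t \<Longrightarrow> w t \<le> w s"
    and w_nonneg: "\<And>t. 0 \<le> w t"
begin

lemma continuous2_weighted: "continuous2 G \<Longrightarrow> continuous2 (\<lambda>t \<theta>. w t * G t \<theta>)"
  by (intro continuous_intros continuous_on_compose2[OF w_cont]) auto

text \<open>\<open>S\<close> is the cut. The second integral may run over the whole rectangle, since
  it is the factor \<open>w S\<close> that becomes small.\<close>

lemma strip_int_weight_split:
  assumes G: "continuous2 G" and nonneg: "\<And>t \<theta>. 0 \<le> G t \<theta>" and "0 \<le> S"
  shows "strip_int T (\<lambda>t \<theta>. w t * G t \<theta>) \<le> w 0 * strip_int S G + w S * strip_int T G"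
proof (cases "T \<le> S")
  case True
  have "strip_int T (\<lambda>t \<theta>. w t * G t \<theta>) \<le> strip_int T (\<lambda>t \<theta>. w 0 * G t \<theta>)"
    by (intro strip_int_mono continuous2_weighted G continuous_intros mult_right_mono w_antimono nonneg) auto
  also have "\<dots> \<le> w 0 * strip_int S G" unfolding strip_int_cmult
    by (intro mult_left_mono strip_int_extend_le G True w_nonneg nonneg)
  finally show ?thesis
    using mult_nonneg_nonneg[OF w_nonneg[of S] strip_int_nonneg[OF G nonneg, of T]] by simp
next
  case False
  define g where "g = (\<lambda>t. integral {0..2*pi} (G t))"
  have cg: "continuous_on A g" for A unfolding g_def by (intro cont_int_left G)
  have g0: "0 \<le> g t" for t
    unfolding g_def by (intro integral_nonneg cont_integrable continuous2_left G nonneg)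
  have cwg: "continuous_on A (\<lambda>t. w t * g t)" for A
    by (intro continuous_intros cg continuous_on_subset[OF w_cont]) auto
  have "strip_int T (\<lambda>t \<theta>. w t * G t \<theta>) = integral {0..T} (\<lambda>t. w t * g t)"
    by (simp add: strip_int_def g_def)
  also have "\<dots> = integral {0..S} (\<lambda>t. w t * g t) + integral {S..T} (\<lambda>t. w t * g t)"
    using False \<open>0 \<le> S\<close>
    by (intro Henstock_Kurzweil_Integration.integral_combine[symmetric] cont_integrable cwg) auto
  also have "integral {0..S} (\<lambda>t. w t * g t) \<le> integral {0..S} (\<lambda>t. w 0 * g t)"
    by (intro integral_le cont_integrable cwg continuous_intros cg mult_right_mono w_antimono g0) auto
  also have "integral {S..T} (\<lambda>t. w t * g t) \<le> integral {S..T} (\<lambda>t. w S * g t)" using \<open>0 \<le> S\<close>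
    by (intro integral_le cont_integrable cwg continuous_intros cg mult_right_mono w_antimono g0) auto
  also have "integral {S..T} (\<lambda>t. w S * g t) \<le> integral {0..T} (\<lambda>t. w S * g t)" using \<open>0 \<le> S\<close>
    by (intro integral_subinterval_le continuous_intros cg mult_nonneg_nonneg w_nonneg g0) auto
  finally show ?thesis by (simp add: strip_int_def g_def)
qed

end

locale weighted_strip_fn = mean_zero_strip_fn + strip_weight
begin

lemma strip_weighted_powr_bound:
  assumes "energy T \<le> e" and q: "2 \<le> q" "q + 1 \<le> real (2 * Suc k)"
  shows "strip_int T (\<lambda>t \<theta>. w t * \<bar>V t \<theta>\<bar> powr q) \<le> w 0 * (pow_const 0 e + pow_const k e)"
proof -
  \<comment> \<open>The cut at 0 leaves the first integral empty, so \<open>w 0\<close> bounds the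
    weight throughout.\<close>
  have "strip_int T (\<lambda>t \<theta>. w t * \<bar>V t \<theta>\<bar> powr q)
    \<le> w 0 * strip_int 0 (\<lambda>t \<theta>. \<bar>V t \<theta>\<bar> powr q) + w 0 * strip_int T (\<lambda>t \<theta>. \<bar>V t \<theta>\<bar> powr q)"
    using q by (intro strip_int_weight_split continuous2_powr cont) auto
  also have "\<dots> = w 0 * strip_int T (\<lambda>t \<theta>. \<bar>V t \<theta>\<bar> powr q)" by (simp add: strip_int_def)
  also have "\<dots> \<le> w 0 * (pow_const 0 e + pow_const k e)"
    by (intro mult_left_mono strip_powr_bound assms w_nonneg)
  finally show ?thesis .
qed

text \<open>Every term except the sum over cells becomes small by choosing \<open>K\<close>, then
  \<open>N\<close> (the mesh), then \<open>M\<close> (the height of the grid), with choices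
  depending on \<open>V\<close> only through \<open>e\<close>. What remains of \<open>V\<close> is
  \<open>N * M\<close> numbers.\<close>

lemma strip_compactness_bound:
  assumes E: "\<And>T. energy T \<le> e" and q: "2 \<le> q" "q + 1 \<le> real (2 * Suc k)" and K: "1 \<le> K"
    and N: "0 < N" and h: "h = 2*pi / real N"
  shows "strip_int T (\<lambda>t \<theta>. w t * \<bar>V t \<theta>\<bar> powr q) \<le>
    w 0 * (K powr (q - 2) * ((\<Sum>j<N. \<Sum>i<M. (cell_integral V h i j)\<^sup>2 / h\<^sup>2) + h\<^sup>2 * e) + pow_const k e / K)
    + w (real M*h) * (pow_const 0 e + pow_const k e)" proof -
  let ?G = "\<lambda>t \<theta>. \<bar>V t \<theta>\<bar> powr q" and ?S = "real M*h"
  let ?C = "\<Sum>j<N. \<Sum>i<M. (cell_integral V h i j)\<^sup>2 / h\<^sup>2"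
  have cG: "continuous2 ?G" using q by (intro continuous2_powr cont) auto
  have 1: "strip_int T ?G \<le> pow_const 0 e + pow_const k e" by (rule strip_powr_bound[OF E q])
  have "strip_int ?S ?G \<le> strip_int ?S (\<lambda>t \<theta>. K powr (q - 2) * (V t \<theta>)\<^sup>2 + (1/K) * V t \<theta> ^ (2 * Suc k))"
    using powr_le_squares_scaled[OF q K] K by (intro strip_int_mono cG cont continuous_intros) simp
  also have "\<dots> = K powr (q - 2) * strip_int ?S (\<lambda>t \<theta>. (V t \<theta>)\<^sup>2) + (1/K) * strip_int ?S (\<lambda>t \<theta>. V t \<theta> ^ (2 * Suc k))"
    by (subst strip_int_add; (intro continuous_intros cont)?; (simp only: strip_int_cmult)?)
  also have "\<dots> \<le> K powr (q - 2) * (?C + h\<^sup>2 * e) + (1/K) * pow_const k e"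
  proof (intro add_mono mult_left_mono strip_power_bound E)
    have "strip_int ?S (\<lambda>t \<theta>. (V t \<theta>)\<^sup>2) \<le> ?C + h\<^sup>2 * energy ?S" by (rule strip_Poincare[OF N h])
    also have "\<dots> \<le> ?C + h\<^sup>2 * e" by (intro add_left_mono mult_left_mono E) simp
    finally show "strip_int ?S (\<lambda>t \<theta>. (V t \<theta>)\<^sup>2) \<le> ?C + h\<^sup>2 * e" .
  qed (use K in auto)
  finally have 2: "strip_int ?S ?G \<le> K powr (q - 2) * (?C + h\<^sup>2 * e) + pow_const k e / K" by simp
  have "0 \<le> ?S" using h by simp
  then have "strip_int T (\<lambda>t \<theta>. w t * ?G t \<theta>) \<le> w 0 * strip_int ?S ?G + w ?S * strip_int T ?G"
    by (intro strip_int_weight_split cG) auto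
  also have "\<dots> \<le> w 0 * (K powr (q - 2) * (?C + h\<^sup>2 * e) + pow_const k e / K)
      + w ?S * (pow_const 0 e + pow_const k e)" by (intro add_mono mult_left_mono 1 2 w_nonneg)
  finally show ?thesis .
qed

end

section \<open>Test functions in polar coordinates\<close>

text \<open>A support inside a smaller concentric disc is a radial condition, visibly inherited by
  rotational averages, linear combinations and partial derivatives.\<close>

lemma test_fn_iff:
  "f \<in> test_functions \<longleftrightarrow> (\<forall>k. C_k k f) \<and> (\<exists>\<rho><1. \<forall>x. \<rho> < norm x \<longrightarrow> f x = 0)" (is "?L = ?R")
proof
  assume L: ?L
  define K where "K = closure {x. f x \<noteq> 0}"
  have K: "compact K" "K \<subseteq> unit_disc" using L by (auto simp: test_functions_def K_def)
  have supp: "x \<notin> K \<Longrightarrow> f x = 0" for x using closure_subset[of "{x. f x \<noteq> 0}"] by (auto simp: K_def)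
  have "\<exists>\<rho><1. \<forall>x\<in>K. norm x \<le> \<rho>"
  proof (cases "K = {}")
    case False
    then obtain z where "z \<in> K" "\<And>x. x \<in> K \<Longrightarrow> norm x \<le> norm z"
      using continuous_attains_sup[OF K(1), of norm] continuous_on_norm_id by blast
    with K(2) show ?thesis by (intro exI[of _ "norm z"]) auto
  qed (auto intro: exI[of _ 0])
  then obtain \<rho> where "\<rho> < 1" "\<And>x. x \<in> K \<Longrightarrow> norm x \<le> \<rho>" by blast
  with supp have "\<forall>x. \<rho> < norm x \<longrightarrow> f x = 0" by (meson not_less)
  with L \<open>\<rho> < 1\<close> show ?R by (auto simp: test_functions_def)
next
  assume ?R
  then obtain \<rho> where \<rho>: "\<rho> < 1" "\<And>x. \<rho> < norm x \<Longrightarrow> f x = 0" and C: "\<forall>k. C_k k f" by blast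
  have "{x. f x \<noteq> 0} \<subseteq> cball 0 \<rho>" using \<rho>(2) by (auto simp: not_less[symmetric])
  then have sub: "closure {x. f x \<noteq> 0} \<subseteq> cball 0 \<rho>" by (rule closure_minimal) simp
  then have "compact (closure {x. f x \<noteq> 0})"
    by (meson bounded_cball bounded_subset closed_closure compact_eq_bounded_closed)
  with sub \<rho>(1) C show ?L by (auto simp: test_functions_def)
qed

lemma test_fn_C_k: "f \<in> test_functions \<Longrightarrow> C_k k f"
  by (simp add: test_fn_iff)

lemma test_fn_differentiable: "f \<in> test_functions \<Longrightarrow> f differentiable (at x)"
  using test_fn_C_k[of f "Suc 0"] by simp

lemma test_fn_continuous_on:
  "f \<in> test_functions \<Longrightarrow> continuous_on S f" "f \<in> test_functions \<Longrightarrow> continuous_on S (grad f)"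
  using C_k_continuous_on[OF test_fn_C_k] continuous_on_grad[OF test_fn_C_k] by blast+

lemma test_fn_outside: "f \<in> test_functions \<Longrightarrow> 1 \<le> norm x \<Longrightarrow> f x = 0"
  by (force simp: test_fn_iff)

lemma test_fn_lincomb:
  assumes "f \<in> test_functions" "g \<in> test_functions"
  shows "(\<lambda>x. a * f x + b * g x) \<in> test_functions"
proof -
  obtain \<rho> \<sigma> where "\<rho> < 1" "\<forall>x. \<rho> < norm x \<longrightarrow> f x = 0" "\<sigma> < 1" "\<forall>x. \<sigma> < norm x \<longrightarrow> g x = 0"
    using assms by (auto simp: test_fn_iff)
  then have "\<exists>\<rho><1. \<forall>x. \<rho> < norm x \<longrightarrow> a * f x + b * g x = 0" by (intro exI[of _ "max \<rho> \<sigma>"]) auto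
  with assms C_k_lincomb show ?thesis by (simp add: test_fn_iff)
qed

lemma test_fn_diff: "f \<in> test_functions \<Longrightarrow> g \<in> test_functions \<Longrightarrow> (\<lambda>x. f x - g x) \<in> test_functions"
  using test_fn_lincomb[of f g 1 "-1"] by simp

lemma test_fn_add: "f \<in> test_functions \<Longrightarrow> g \<in> test_functions \<Longrightarrow> (\<lambda>x. f x + g x) \<in> test_functions"
  using test_fn_lincomb[of f g 1 1] by simp

lemma grad_diff:
  "f \<in> test_functions \<Longrightarrow> g \<in> test_functions \<Longrightarrow> grad (\<lambda>x. f x - g x) x = grad f x - grad g x"
  using grad_lincomb[of f x g 1 "-1"] by (simp add: test_fn_differentiable)

lemma grad_add:
  "f \<in> test_functions \<Longrightarrow> g \<in> test_functions \<Longrightarrow> grad (\<lambda>x. f x + g x) x = grad f x + grad g x"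
  using grad_lincomb[of f x g 1 1] by (simp add: test_fn_differentiable)

lemma integrable_disc_continuous:
  fixes g :: "real^2 \<Rightarrow> 'b::{banach, second_countable_topology}"
  assumes "continuous_on UNIV g"
  shows "integrable disc_measure g"
proof -
  interpret finite_measure disc_measure by (rule finite_measure_lebesgue_on) simp
  have "compact (g ` cball 0 1)"
    by (intro compact_continuous_image continuous_on_subset[OF assms]) auto
  then obtain B where "\<forall>y\<in>g ` cball 0 1. norm y \<le> B"
    using compact_imp_bounded bounded_iff by metis
  then have "AE x in disc_measure. norm (g x) \<le> B" by (intro AE_I2) auto
  moreover have "g \<in> borel_measurable disc_measure"
    using borel_measurable_continuous_onI[OF assms]
    by (intro measurable_restrict_space1 measurable_completion) simp
  ultimately show ?thesis by (rule integrable_const_bound)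
qed

definition dirichlet :: "(real^2 \<Rightarrow> real) \<Rightarrow> real" where
  "dirichlet f = (\<integral>x. (norm (grad f x))\<^sup>2 \<partial>disc_measure)"

definition pull :: "(real^2 \<Rightarrow> real) \<Rightarrow> real \<Rightarrow> real \<Rightarrow> real" where
  "pull f t \<theta> = f (polar t \<theta>)"

definition pull_t :: "(real^2 \<Rightarrow> real) \<Rightarrow> real \<Rightarrow> real \<Rightarrow> real" where
  "pull_t f t \<theta> = - (grad f (polar t \<theta>) \<bullet> polar t \<theta>)"

definition pull_\<theta> :: "(real^2 \<Rightarrow> real) \<Rightarrow> real \<Rightarrow> real \<Rightarrow> real" where
  "pull_\<theta> f t \<theta> = grad f (polar t \<theta>) \<bullet> vec2 (- (exp (-t) * sin \<theta>), exp (-t) * cos \<theta>)"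

lemma strip_fn_pull:
  assumes f: "f \<in> test_functions"
  shows "strip_fn (pull f) (pull_t f) (pull_\<theta> f)"
proof
  note [continuous_intros] = continuous_on_compose2[OF test_fn_continuous_on(1)[OF f, of UNIV]]
    continuous_on_compose2[OF test_fn_continuous_on(2)[OF f, of UNIV]]
  show "continuous2 (pull f)" "continuous2 (pull_t f)" "continuous2 (pull_\<theta> f)"
    unfolding pull_def pull_t_def pull_\<theta>_def by (intro continuous_intros; simp)+
  fix t \<theta>
  note gd = grad_has_derivative[OF test_fn_differentiable[OF f]]
  have "((\<lambda>t. polar t \<theta>) has_derivative (\<lambda>h. vec2 (h * (- exp (-t) * cos \<theta>), h * (- exp (-t) * sin \<theta>)))) (at t)"
    unfolding polar_def by (rule has_derivative_vec2) (auto intro!: derivative_eq_intros)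
  from has_derivative_compose[OF this gd]
  show "((\<lambda>t. pull f t \<theta>) has_real_derivative pull_t f t \<theta>) (at t)"
    unfolding has_field_derivative_def pull_def pull_t_def
    by (rule has_derivative_eq_rhs) (auto simp: inner_vec_def sum_2 algebra_simps)
  have "(polar t has_derivative (\<lambda>h. vec2 (h * (- exp (-t) * sin \<theta>), h * (exp (-t) * cos \<theta>)))) (at \<theta>)"
    unfolding polar_def[abs_def] by (rule has_derivative_vec2) (auto intro!: derivative_eq_intros)
  from has_derivative_compose[OF this gd]
  show "(pull f t has_real_derivative pull_\<theta> f t \<theta>) (at \<theta>)"
    unfolding has_field_derivative_def pull_def[abs_def] pull_\<theta>_def
    by (rule has_derivative_eq_rhs) (auto simp: inner_vec_def sum_2 algebra_simps)
  show "pull f 0 \<theta> = 0" by (simp add: pull_def test_fn_outside[OF f])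
qed

abbreviation strip_energy :: "(real^2 \<Rightarrow> real) \<Rightarrow> real \<Rightarrow> real" where
  "strip_energy f \<equiv> strip_fn.energy (pull_t f) (pull_\<theta> f)"

lemma strip_energy_eq:
  "f \<in> test_functions \<Longrightarrow>
    strip_energy f T = strip_int T (\<lambda>t \<theta>. (pull_t f t \<theta>)\<^sup>2 + (pull_\<theta> f t \<theta>)\<^sup>2)"
  using strip_fn.energy_def[OF strip_fn_pull] by simp

text \<open>The derivatives of \<open>polar\<close> in t and \<theta> are orthogonal vectors of the
  same length \<open>exp (-t)\<close>, which is conformality. The factor on the right is the
  Jacobian, so the Dirichlet integral transforms without a weight.\<close>

lemma norm_grad_polar:
  "(pull_t f t \<theta>)\<^sup>2 + (pull_\<theta> f t \<theta>)\<^sup>2 = (norm (grad f (polar t \<theta>)))\<^sup>2 * exp (-2*t)"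
proof -
  have "(v \<bullet> polar t \<theta>)\<^sup>2 + (v \<bullet> vec2 (- (exp (-t) * sin \<theta>), exp (-t) * cos \<theta>))\<^sup>2
      = (norm v)\<^sup>2 * (exp (-t))\<^sup>2" for v :: "real^2" proof -
    have "(v \<bullet> polar t \<theta>)\<^sup>2 + (v \<bullet> vec2 (- (exp (-t) * sin \<theta>), exp (-t) * cos \<theta>))\<^sup>2
      = ((v$1)\<^sup>2 + (v$2)\<^sup>2) * (exp (-t))\<^sup>2 * ((sin \<theta>)\<^sup>2 + (cos \<theta>)\<^sup>2)"
      by (simp only: inner_vec_def sum_2 polar_nth vec2_nth fst_conv snd_conv inner_real_def power2_eq_square) algebra
    then show ?thesis by (simp add: norm_vec2)
  qed
  then show ?thesis by (simp add: pull_t_def pull_\<theta>_def flip: exp_double)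
qed

lemma nn_integral_grad:
  assumes f: "f \<in> test_functions"
  shows "(\<integral>\<^sup>+x. ennreal ((norm (grad f x))\<^sup>2) \<partial>disc_measure) = (SUP n. ennreal (strip_energy f (real n)))"
proof -
  interpret strip_fn "pull f" "pull_t f" "pull_\<theta> f" by (rule strip_fn_pull[OF f])
  have [measurable]: "grad f \<in> borel_measurable borel"
    by (intro borel_measurable_continuous_onI test_fn_continuous_on f)
  have "(\<integral>\<^sup>+x. ennreal ((norm (grad f x))\<^sup>2) \<partial>disc_measure) =
    strip_nn (\<lambda>t \<theta>. ennreal ((pull_t f t \<theta>)\<^sup>2 + (pull_\<theta> f t \<theta>)\<^sup>2))"
    by (subst nn_integral_disc_polar) (simp_all add: norm_grad_polar ennreal_mult)
  also have "\<dots> = (SUP n. ennreal (strip_energy f (real n)))"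
    unfolding energy_def by (rule nn_integral_half_strip) (auto intro!: continuous_intros)
  finally show ?thesis .
qed

lemma integrable_norm_grad: 
  assumes "f \<in> test_functions"
  shows "integrable disc_measure (\<lambda>x. (norm (grad f x))\<^sup>2)"
  by (intro integrable_disc_continuous continuous_intros test_fn_continuous_on assms)

lemma ennreal_dirichlet:
  assumes "f \<in> test_functions"
  shows "ennreal (dirichlet f) = (SUP n. ennreal (strip_energy f (real n)))"
  unfolding nn_integral_grad[OF assms, symmetric] dirichlet_def
  by (rule nn_integral_eq_integral[symmetric, OF integrable_norm_grad[OF assms]]) auto

lemma dirichlet_nonneg: "0 \<le> dirichlet f"
  unfolding dirichlet_def by simp

lemma strip_energy_le_dirichlet:
  assumes f: "f \<in> test_functions"
  shows "strip_energy f T \<le> dirichlet f"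
proof -
  interpret strip_fn "pull f" "pull_t f" "pull_\<theta> f" by (rule strip_fn_pull[OF f])
  obtain n :: nat where "T \<le> real n" using real_arch_simple by blast
  then have "energy T \<le> energy (real n)"
    unfolding energy_def by (intro strip_int_extend_le continuous_intros) auto
  moreover have "ennreal (energy (real n)) \<le> ennreal (dirichlet f)"
    unfolding ennreal_dirichlet[OF f] by (rule SUP_upper) simp
  ultimately show ?thesis using dirichlet_nonneg[of f] by (simp add: ennreal_le_iff)
qed

text \<open>Covers radial functions too, as it is applied to angular means. Cauchy-Schwarz along a
  ray from the boundary gives \<open>t * B \<theta>\<close> as a bound for the square. The Jacobian
  is split into two factors \<open>exp (-t)\<close>: one absorbs \<open>t\<close>, the other has
  integral at most 1, so the constant is 1.\<close>

lemma Poincare_disc: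
  assumes f: "f \<in> test_functions"
  shows "(\<integral>x. (f x)\<^sup>2 \<partial>disc_measure) \<le> dirichlet f"
proof -
  interpret strip_fn "pull f" "pull_t f" "pull_\<theta> f" by (rule strip_fn_pull[OF f])
  have [measurable]: "f \<in> borel_measurable borel"
    by (intro borel_measurable_continuous_onI test_fn_continuous_on f)
  have int: "integrable disc_measure (\<lambda>x. (f x)\<^sup>2)"
    by (intro integrable_disc_continuous continuous_intros test_fn_continuous_on f)
  have bound: "strip_int T (\<lambda>t \<theta>. (pull f t \<theta>)\<^sup>2 * exp (-2*t)) \<le> dirichlet f" for T
  proof (cases "0 \<le> T")
    case True
    define B where "B = (\<lambda>\<theta>. integral {0..T} (\<lambda>t. (pull_t f t \<theta>)\<^sup>2))"
    have cB: "continuous_on S B" for S unfolding B_def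
      using cont_int_left[OF continuous2_flip[OF continuous_on_power[OF cont(2)]], of S 0 T 2] by simp
    have pt: "(pull f t \<theta>)\<^sup>2 * exp (-2*t) \<le> exp (-t) * B \<theta>" if t: "t \<in> {0..T}" for t \<theta>
    proof -
      have "\<bar>pull f t \<theta> - pull f 0 \<theta>\<bar> \<le> integral {0..t} (\<lambda>s. \<bar>pull_t f s \<theta>\<bar>)"
        using t by (intro abs_diff_le_integral deriv_t continuous2_right cont) auto
      then have "\<bar>pull f t \<theta>\<bar>\<^sup>2 \<le> (integral {0..t} (\<lambda>s. \<bar>pull_t f s \<theta>\<bar>))\<^sup>2"
        by (intro power_mono) (auto simp: boundary)
      also have "\<dots> \<le> (t - 0) * integral {0..t} (\<lambda>s. \<bar>pull_t f s \<theta>\<bar>\<^sup>2)"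
        using t by (intro integral_sq_le continuous_intros continuous2_right cont) auto
      also have "\<dots> \<le> t * B \<theta>" unfolding B_def using t
        by (auto intro!: mult_left_mono integral_subinterval_le continuous_intros continuous2_right cont)
      finally have "(pull f t \<theta>)\<^sup>2 * exp (-2*t) \<le> t * B \<theta> * exp (-2*t)" by (intro mult_right_mono) auto
      also have "\<dots> = (t * exp (-t)) * (exp (-t) * B \<theta>)" by (simp flip: exp_add)
      also have "\<dots> \<le> 1 * (exp (-t) * B \<theta>)"
      proof (rule mult_right_mono)
        have "t \<le> exp t" using exp_ge_add_one_self[of t] by linarith
        then show "t * exp (-t) \<le> 1" by (simp add: exp_minus field_simps)
        show "0 \<le> exp (-t) * B \<theta>"
          unfolding B_def by (intro mult_nonneg_nonneg integral_nonneg cont_integrable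
              continuous_intros continuous2_right cont) auto
      qed
      finally show ?thesis by simp
    qed
    have ceB: "continuous2 (\<lambda>t \<theta>. exp (-t) * B \<theta>)"
      by (intro continuous_intros continuous_on_compose2[OF cB[of UNIV]]) auto
    have "strip_int T (\<lambda>t \<theta>. (pull f t \<theta>)\<^sup>2 * exp (-2*t)) \<le> strip_int T (\<lambda>t \<theta>. exp (-t) * B \<theta>)"
      by (rule strip_int_mono[OF _ ceB pt]) (intro continuous_intros)
    also have "\<dots> = integral {0..T} (\<lambda>t. exp (-t)) * integral {0..2*pi} B"
      by (simp add: strip_int_def)
    also have "integral {0..T} (\<lambda>t. exp (-t)) = 1 - exp (-T)"
    proof -
      have "((\<lambda>t. exp (-t)) has_integral (- exp (-T)) - (- exp (-0))) {0..T}"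
        using True by (intro fundamental_theorem_of_calculus)
          (auto intro!: derivative_eq_intros simp flip: has_real_derivative_iff_has_vector_derivative)
      then show ?thesis by (simp add: integral_unique)
    qed
    also have "integral {0..2*pi} B = strip_int T (\<lambda>t \<theta>. (pull_t f t \<theta>)\<^sup>2)"
      unfolding B_def strip_int_def by (rule integral_swap2[symmetric]) (intro continuous_intros)
    also have "(1 - exp (-T)) * \<dots> \<le> 1 * energy T"
      using energy_parts_nonneg[of T] True by (intro mult_mono) (auto simp: energy_split)
    also have "\<dots> \<le> dirichlet f" using strip_energy_le_dirichlet[OF f] by simp
    finally show ?thesis .
  next
    case False
    then show ?thesis by (simp add: strip_int_def dirichlet_nonneg)
  qed
  have "ennreal (\<integral>x. (f x)\<^sup>2 \<partial>disc_measure) = (\<integral>\<^sup>+x. ennreal ((f x)\<^sup>2) \<partial>disc_measure)"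
    by (rule nn_integral_eq_integral[symmetric, OF int]) auto
  also have "\<dots> = strip_nn (\<lambda>t \<theta>. ennreal ((pull f t \<theta>)\<^sup>2 * exp (-2*t)))"
    by (subst nn_integral_disc_polar) (simp_all add: pull_def ennreal_mult)
  also have "\<dots> \<le> ennreal (dirichlet f)"
    by (intro nn_integral_half_strip_le continuous_intros bound) auto
  finally show ?thesis by (simp add: ennreal_le_iff dirichlet_nonneg)
qed

section \<open>Splitting a test function into its angular mean and a part of zero mean\<close>

definition mean_zero_fn :: "(real^2 \<Rightarrow> real) \<Rightarrow> bool" where
  "mean_zero_fn f \<longleftrightarrow> (\<forall>t. integral {0..2*pi} (pull f t) = 0)"

definition angular_mean :: "(real^2 \<Rightarrow> real) \<Rightarrow> real^2 \<Rightarrow> real" where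
  "angular_mean = rot_avg (\<lambda>_. 1 / (2*pi))"

lemma angular_mean_test_function:
  assumes "f \<in> test_functions"
  shows "angular_mean f \<in> test_functions"
proof -
  obtain \<rho> where "\<rho> < 1" "\<forall>x. \<rho> < norm x \<longrightarrow> f x = 0" using assms by (auto simp: test_fn_iff)
  then have "\<exists>\<rho><1. \<forall>x. \<rho> < norm x \<longrightarrow> angular_mean f x = 0"
    by (intro exI[of _ \<rho>]) (auto simp: angular_mean_def rot_avg_def)
  moreover have "C_k k (angular_mean f)" for k
    unfolding angular_mean_def by (intro C_k_rot_avg test_fn_C_k assms) simp
  ultimately show ?thesis by (simp add: test_fn_iff)
qed

lemma angular_mean_polar:
  assumes f: "continuous_on UNIV f"
  shows "angular_mean f (polar t \<alpha>) = integral {0..2*pi} (pull f t) / (2*pi)"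
proof -
  have "polar t \<alpha> \<noteq> 0" using norm_polar[of t \<alpha>] by (metis exp_not_eq_zero norm_zero)
  \<comment> \<open>An angle in one period is needed to shift the periodic integral.\<close>
  then obtain \<beta> where \<beta>: "0 \<le> \<beta>" "\<beta> < 2*pi" "polar t \<alpha> = polar (- ln (norm (polar t \<alpha>))) \<beta>"
    by (rule polar_exists_angle)
  have "continuous_on UNIV (\<lambda>\<theta>. f (polar t \<theta>))"
    by (rule continuous_on_compose2[OF f continuous_on_polar]) auto
  then have "continuous_on UNIV (pull f t)" by (simp add: pull_def[abs_def])
  moreover have "pull f t (\<theta> + 2*pi) = pull f t \<theta>" for \<theta> by (simp add: pull_def polar_def)
  ultimately have "integral {0..2*pi} (\<lambda>\<theta>. pull f t (\<beta> + \<theta>)) = integral {0..2*pi} (pull f t)"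
    using \<beta> by (intro integral_periodic_shift) auto
  moreover have "angular_mean f (polar t \<beta>) = integral {0..2*pi} (\<lambda>\<theta>. pull f t (\<beta> + \<theta>)) / (2*pi)"
    by (simp add: angular_mean_def rot_avg_def rot_polar pull_def)
  ultimately show ?thesis using \<beta>(3) by simp
qed

lemma mean_zero_fn_diff_angular_mean:
  assumes f: "f \<in> test_functions"
  shows "mean_zero_fn (\<lambda>x. f x - angular_mean f x)" unfolding mean_zero_fn_def
proof
  fix t
  interpret strip_fn "pull f" "pull_t f" "pull_\<theta> f" by (rule strip_fn_pull[OF f])
  have "integral {0..2*pi} (pull (\<lambda>x. f x - angular_mean f x) t)
    = integral {0..2*pi} (\<lambda>\<theta>. pull f t \<theta> - integral {0..2*pi} (pull f t) / (2*pi))"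
    unfolding pull_def[of "\<lambda>x. f x - angular_mean f x"]
    by (simp add: angular_mean_polar test_fn_continuous_on f pull_def)
  also have "\<dots> = 0"
  proof -
    have "pull f t integrable_on {0..2*pi}" by (intro cont_integrable continuous2_left cont)
    then show ?thesis by (subst integral_diff) auto
  qed
  finally show "integral {0..2*pi} (pull (\<lambda>x. f x - angular_mean f x) t) = 0" .
qed

lemma mean_zero_fn_diff:
  assumes "mean_zero_fn f" "mean_zero_fn g" "f \<in> test_functions" "g \<in> test_functions"
  shows "mean_zero_fn (\<lambda>x. f x - g x)"
proof -
  have "pull f t integrable_on {0..2*pi}" if "f \<in> test_functions" for f t
    using strip_fn.cont(1)[OF strip_fn_pull[OF that]] by (intro cont_integrable continuous2_left)
  from integral_diff[OF this this] assms show ?thesis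
    by (simp add: mean_zero_fn_def pull_def[abs_def])
qed

lemma mean_zero_strip_fn_pull:
  "f \<in> test_functions \<Longrightarrow> mean_zero_fn f \<Longrightarrow> mean_zero_strip_fn (pull f) (pull_t f) (pull_\<theta> f)"
  by (simp add: mean_zero_strip_fn_def mean_zero_strip_fn_axioms_def
      strip_fn_pull mean_zero_fn_def)

text \<open>\<open>h01_inner\<close> with classical gradients; \<open>h01_grad\<close> of a test
  function is a choice that agrees with \<open>grad\<close> only up to null sets.\<close>

definition dirichlet_inner :: "(real^2 \<Rightarrow> real) \<Rightarrow> (real^2 \<Rightarrow> real) \<Rightarrow> real" where
  "dirichlet_inner f g = (\<integral>x. grad f x \<bullet> grad g x \<partial>disc_measure)"

lemma integrable_grad_inner:
  "f \<in> test_functions \<Longrightarrow> g \<in> test_functions \<Longrightarrow> integrable disc_measure (\<lambda>x. grad f x \<bullet> grad g x)"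
  by (intro integrable_disc_continuous continuous_intros test_fn_continuous_on)

lemma dirichlet_lincomb:
  assumes "f \<in> test_functions" "g \<in> test_functions"
  shows "dirichlet (\<lambda>x. a * f x + b * g x) =
    a\<^sup>2 * dirichlet f + 2 * a * b * dirichlet_inner f g + b\<^sup>2 * dirichlet g" proof -
  have "(norm (a *\<^sub>R v + b *\<^sub>R w))\<^sup>2 = a\<^sup>2 * (norm v)\<^sup>2 + 2 * a * b * (v \<bullet> w) + b\<^sup>2 * (norm w)\<^sup>2"
    for v w :: "real^2" unfolding power2_norm_eq_inner
    by (simp add: inner_add_left inner_add_right inner_commute[of w v] power2_eq_square algebra_simps)
  then show ?thesis
    by (simp add: dirichlet_def dirichlet_inner_def grad_lincomb test_fn_differentiable
        integrable_grad_inner integrable_norm_grad assms)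
qed

lemma dirichlet_add:
  "f \<in> test_functions \<Longrightarrow> g \<in> test_functions \<Longrightarrow>
    dirichlet (\<lambda>x. f x + g x) = dirichlet f + 2 * dirichlet_inner f g + dirichlet g"
  using dirichlet_lincomb[of f g 1 1] by simp

lemma dirichlet_diff:
  "f \<in> test_functions \<Longrightarrow> g \<in> test_functions \<Longrightarrow>
    dirichlet (\<lambda>x. f x - g x) = dirichlet f - 2 * dirichlet_inner f g + dirichlet g"
  using dirichlet_lincomb[of f g 1 "-1"] by simp

text \<open>The polar formula is one for nonnegative integrands, so orthogonality is reached by
  polarization: \<open>f + g\<close> and \<open>f - g\<close> have the same energy on every
  rectangle. The two energies differ by four times the integral of
  \<open>pull_t f * pull_t g\<close>, where the second factor is constant in \<theta> and the first
  has zero mean over \<theta>.\<close>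

lemma dirichlet_inner_radial_mean_zero:
  assumes f: "f \<in> test_functions" "mean_zero_fn f"
    and g: "g \<in> test_functions" "\<And>t \<theta>. pull g t \<theta> = pull g t 0"
  shows "dirichlet_inner f g = 0"
proof -
  interpret F: mean_zero_strip_fn "pull f" "pull_t f" "pull_\<theta> f"
    by (rule mean_zero_strip_fn_pull[OF f])
  interpret G: strip_fn "pull g" "pull_t g" "pull_\<theta> g" by (rule strip_fn_pull[OF g(1)])
  have g\<theta>: "pull_\<theta> g t \<theta> = 0" for t \<theta>
  proof -
    have "pull g t = (\<lambda>_. pull g t 0)" using g(2) by auto
    then have "(pull g t has_real_derivative 0) (at \<theta>)" by (metis DERIV_const)
    then show ?thesis using G.deriv_\<theta> DERIV_unique by blast
  qed
  have gt: "pull_t g t \<theta> = pull_t g t 0" for t \<theta>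
  proof -
    have "(\<lambda>t. pull g t \<theta>) = (\<lambda>t. pull g t 0)" using g(2) by auto
    then show ?thesis using G.deriv_t[of \<theta> t] G.deriv_t[of 0 t] DERIV_unique by metis
  qed
  \<comment> \<open>The derivative in t of the means of \<open>f\<close>, which are identically
    0.\<close>
  have ft: "integral {0..2*pi} (pull_t f t) = 0" for t
  proof -
    have "((\<lambda>t. integral (cbox 0 (2*pi)) (pull f t)) has_real_derivative integral (cbox 0 (2*pi)) (pull_t f t)) (at t within UNIV)"
      using F.deriv_t by (intro leibniz_rule_field_derivative)
         (auto simp: cbox_interval case_prod_beta intro!: F.cont continuous2_left
          cont_integrable continuous_on_subset[OF F.cont(2)])
    moreover have "((\<lambda>t. integral (cbox 0 (2*pi)) (pull f t)) has_real_derivative 0) (at t)"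
      by (simp add: cbox_interval F.mean_zero)
    ultimately show ?thesis using DERIV_unique by (metis cbox_interval)
  qed
  have cross: "strip_int T (\<lambda>t \<theta>. pull_t f t \<theta> * pull_t g t \<theta>) = 0" for T
  proof -
    have "integral {0..2*pi} (\<lambda>\<theta>. pull_t f t \<theta> * pull_t g t \<theta>) = integral {0..2*pi} (\<lambda>\<theta>. pull_t f t \<theta> * pull_t g t 0)" for t
      by (subst gt) simp
    then show ?thesis by (simp add: strip_int_def ft)
  qed
  have pull_add: "pull_t (\<lambda>x. f x + g x) t \<theta> = pull_t f t \<theta> + pull_t g t \<theta>"
    "pull_\<theta> (\<lambda>x. f x + g x) t \<theta> = pull_\<theta> f t \<theta>"
    "pull_t (\<lambda>x. f x - g x) t \<theta> = pull_t f t \<theta> - pull_t g t \<theta>"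
    "pull_\<theta> (\<lambda>x. f x - g x) t \<theta> = pull_\<theta> f t \<theta>" for t \<theta> using g\<theta>[of t \<theta>]
    by (auto simp: pull_t_def pull_\<theta>_def grad_add[OF f(1) g(1)] grad_diff[OF f(1) g(1)]
        inner_add_left inner_diff_left)
  have "strip_energy (\<lambda>x. f x + g x) T = strip_energy (\<lambda>x. f x - g x) T" for T
  proof -
    have "strip_energy (\<lambda>x. f x + g x) T = strip_int T (\<lambda>t \<theta>.
        ((pull_t f t \<theta> - pull_t g t \<theta>)\<^sup>2 + (pull_\<theta> f t \<theta>)\<^sup>2) + 4 * (pull_t f t \<theta> * pull_t g t \<theta>))"
      by (subst strip_energy_eq[OF test_fn_add[OF f(1) g(1)]])
         (simp add: pull_add power2_eq_square algebra_simps)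
    also have "\<dots> = strip_int T (\<lambda>t \<theta>. (pull_t f t \<theta> - pull_t g t \<theta>)\<^sup>2 + (pull_\<theta> f t \<theta>)\<^sup>2)"
      by (subst strip_int_add) (auto intro!: continuous_intros simp: strip_int_cmult cross)
    also have "\<dots> = strip_energy (\<lambda>x. f x - g x) T"
      by (subst strip_energy_eq[OF test_fn_diff[OF f(1) g(1)]]) (simp add: pull_add)
    finally show ?thesis .
  qed
  then have "ennreal (dirichlet (\<lambda>x. f x + g x)) = ennreal (dirichlet (\<lambda>x. f x - g x))"
    by (simp add: ennreal_dirichlet test_fn_add test_fn_diff f g)
  then have "dirichlet (\<lambda>x. f x + g x) = dirichlet (\<lambda>x. f x - g x)"
    by (simp add: dirichlet_nonneg)
  then show ?thesis by (simp add: dirichlet_add dirichlet_diff f g)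
qed

section \<open>Lebesgue spaces over a finite measure\<close>

text \<open>The p-th power of the norm. Without the root, the constant \<open>2 powr p\<close> in
  \<open>lp_int_add\<close> takes the place of Minkowski's inequality, which is enough where only
  convergence and boundedness are asked.\<close>

definition lp_int :: "real \<Rightarrow> 'a measure \<Rightarrow> ('a \<Rightarrow> 'b::{banach, second_countable_topology}) \<Rightarrow> real" where
  "lp_int p M u = (\<integral>x. norm (u x) powr p \<partial>M)"

lemma lp_int_nonneg: "0 \<le> lp_int p M u"
  unfolding lp_int_def by simp

lemma lp_norm_eq: "lp_norm p M u = lp_int p M u powr (1 / p)"
  by (simp add: lp_norm_def lp_int_def)

lemma lp_norm_less:
  assumes "0 < p" "0 < e" "lp_int p M u < e powr p"
  shows "lp_norm p M u < e"
  using assms lp_int_nonneg[of p M u] powr_less_mono2[of "1/p" "lp_int p M u" "e powr p"]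
  by (simp add: lp_norm_eq powr_powr)

lemma lp_norm_tendsto_0_iff:
  assumes "0 < p"
  shows "(\<lambda>n. lp_norm p M (u n)) \<longlonglongrightarrow> 0 \<longleftrightarrow> (\<lambda>n. lp_int p M (u n)) \<longlonglongrightarrow> 0"
proof
  assume "(\<lambda>n. lp_norm p M (u n)) \<longlonglongrightarrow> 0"
  then have "(\<lambda>n. lp_norm p M (u n) powr p) \<longlonglongrightarrow> 0 powr p"
    using assms by (intro tendsto_powr') (auto simp: lp_norm_eq)
  moreover have "lp_norm p M v powr p = lp_int p M v" for v :: "'a \<Rightarrow> 'b"
    using assms lp_int_nonneg[of p M v] by (simp add: lp_norm_eq powr_powr)
  ultimately show "(\<lambda>n. lp_int p M (u n)) \<longlonglongrightarrow> 0" by simp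
next
  assume "(\<lambda>n. lp_int p M (u n)) \<longlonglongrightarrow> 0"
  then have "(\<lambda>n. lp_int p M (u n) powr (1/p)) \<longlonglongrightarrow> 0 powr (1/p)"
    using assms by (intro tendsto_powr') (auto simp: lp_int_nonneg)
  then show "(\<lambda>n. lp_norm p M (u n)) \<longlonglongrightarrow> 0" by (simp add: lp_norm_eq)
qed

lemma norm_add_powr_le:
  fixes a b :: "'b::real_normed_vector"
  assumes "0 \<le> p"
  shows "norm (a + b) powr p \<le> 2 powr p * (norm a powr p + norm b powr p)"
proof -
  have "norm (a + b) powr p \<le> (2 * max (norm a) (norm b)) powr p"
    using assms norm_triangle_ineq[of a b] by (intro powr_mono2) (auto simp: max_def)
  also have "\<dots> = 2 powr p * (max (norm a) (norm b)) powr p" by (simp add: powr_mult max_def)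
  also have "\<dots> \<le> 2 powr p * (norm a powr p + norm b powr p)"
    by (intro mult_left_mono) (auto simp: max_def)
  finally show ?thesis .
qed

lemma lp_space_measurable: "u \<in> lp_space p M \<Longrightarrow> u \<in> borel_measurable M"
  by (simp add: lp_space_def)

lemma lp_space_integrable: "u \<in> lp_space p M \<Longrightarrow> integrable M (\<lambda>x. norm (u x) powr p)"
  by (simp add: lp_space_def)

lemma lp_space_uminus: "u \<in> lp_space p M \<Longrightarrow> (\<lambda>x. - u x) \<in> lp_space p M"
  by (simp add: lp_space_def)

lemma lp_int_add:
  assumes u: "u \<in> lp_space p M" and v: "v \<in> lp_space p M" and "0 \<le> p"
  shows "(\<lambda>x. u x + v x) \<in> lp_space p M"
    and "lp_int p M (\<lambda>x. u x + v x) \<le> 2 powr p * (lp_int p M u + lp_int p M v)"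
proof -
  note [measurable] = lp_space_measurable[OF u] lp_space_measurable[OF v]
  note iu = lp_space_integrable[OF u] and iv = lp_space_integrable[OF v]
  have i: "integrable M (\<lambda>x. 2 powr p * (norm (u x) powr p + norm (v x) powr p))"
    using iu iv by simp
  have "integrable M (\<lambda>x. norm (u x + v x) powr p)"
    using norm_add_powr_le[OF \<open>0 \<le> p\<close>] by (intro Bochner_Integration.integrable_bound[OF i] AE_I2) auto
  then show "(\<lambda>x. u x + v x) \<in> lp_space p M" by (simp add: lp_space_def)
  have "lp_int p M (\<lambda>x. u x + v x) \<le> (\<integral>x. 2 powr p * (norm (u x) powr p + norm (v x) powr p) \<partial>M)"
    unfolding lp_int_def by (intro integral_mono i norm_add_powr_le \<open>0 \<le> p\<close>) fact
  also have "\<dots> = 2 powr p * (lp_int p M u + lp_int p M v)" using iu iv by (simp add: lp_int_def)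
  finally show "lp_int p M (\<lambda>x. u x + v x) \<le> 2 powr p * (lp_int p M u + lp_int p M v)" .
qed

lemma lp_int_diff:
  assumes u: "u \<in> lp_space p M" and v: "v \<in> lp_space p M" and "0 \<le> p"
  shows "(\<lambda>x. u x - v x) \<in> lp_space p M"
    and "lp_int p M (\<lambda>x. u x - v x) \<le> 2 powr p * (lp_int p M u + lp_int p M v)"
  using lp_int_add[OF u lp_space_uminus[OF v] \<open>0 \<le> p\<close>] by (simp_all add: lp_int_def)

lemma lp_int_diff_commute: "lp_int p M (\<lambda>x. u x - v x) = lp_int p M (\<lambda>x. v x - u x)"
  by (simp add: lp_int_def norm_minus_commute)

text \<open>Integrating \<open>s \<le> \<epsilon> + \<epsilon> powr (1 - p) * s powr p\<close> avoids Hoelder's inequality.\<close>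

lemma (in finite_measure) lp_int_imp_L1:
  assumes u: "u \<in> lp_space p M" and "1 \<le> p" "0 < \<epsilon>"
  shows "integrable M u" "(\<integral>x. norm (u x) \<partial>M) \<le> \<epsilon> * measure M (space M) + \<epsilon> powr (1 - p) * lp_int p M u"
proof -
  note [measurable] = lp_space_measurable[OF u]
  have le: "s \<le> \<epsilon> + \<epsilon> powr (1 - p) * s powr p" if "0 \<le> s" for s
  proof (cases "s \<le> \<epsilon>")
    case False
    have "s = \<epsilon> powr (1 - p) * (s * \<epsilon> powr (p - 1))" using \<open>0 < \<epsilon>\<close> by (simp flip: powr_add)
    also have "\<dots> \<le> \<epsilon> powr (1 - p) * (s * s powr (p - 1))"
      using False that assms by (intro mult_left_mono powr_mono2) auto
    also have "s * s powr (p - 1) = s powr p" using False \<open>0 < \<epsilon>\<close> powr_add[of s 1 "p - 1"] by simp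
    finally show ?thesis using \<open>0 < \<epsilon>\<close> by simp
  qed (simp add: add_increasing2)
  have i: "integrable M (\<lambda>x. \<epsilon> + \<epsilon> powr (1 - p) * norm (u x) powr p)"
    using lp_space_integrable[OF u] by simp
  show iu: "integrable M u"
    using le \<open>0 < \<epsilon>\<close> by (intro Bochner_Integration.integrable_bound[OF i] AE_I2) auto
  have "(\<integral>x. norm (u x) \<partial>M) \<le> (\<integral>x. \<epsilon> + \<epsilon> powr (1 - p) * norm (u x) powr p \<partial>M)"
    using iu by (intro integral_mono i le) auto
  also have "\<dots> = \<epsilon> * measure M (space M) + \<epsilon> powr (1 - p) * lp_int p M u"
    using lp_space_integrable[OF u] by (simp add: lp_int_def)
  finally show "(\<integral>x. norm (u x) \<partial>M) \<le> \<epsilon> * measure M (space M) + \<epsilon> powr (1 - p) * lp_int p M u" .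
qed

lemma (in finite_measure) lp_small_imp_L1_small:
  assumes "1 \<le> p" "0 < e"
  shows "\<exists>d>0. \<forall>u::'a \<Rightarrow> 'b::{banach, second_countable_topology}.
    u \<in> lp_space p M \<longrightarrow> lp_int p M u < d \<longrightarrow> (\<integral>x. norm (u x) \<partial>M) < e" proof -
  \<comment> \<open>Half of \<open>e\<close> is for the constant term and half for the power; the
    summand 1 guards against measure 0.\<close>
  define \<epsilon> where "\<epsilon> = e / (2 * (measure M (space M) + 1))"
  have m: "0 < measure M (space M) + 1" by (simp add: add_nonneg_pos)
  have \<epsilon>: "0 < \<epsilon>" using assms m by (simp add: \<epsilon>_def)
  have 1: "\<epsilon> * measure M (space M) \<le> e / 2"
  proof -
    have "\<epsilon> * measure M (space M) \<le> \<epsilon> * (measure M (space M) + 1)" using \<epsilon> by simp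
    also have "\<dots> = e / 2" using m by (simp add: \<epsilon>_def field_simps)
    finally show ?thesis .
  qed
  show ?thesis
  proof (intro exI[of _ "e / 2 / \<epsilon> powr (1 - p)"] conjI allI impI)
    show "0 < e / 2 / \<epsilon> powr (1 - p)" using assms \<epsilon> by simp
    fix u :: "'a \<Rightarrow> 'b"
    assume u: "u \<in> lp_space p M" and "lp_int p M u < e / 2 / \<epsilon> powr (1 - p)"
    then have "\<epsilon> powr (1 - p) * lp_int p M u < e / 2" using \<epsilon> by (simp add: field_simps)
    with 1 lp_int_imp_L1(2)[OF u \<open>1 \<le> p\<close> \<epsilon>] show "(\<integral>x. norm (u x) \<partial>M) < e" by linarith
  qed
qed

text \<open>Over a finite measure convergence passes to L1, where a subsequence converges almost
  everywhere. This identifies limits taken in different spaces and shows that limits of radial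
  functions are radial.\<close>

lemma (in finite_measure) lp_tendsto_imp_AE_subseq:
  fixes f :: "nat \<Rightarrow> 'a \<Rightarrow> 'b::{banach, second_countable_topology}"
  assumes f: "\<And>n. f n \<in> lp_space p M" and g: "g \<in> lp_space p M" and p: "1 \<le> p"
    and lim: "(\<lambda>n. lp_int p M (\<lambda>x. f n x - g x)) \<longlonglongrightarrow> 0"
  shows "\<exists>r::nat\<Rightarrow>nat. strict_mono r \<and> (AE x in M. (\<lambda>n. f (r n) x) \<longlonglongrightarrow> g x)"
proof -
  have d: "(\<lambda>x. f n x - g x) \<in> lp_space p M" for n using p by (intro lp_int_diff f g) auto
  have "(\<lambda>n. (\<integral>x. norm (f n x - g x) \<partial>M)) \<longlonglongrightarrow> 0"
  proof (rule LIMSEQ_I)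
    fix e :: real assume "0 < e"
    obtain d where "0 < d" "\<And>u::'a\<Rightarrow>'b. u \<in> lp_space p M \<Longrightarrow> lp_int p M u < d \<Longrightarrow> (\<integral>x. norm (u x) \<partial>M) < e"
      using lp_small_imp_L1_small[OF p \<open>0 < e\<close>, where 'b='b] by blast
    moreover obtain N where "\<forall>n\<ge>N. lp_int p M (\<lambda>x. f n x - g x) < d"
      using order_tendstoD(2)[OF lim \<open>0 < d\<close>] by (auto simp: eventually_sequentially)
    ultimately show "\<exists>N. \<forall>n\<ge>N. norm ((\<integral>x. norm (f n x - g x) \<partial>M) - 0) < e"
      using \<open>\<And>n. (\<lambda>x. f n x - g x) \<in> lp_space p M\<close> by (intro exI[of _ N]) auto
  qed
  from tendsto_L1_AE_subseq[OF lp_int_imp_L1(1)[OF d p zero_less_one] this]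
  show ?thesis using LIM_zero_cancel by (fastforce elim: eventually_mono)
qed

text \<open>Riesz-Fischer by way of L1: the sequence is Cauchy there too, a subsequence converges
  almost everywhere, and Fatou's lemma brings back the p-th power.\<close>

lemma (in finite_measure) lp_complete:
  fixes f :: "nat \<Rightarrow> 'a \<Rightarrow> 'b::{banach, second_countable_topology}"
  assumes f: "\<And>n. f n \<in> lp_space p M" and p: "1 \<le> p"
    and cauchy: "\<And>e. 0 < e \<Longrightarrow> \<exists>N. \<forall>m\<ge>N. \<forall>n\<ge>N. lp_int p M (\<lambda>x. f m x - f n x) < e"
  shows "\<exists>g\<in>lp_space p M. (\<lambda>n. lp_int p M (\<lambda>x. f n x - g x)) \<longlonglongrightarrow> 0"
proof -
  note [measurable] = lp_space_measurable[OF f]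
  have d: "(\<lambda>x. f m x - f n x) \<in> lp_space p M" for m n using p by (intro lp_int_diff f) auto
  have L1: "\<exists>N. \<forall>i\<ge>N. \<forall>j\<ge>N. (\<integral>x. norm (f i x - f j x) \<partial>M) < e" if "0 < e" for e
  proof -
    obtain \<delta> where "0 < \<delta>" and \<delta>: "\<And>u::'a\<Rightarrow>'b. u \<in> lp_space p M \<Longrightarrow> lp_int p M u < \<delta> \<Longrightarrow> (\<integral>x. norm (u x) \<partial>M) < e"
      using lp_small_imp_L1_small[OF p \<open>0 < e\<close>, where 'b='b] by blast
    then show ?thesis using cauchy[OF \<open>0 < \<delta>\<close>] d by meson
  qed
  obtain r where r: "strict_mono r" "AE x in M. Cauchy (\<lambda>i. f (r i) x)"
    by (rule cauchy_L1_AE_cauchy_subseq[OF lp_int_imp_L1(1)[OF f p zero_less_one] L1])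
  define g where "g = (\<lambda>x. lim (\<lambda>i. f (r i) x))"
  have [measurable]: "g \<in> borel_measurable M" unfolding g_def by measurable
  have g: "AE x in M. (\<lambda>i. f (r i) x) \<longlonglongrightarrow> g x"
    using r(2) by eventually_elim (simp add: g_def Cauchy_convergent_iff convergent_LIMSEQ_iff)
  \<comment> \<open>Fatou gives at once that the difference lies in the space and that it is small;
    membership of \<open>g\<close> itself follows by subtracting from one
    \<open>f n\<close>.\<close>
  have fatou: "(\<lambda>x. f n x - g x) \<in> lp_space p M \<and> lp_int p M (\<lambda>x. f n x - g x) \<le> e"
    if N: "\<forall>m\<ge>N. lp_int p M (\<lambda>x. f n x - f m x) \<le> e" for n N e
  proof -
    have "(\<integral>\<^sup>+x. ennreal (norm (f n x - g x) powr p) \<partial>M) =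
      (\<integral>\<^sup>+x. liminf (\<lambda>i. ennreal (norm (f n x - f (r i) x) powr p)) \<partial>M)"
    proof (rule nn_integral_cong_AE)
      show "AE x in M. ennreal (norm (f n x - g x) powr p) = liminf (\<lambda>i. ennreal (norm (f n x - f (r i) x) powr p))"
        using g
      proof eventually_elim
        fix x assume "(\<lambda>i. f (r i) x) \<longlonglongrightarrow> g x"
        then have "(\<lambda>i. norm (f n x - f (r i) x) powr p) \<longlonglongrightarrow> norm (f n x - g x) powr p"
          using p by (intro tendsto_powr' tendsto_intros) auto
        then have "(\<lambda>i. ennreal (norm (f n x - f (r i) x) powr p)) \<longlonglongrightarrow> ennreal (norm (f n x - g x) powr p)"
          by (rule tendsto_ennrealI)
        then show "ennreal (norm (f n x - g x) powr p) = liminf (\<lambda>i. ennreal (norm (f n x - f (r i) x) powr p))"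
          using lim_imp_Liminf[OF sequentially_bot] by metis
      qed
    qed
    also have "\<dots> \<le> liminf (\<lambda>i. \<integral>\<^sup>+x. ennreal (norm (f n x - f (r i) x) powr p) \<partial>M)"
      by (rule nn_integral_liminf) measurable
    also have "\<dots> \<le> ennreal e"
    proof -
      have "eventually (\<lambda>i. (\<integral>\<^sup>+x. ennreal (norm (f n x - f (r i) x) powr p) \<partial>M) \<le> ennreal e) sequentially"
        using eventually_ge_at_top[of N]
      proof eventually_elim
        fix i assume "N \<le> i"
        then have "N \<le> r i" using seq_suble[OF r(1), of i] by simp
        then have "lp_int p M (\<lambda>x. f n x - f (r i) x) \<le> e" using N by blast
        then show "(\<integral>\<^sup>+x. ennreal (norm (f n x - f (r i) x) powr p) \<partial>M) \<le> ennreal e"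
          using lp_space_integrable[OF d[of n "r i"]]
          by (subst nn_integral_eq_integral) (auto simp: lp_int_def intro: ennreal_leI)
      qed
      then have "liminf (\<lambda>i. \<integral>\<^sup>+x. ennreal (norm (f n x - f (r i) x) powr p) \<partial>M) \<le> liminf (\<lambda>i::nat. ennreal e)"
        by (rule Liminf_mono)
      then show ?thesis by (simp add: Liminf_const)
    qed
    finally have le: "(\<integral>\<^sup>+x. ennreal (norm (f n x - g x) powr p) \<partial>M) \<le> ennreal e" .
    then have i: "integrable M (\<lambda>x. norm (f n x - g x) powr p)"
      by (intro integrableI_bounded) (auto simp: le_less_trans[OF _ ennreal_less_top])
    have "0 \<le> e" using N lp_int_nonneg order_trans by blast
    then have "lp_int p M (\<lambda>x. f n x - g x) \<le> e"
      using le i by (subst (asm) nn_integral_eq_integral) (auto simp: lp_int_def)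
    with i show ?thesis by (simp add: lp_space_def)
  qed
  have ev: "\<exists>N. \<forall>n\<ge>N. (\<lambda>x. f n x - g x) \<in> lp_space p M \<and> lp_int p M (\<lambda>x. f n x - g x) \<le> e" if "0 < e" for e
  proof -
    obtain N where "\<forall>m\<ge>N. \<forall>n\<ge>N. lp_int p M (\<lambda>x. f m x - f n x) < e" using cauchy[OF \<open>0 < e\<close>] by blast
    then show ?thesis by (intro exI[of _ N] allI impI fatou[of N]) (auto intro: less_imp_le)
  qed
  obtain n where D: "(\<lambda>x. f n x - g x) \<in> lp_space p M" using ev[of 1] by auto
  have "(\<lambda>x. f n x - (f n x - g x)) \<in> lp_space p M"
    by (rule lp_int_diff(1)[OF f[of n] D order_trans[OF zero_le_one p]])
  moreover have "(\<lambda>x. f n x - (f n x - g x)) = g" by (simp add: fun_eq_iff)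
  ultimately have "g \<in> lp_space p M" by argo
  moreover have "(\<lambda>n. lp_int p M (\<lambda>x. f n x - g x)) \<longlonglongrightarrow> 0"
  proof (rule LIMSEQ_I)
    fix e :: real assume "0 < e"
    then obtain N where N: "\<And>n. N \<le> n \<Longrightarrow> lp_int p M (\<lambda>x. f n x - g x) \<le> e / 2"
      using ev[of "e / 2"] by auto
    have "norm (lp_int p M (\<lambda>x. f n x - g x) - 0) < e" if "N \<le> n" for n
      using N[OF that] lp_int_nonneg[of p M "\<lambda>x. f n x - g x"] \<open>0 < e\<close> by simp
    then show "\<exists>N. \<forall>n\<ge>N. norm (lp_int p M (\<lambda>x. f n x - g x) - 0) < e" by blast
  qed
  ultimately show ?thesis by blast
qed

section \<open>The inner product for exponent 2\<close>

lemma lp_int_2: "lp_int 2 M u = (\<integral>x. (norm (u x))\<^sup>2 \<partial>M)"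
  by (simp add: lp_int_def)

lemma lp_space_2: "u \<in> lp_space 2 M \<longleftrightarrow> u \<in> borel_measurable M \<and> integrable M (\<lambda>x. (norm (u x))\<^sup>2)"
  by (simp add: lp_space_def)

text \<open>Cauchy-Schwarz from AM-GM with a free parameter \<open>l\<close>, integrated; the best
  choice is \<open>l = B / A\<close> for the two norms. If one of them is 0, the integrand vanishes
  almost everywhere.\<close>

lemma L2_inner:
  fixes u v :: "'a \<Rightarrow> 'b::{real_inner, banach, second_countable_topology}"
  assumes u: "u \<in> lp_space 2 M" and v: "v \<in> lp_space 2 M"
  shows "integrable M (\<lambda>x. u x \<bullet> v x)"
    and "\<bar>\<integral>x. u x \<bullet> v x \<partial>M\<bar> \<le> sqrt (lp_int 2 M u) * sqrt (lp_int 2 M v)"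
proof -
  note [measurable] = lp_space_measurable[OF u] lp_space_measurable[OF v]
  have iu: "integrable M (\<lambda>x. (norm (u x))\<^sup>2)" and iv: "integrable M (\<lambda>x. (norm (v x))\<^sup>2)"
    using u v by (auto simp: lp_space_2)
  have amgm: "\<bar>a \<bullet> b\<bar> \<le> (l * (norm a)\<^sup>2 + (norm b)\<^sup>2 / l) / 2" if "0 < l" for l and a b :: 'b
  proof -
    have "\<bar>a \<bullet> b\<bar> \<le> norm a * norm b" by (rule Cauchy_Schwarz_ineq2)
    also have "\<dots> = (sqrt l * norm a) * (norm b / sqrt l)" using that by simp
    also have "\<dots> \<le> ((sqrt l * norm a)\<^sup>2 + (norm b / sqrt l)\<^sup>2) / 2"
    proof -
      have "x * y \<le> (x\<^sup>2 + y\<^sup>2) / 2" for x y :: real using sum_squares_bound[of x y] by simp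
      then show ?thesis .
    qed
    finally show ?thesis using that by (simp add: power_mult_distrib power_divide)
  qed
  have i: "integrable M (\<lambda>x. (l * (norm (u x))\<^sup>2 + (norm (v x))\<^sup>2 / l) / 2)" for l
    using iu iv by simp
  show iuv: "integrable M (\<lambda>x. u x \<bullet> v x)"
    using amgm[of 1] by (intro Bochner_Integration.integrable_bound[OF i[of 1]] AE_I2) auto
  have le: "\<bar>\<integral>x. u x \<bullet> v x \<partial>M\<bar> \<le> (l * lp_int 2 M u + lp_int 2 M v / l) / 2" if "0 < l" for l
  proof -
    have "\<bar>\<integral>x. u x \<bullet> v x \<partial>M\<bar> \<le> (\<integral>x. \<bar>u x \<bullet> v x\<bar> \<partial>M)" by (rule integral_abs_bound)
    also have "\<dots> \<le> (\<integral>x. (l * (norm (u x))\<^sup>2 + (norm (v x))\<^sup>2 / l) / 2 \<partial>M)"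
      using that iuv by (intro integral_mono i amgm) auto
    also have "\<dots> = (l * lp_int 2 M u + lp_int 2 M v / l) / 2" using iu iv by (simp add: lp_int_2)
    finally show ?thesis .
  qed
  show "\<bar>\<integral>x. u x \<bullet> v x \<partial>M\<bar> \<le> sqrt (lp_int 2 M u) * sqrt (lp_int 2 M v)"
  proof (cases "lp_int 2 M u = 0 \<or> lp_int 2 M v = 0")
    case True
    then have "(AE x in M. u x = 0) \<or> (AE x in M. v x = 0)"
      using integral_nonneg_eq_0_iff_AE[OF iu] integral_nonneg_eq_0_iff_AE[OF iv] by (auto simp: lp_int_2)
    then have "AE x in M. u x \<bullet> v x = 0" by (auto elim: eventually_mono)
    then have "(\<integral>x. u x \<bullet> v x \<partial>M) = 0" by (rule integral_eq_zero_AE)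
    then show ?thesis by (simp add: lp_int_nonneg)
  next
    case False
    define A B where "A = sqrt (lp_int 2 M u)" and "B = sqrt (lp_int 2 M v)"
    have AB: "0 < A" "0 < B" "lp_int 2 M u = A\<^sup>2" "lp_int 2 M v = B\<^sup>2"
      using False lp_int_nonneg[of 2 M u] lp_int_nonneg[of 2 M v] by (auto simp: A_def B_def)
    have "\<bar>\<integral>x. u x \<bullet> v x \<partial>M\<bar> \<le> (B / A * A\<^sup>2 + B\<^sup>2 / (B / A)) / 2" using le[of "B / A"] AB by simp
    also have "\<dots> = A * B" using AB by (simp add: power2_eq_square)
    finally show ?thesis by (simp add: A_def B_def)
  qed
qed

lemma lp_int_2_add_le:
  assumes "u \<in> lp_space 2 M" "v \<in> lp_space 2 M"
  shows "lp_int 2 M (\<lambda>x. u x + v x) \<le> 4 * (lp_int 2 M u + lp_int 2 M v)"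
  using lp_int_add(2)[OF assms] by simp

lemma lp_int_2_diff_le:
  assumes "u \<in> lp_space 2 M" "v \<in> lp_space 2 M"
  shows "lp_int 2 M (\<lambda>x. u x - v x) \<le> 4 * (lp_int 2 M u + lp_int 2 M v)"
  using lp_int_diff(2)[OF assms] by simp

section \<open>The gradient on the Sobolev space\<close>

lemma integral_disc_eq_lborel:
  fixes f :: "real^2 \<Rightarrow> real"
  assumes [measurable]: "f \<in> borel_measurable borel" and "\<And>x. 1 \<le> norm x \<Longrightarrow> f x = 0"
  shows "(\<integral>x. f x \<partial>disc_measure) = (\<integral>x. f x \<partial>lborel)"
proof -
  have "(\<integral>x. f x \<partial>disc_measure) = (\<integral>x. indicator unit_disc x *\<^sub>R f x \<partial>lebesgue)"
    by (subst integral_restrict_space) auto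
  also have "\<dots> = (\<integral>x. f x \<partial>lebesgue)"
    using assms(2) by (intro Bochner_Integration.integral_cong) (auto simp: indicator_def)
  also have "\<dots> = (\<integral>x. f x \<partial>lborel)" by (rule integral_completion) simp
  finally show ?thesis .
qed

text \<open>Differentiating \<open>\<integral>\<eta>(x + h) dx = \<integral>\<eta>(x) dx\<close> in \<open>h\<close>.\<close>

lemma integral_derivative_zero:
  fixes \<eta> :: "real^2 \<Rightarrow> real" and D :: "real^2 \<Rightarrow> real^2"
  assumes der: "\<And>x. (\<eta> has_derivative (\<lambda>h. D x \<bullet> h)) (at x)"
    and D: "continuous_on UNIV D"
    and zero: "\<And>x. 1 \<le> norm x \<Longrightarrow> \<eta> x = 0" "\<And>x. 1 \<le> norm x \<Longrightarrow> D x = 0"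
  shows "(\<integral>x. D x \<bullet> e \<partial>disc_measure) = 0"
proof -
  have "compact (D ` cball 0 1)" by (intro compact_continuous_image continuous_on_subset[OF D]) auto
  then obtain B0 where B0: "\<forall>y\<in>D ` cball 0 1. norm y \<le> B0"
    using compact_imp_bounded bounded_iff by metis
  define B where "B = max B0 0"
  have B: "norm (D x) \<le> B" for x
    using B0 zero(2)[of x] by (cases "norm x \<le> 1") (auto simp: B_def le_max_iff_disj)
  have [measurable]: "\<eta> \<in> borel_measurable borel"
    using der by (intro borel_measurable_continuous_onI continuous_at_imp_continuous_on)
      (auto intro: has_derivative_continuous)
  have De [measurable]: "(\<lambda>x. D x \<bullet> e) \<in> borel_measurable borel"
    by (intro borel_measurable_continuous_onI continuous_intros D)
  have lip: "\<bar>\<eta> x - \<eta> y\<bar> \<le> B * norm (x - y)" for x y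
  proof -
    have "onorm (\<lambda>h. D z \<bullet> h) \<le> B" for z
    proof (rule onorm_le)
      fix h have "norm (D z \<bullet> h) \<le> norm (D z) * norm h" by (simp add: Cauchy_Schwarz_ineq2)
      also have "\<dots> \<le> B * norm h" by (intro mult_right_mono B) auto
      finally show "norm (D z \<bullet> h) \<le> B * norm h" .
    qed
    then have "norm (\<eta> x - \<eta> y) \<le> B * norm (x - y)"
      using der by (intro differentiable_bound[of UNIV]) auto
    then show ?thesis by simp
  qed
  have int\<eta>: "integrable lborel \<eta>"
  proof -
    have "continuous_on (cball 0 1) \<eta>"
      using der by (intro continuous_at_imp_continuous_on) (auto intro: has_derivative_continuous)
    then have "integrable lborel (\<lambda>x. indicator (cball 0 1) x *\<^sub>R \<eta> x)"
      by (intro borel_integrable_compact) auto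
    moreover have "(\<lambda>x. indicator (cball 0 1) x *\<^sub>R \<eta> x) = \<eta>"
      using zero(1) by (auto simp: fun_eq_iff indicator_def)
    ultimately show ?thesis by simp
  qed
  \<comment> \<open>Steps of length at most 1, so all difference quotients vanish outside the ball
    of radius \<open>1 + norm e\<close>; with the Lipschitz constant \<open>B\<close> this yields
    the dominating function.\<close>
  define h where "h = (\<lambda>n. inverse (real (Suc n)))"
  have h: "0 < h n" "h n \<le> 1" for n by (auto simp: h_def field_simps)
  define q where "q = (\<lambda>n x. (\<eta> (h n *\<^sub>R e + x) - \<eta> x) / h n)"
  have intq: "(\<integral>x. q n x \<partial>lborel) = 0" for n
  proof -
    have "(\<integral>x. \<eta> (h n *\<^sub>R e + x) \<partial>lborel) = (\<integral>x. \<eta> x \<partial>lborel)"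
      by (subst (2) lborel_distr_plus[of "h n *\<^sub>R e", symmetric], subst integral_distr) auto
    moreover have "integrable lborel (\<lambda>x. \<eta> (h n *\<^sub>R e + x))"
    proof -
      have "integrable (distr lborel borel ((+) (h n *\<^sub>R e))) \<eta>"
        using int\<eta> by (simp add: lborel_distr_plus)
      then show ?thesis by (subst (asm) integrable_distr_eq) auto
    qed
    ultimately show ?thesis using int\<eta> by (simp add: q_def)
  qed
  have "(\<lambda>n. \<integral>x. q n x \<partial>lborel) \<longlonglongrightarrow> (\<integral>x. D x \<bullet> e \<partial>lborel)"
  proof (rule integral_dominated_convergence)
    show "(\<lambda>x. D x \<bullet> e) \<in> borel_measurable lborel" using De by simp
    show "q n \<in> borel_measurable lborel" for n unfolding q_def by measurable
    show "integrable lborel (\<lambda>x. indicator (cball 0 (1 + norm e)) x *\<^sub>R (B * norm e))"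
      by (intro borel_integrable_compact) auto
    show "AE x in lborel. (\<lambda>n. q n x) \<longlonglongrightarrow> D x \<bullet> e"
    proof (rule AE_I2)
      fix x
      have "((\<lambda>t. \<eta> (t *\<^sub>R e + x)) has_derivative (\<lambda>t. D x \<bullet> (t *\<^sub>R e))) (at 0)"
        by (rule has_derivative_compose[of "\<lambda>t. t *\<^sub>R e + x" "\<lambda>t. t *\<^sub>R e" 0 UNIV \<eta>])
           (auto intro!: derivative_eq_intros der)
      then have "((\<lambda>t. \<eta> (t *\<^sub>R e + x)) has_real_derivative D x \<bullet> e) (at 0)"
        by (simp add: has_field_derivative_def mult.commute[of _ "D x \<bullet> e"])
      then have "((\<lambda>t. (\<eta> (t *\<^sub>R e + x) - \<eta> x) / t) \<longlongrightarrow> D x \<bullet> e) (at 0)" by (simp add: DERIV_def)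
      moreover have "filterlim h (at 0) sequentially"
        unfolding filterlim_at using h LIMSEQ_inverse_real_of_nat
        by (auto simp: h_def less_imp_neq[symmetric])
      ultimately show "(\<lambda>n. q n x) \<longlonglongrightarrow> D x \<bullet> e" unfolding q_def by (rule filterlim_compose)
    qed
    show "AE x in lborel. norm (q n x) \<le> indicator (cball 0 (1 + norm e)) x *\<^sub>R (B * norm e)" for n
    proof (rule AE_I2)
      fix x
      show "norm (q n x) \<le> indicator (cball 0 (1 + norm e)) x *\<^sub>R (B * norm e)"
      proof (cases "norm x \<le> 1 + norm e")
        case True
        have "\<bar>\<eta> (h n *\<^sub>R e + x) - \<eta> x\<bar> \<le> B * (h n * norm e)"
          using lip[of "h n *\<^sub>R e + x" x] h[of n] by simp
        then show ?thesis using True h[of n] by (simp add: q_def field_simps)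
      next
        case False
        have "norm (h n *\<^sub>R e) \<le> norm e" using h[of n] by (simp add: mult_left_le_one_le)
        then have "1 \<le> norm (h n *\<^sub>R e + x)"
          using False norm_triangle_ineq4[of "h n *\<^sub>R e + x" "h n *\<^sub>R e"] by simp
        moreover have "1 \<le> norm x" using False norm_ge_zero[of e] by linarith
        ultimately show ?thesis using False by (simp add: q_def zero)
      qed
    qed
  qed
  then have "(\<integral>x. D x \<bullet> e \<partial>lborel) = 0" by (simp add: intq LIMSEQ_const_iff)
  then show ?thesis using integral_disc_eq_lborel[OF De] zero(2) by simp
qed

lemma partial_test_function:
  assumes f: "f \<in> test_functions"
  shows "partial i f \<in> test_functions"
proof -
  obtain \<rho> where \<rho>: "\<rho> < 1" "\<forall>x. \<rho> < norm x \<longrightarrow> f x = 0" using f by (auto simp: test_fn_iff)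
  have "partial i f x = 0" if "\<rho> < norm x" for x
  proof -
    have "open {x::real^2. \<rho> < norm x}" by (intro open_Collect_less continuous_intros)
    then have "(f has_derivative (\<lambda>_. 0)) (at x)"
      by (rule has_derivative_transform_within_open[OF has_derivative_const, of _ x]) (use \<rho> that in auto)
    from partial_eq[OF this] show ?thesis by simp
  qed
  moreover have "C_k k (partial i f)" for k using test_fn_C_k[OF f, of "Suc k"] by simp
  ultimately show ?thesis using \<rho>(1) by (auto simp: test_fn_iff)
qed

text \<open>Apply \<open>integral_derivative_zero\<close> to \<open>partial i f x * g x\<close> in
  direction \<open>i\<close> and sum. No derivative is left on \<open>g\<close>, so the right side
  passes to L2 limits in \<open>g\<close>.\<close>

lemma dirichlet_inner_by_parts:
  assumes f: "f \<in> test_functions" and g: "g \<in> test_functions"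
  shows "dirichlet_inner f g = - (\<integral>x. (partial 1 (partial 1 f) x + partial 2 (partial 2 f) x) * g x \<partial>disc_measure)"
proof -
  note p = partial_test_function[OF f]
  note pp = partial_test_function[OF p]
  note c = test_fn_continuous_on(1)
  have int: "integrable disc_measure (\<lambda>x. partial i (partial i f) x * g x)"
    "integrable disc_measure (\<lambda>x. partial i f x * partial i g x)" for i
    by (intro integrable_disc_continuous continuous_intros c pp p g partial_test_function)+
  have zero: "(\<integral>x. partial i (partial i f) x * g x + partial i f x * partial i g x \<partial>disc_measure) = 0" for i
  proof -
    let ?D = "\<lambda>x. g x *\<^sub>R grad (partial i f) x + partial i f x *\<^sub>R grad g x"
    have "(\<integral>x. ?D x \<bullet> axis i 1 \<partial>disc_measure) = 0"
    proof (rule integral_derivative_zero[where \<eta> = "\<lambda>x. partial i f x * g x"])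
      show "((\<lambda>x. partial i f x * g x) has_derivative (\<lambda>h. ?D x \<bullet> h)) (at x)" for x
        by (rule has_derivative_eq_rhs[OF has_derivative_mult[OF grad_has_derivative grad_has_derivative]])
           (auto intro!: test_fn_differentiable p g simp: inner_add_left algebra_simps)
      show "continuous_on UNIV ?D" by (intro continuous_intros test_fn_continuous_on p g)
    qed (simp_all add: test_fn_outside g p)
    then show ?thesis by (simp add: inner_add_left inner_axis grad_nth mult.commute)
  qed
  have "dirichlet_inner f g = (\<integral>x. partial 1 f x * partial 1 g x + partial 2 f x * partial 2 g x \<partial>disc_measure)"
    by (simp add: dirichlet_inner_def inner_vec_def sum_2 grad_nth)
  also have "\<dots> = - (\<integral>x. (partial 1 (partial 1 f) x + partial 2 (partial 2 f) x) * g x \<partial>disc_measure)"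
    using zero[of 1] zero[of 2] int[of 1] int[of 2] by (simp add: distrib_right)
  finally show ?thesis .
qed

lemma finite_measure_disc: "finite_measure disc_measure"
  by (rule finite_measure_lebesgue_on) simp

lemma test_fn_lp_space:
  assumes "f \<in> test_functions" "1 \<le> p"
  shows "f \<in> lp_space p disc_measure" "grad f \<in> lp_space p disc_measure"
proof -
  have *: "g \<in> lp_space p disc_measure" if g: "continuous_on UNIV g" for g :: "real^2 \<Rightarrow> 'b::{banach,second_countable_topology}"
  proof -
    have "integrable disc_measure (\<lambda>x. norm (g x) powr p)"
      using \<open>1 \<le> p\<close> by (intro integrable_disc_continuous continuous_on_powr' continuous_intros g) auto
    moreover have "g \<in> borel_measurable disc_measure"
      using integrable_disc_continuous[OF g] by (rule borel_measurable_integrable)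
    ultimately show ?thesis by (simp add: lp_space_def)
  qed
  show "f \<in> lp_space p disc_measure" "grad f \<in> lp_space p disc_measure"
    by (intro * test_fn_continuous_on assms)+
qed

abbreviation L2_disc :: "(real^2 \<Rightarrow> 'b::{banach, second_countable_topology}) set" where
  "L2_disc \<equiv> lp_space 2 disc_measure"

abbreviation L2_int :: "(real^2 \<Rightarrow> 'b::{banach, second_countable_topology}) \<Rightarrow> real" where
  "L2_int \<equiv> lp_int 2 disc_measure"

lemma dirichlet_eq_lp_int: "dirichlet f = L2_int (grad f)"
  by (simp add: dirichlet_def lp_int_2)

lemma has_h01_grad_iff:
  "has_h01_grad u g \<longleftrightarrow> u \<in> L2_disc \<and> g \<in> L2_disc \<and>
     (\<exists>\<phi> :: nat \<Rightarrow> real^2 \<Rightarrow> real. (\<forall>n. \<phi> n \<in> test_functions) \<and>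
        (\<lambda>n. L2_int (\<lambda>x. \<phi> n x - u x)) \<longlonglongrightarrow> 0 \<and>
        (\<lambda>n. L2_int (\<lambda>x. grad (\<phi> n) x - g x)) \<longlonglongrightarrow> 0)"
  by (simp add: has_h01_grad_def lp_norm_tendsto_0_iff)

lemma lp_int_2_tendsto_0_add:
  assumes "\<And>n. u n \<in> lp_space 2 M" "\<And>n. v n \<in> lp_space 2 M"
    and "(\<lambda>n. lp_int 2 M (u n)) \<longlonglongrightarrow> 0" "(\<lambda>n. lp_int 2 M (v n)) \<longlonglongrightarrow> 0"
  shows "(\<lambda>n. lp_int 2 M (\<lambda>x. u n x + v n x)) \<longlonglongrightarrow> 0"
proof (rule tendsto_sandwich[where f = "\<lambda>_. 0" and h = "\<lambda>n. 4 * (lp_int 2 M (u n) + lp_int 2 M (v n))"])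
  show "(\<lambda>n. 4 * (lp_int 2 M (u n) + lp_int 2 M (v n))) \<longlonglongrightarrow> 0"
    using tendsto_mult_right_zero[OF tendsto_add_zero[OF assms(3,4)], of 4] by simp
  show "\<forall>\<^sub>F n in sequentially. lp_int 2 M (\<lambda>x. u n x + v n x) \<le> 4 * (lp_int 2 M (u n) + lp_int 2 M (v n))"
    by (intro always_eventually allI lp_int_2_add_le assms)
qed (auto simp: lp_int_nonneg)

lemma has_h01_grad_diff:
  assumes "has_h01_grad u g" "has_h01_grad v h"
  shows "has_h01_grad (\<lambda>x. u x - v x) (\<lambda>x. g x - h x)"
proof -
  obtain \<phi> \<psi> where \<phi>: "\<And>n. \<phi> n \<in> test_functions"
        "(\<lambda>n. L2_int (\<lambda>x. \<phi> n x - u x)) \<longlonglongrightarrow> 0"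
        "(\<lambda>n. L2_int (\<lambda>x. grad (\<phi> n) x - g x)) \<longlonglongrightarrow> 0"
    and \<psi>: "\<And>n. \<psi> n \<in> test_functions"
        "(\<lambda>n. L2_int (\<lambda>x. \<psi> n x - v x)) \<longlonglongrightarrow> 0"
        "(\<lambda>n. L2_int (\<lambda>x. grad (\<psi> n) x - h x)) \<longlonglongrightarrow> 0"
    using assms unfolding has_h01_grad_iff by blast
  have sp: "u \<in> L2_disc" "g \<in> L2_disc"
    "v \<in> L2_disc" "h \<in> L2_disc" using assms unfolding has_h01_grad_iff by blast+
  have t: "\<phi> n \<in> L2_disc" "grad (\<phi> n) \<in> L2_disc"
    "\<psi> n \<in> L2_disc" "grad (\<psi> n) \<in> L2_disc" for n by (intro test_fn_lp_space \<phi> \<psi>; simp)+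
  have 1: "(\<lambda>n. L2_int (\<lambda>x. (\<phi> n x - u x) + (v x - \<psi> n x))) \<longlonglongrightarrow> 0"
    using \<phi> \<psi> sp by (intro lp_int_2_tendsto_0_add lp_int_diff(1) t sp)
       (auto simp: lp_int_diff_commute[of 2 disc_measure v])
  have 2: "(\<lambda>n. L2_int (\<lambda>x. (grad (\<phi> n) x - g x) + (h x - grad (\<psi> n) x))) \<longlonglongrightarrow> 0"
    using \<phi> \<psi> sp by (intro lp_int_2_tendsto_0_add lp_int_diff(1) t sp)
       (auto simp: lp_int_diff_commute[of 2 disc_measure h])
  show ?thesis unfolding has_h01_grad_iff using 1 2 \<phi>(1) \<psi>(1) sp
    by (intro conjI lp_int_diff exI[of _ "\<lambda>n x. \<phi> n x - \<psi> n x"])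
       (auto simp: grad_diff algebra_simps intro: test_fn_diff)
qed

text \<open>Closability of the gradient: if \<open>\<eta> m \<rightarrow> 0\<close> in \<open>L\<^sup>2\<close>, then \<open>\<langle>\<nabla>\<eta> n, \<nabla>\<eta> m\<rangle> = - \<langle>\<Delta>\<eta> n, \<eta> m\<rangle> \<rightarrow> 0\<close> for fixed \<open>n\<close>.\<close>

lemma has_h01_grad_zero:
  assumes "has_h01_grad (\<lambda>_. 0) g"
  shows "L2_int g = 0"
proof -
  let ?M = disc_measure
  obtain \<eta> where \<eta>: "\<And>n. \<eta> n \<in> test_functions"
        "(\<lambda>n. L2_int (\<lambda>x. \<eta> n x)) \<longlonglongrightarrow> 0"
        "(\<lambda>n. L2_int (\<lambda>x. grad (\<eta> n) x - g x)) \<longlonglongrightarrow> 0"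
    and g: "g \<in> L2_disc" using assms unfolding has_h01_grad_iff by auto
  define d where "d = (\<lambda>n. L2_int (\<lambda>x. grad (\<eta> n) x - g x))"
  have dg: "(\<lambda>x. grad (\<eta> n) x - g x) \<in> L2_disc" for n
    by (intro lp_int_diff test_fn_lp_space \<eta> g) auto
  have "dirichlet (\<eta> n) \<le> 4 * d n" for n
  proof -
    have dm: "dirichlet (\<lambda>x. \<eta> n x - \<eta> m x) \<le> 4 * (d n + d m)" for m
    proof -
      have "dirichlet (\<lambda>x. \<eta> n x - \<eta> m x) = L2_int (\<lambda>x. (grad (\<eta> n) x - g x) - (grad (\<eta> m) x - g x))"
        by (simp add: dirichlet_def lp_int_2 grad_diff \<eta>)
      also have "\<dots> \<le> 4 * (d n + d m)" unfolding d_def by (intro lp_int_2_diff_le dg)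
      finally show ?thesis .
    qed
    \<comment> \<open>Expand the energy of the difference, drop the energy of
      \<open>\<eta> m\<close>, and let \<open>m\<close> tend to infinity: the mixed term and
      \<open>d m\<close> vanish.\<close>
    have "dirichlet (\<eta> n) \<le> 2 * dirichlet_inner (\<eta> n) (\<eta> m) + 4 * (d n + d m)" for m
      using dm[of m] dirichlet_diff[OF \<eta>(1)[of n] \<eta>(1)[of m]] dirichlet_nonneg[of "\<eta> m"] by linarith
    moreover have "(\<lambda>m. 2 * dirichlet_inner (\<eta> n) (\<eta> m) + 4 * (d n + d m)) \<longlonglongrightarrow> 2 * 0 + 4 * (d n + 0)"
    proof (intro tendsto_intros)
      show "d \<longlonglongrightarrow> 0" using \<eta>(3) by (simp add: d_def)
      \<comment> \<open>The Laplacian of \<open>\<eta> n\<close>, fixed while \<open>m\<close>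
        grows.\<close>
      define L where "L = (\<lambda>x. partial 1 (partial 1 (\<eta> n)) x + partial 2 (partial 2 (\<eta> n)) x)"
      have "L \<in> test_functions" unfolding L_def by (intro test_fn_add partial_test_function \<eta>)
      then have L: "L \<in> L2_disc" by (intro test_fn_lp_space) auto
      have "(\<lambda>m. sqrt (L2_int L) * sqrt (L2_int (\<eta> m))) \<longlonglongrightarrow> sqrt (L2_int L) * sqrt 0"
        by (intro tendsto_intros \<eta>)
      moreover have "norm (dirichlet_inner (\<eta> n) (\<eta> m)) \<le> sqrt (L2_int L) * sqrt (L2_int (\<eta> m))" for m
        using L2_inner(2)[OF L test_fn_lp_space(1)[OF \<eta>(1)[of m]]] 
        by (simp add: dirichlet_inner_by_parts[OF \<eta>(1) \<eta>(1)] L_def)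
      ultimately show "(\<lambda>m. dirichlet_inner (\<eta> n) (\<eta> m)) \<longlonglongrightarrow> 0"
        by (intro Lim_null_comparison[of "dirichlet_inner (\<eta> n) \<circ> \<eta>", unfolded o_def] always_eventually) auto
    qed
    ultimately show ?thesis by (intro LIMSEQ_le_const) (auto simp: mult.commute)
  qed
  then have le: "L2_int g \<le> 20 * d n" for n
  proof -
    have "L2_int g = L2_int (\<lambda>x. grad (\<eta> n) x - (grad (\<eta> n) x - g x))" by simp
    also have "\<dots> \<le> 4 * (L2_int (grad (\<eta> n)) + d n)"
      unfolding d_def by (intro lp_int_2_diff_le dg test_fn_lp_space \<eta>) auto
    also have "L2_int (grad (\<eta> n)) \<le> 4 * d n"
      using \<open>dirichlet (\<eta> n) \<le> 4 * d n\<close> by (simp add: dirichlet_eq_lp_int)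
    finally show ?thesis by simp
  qed
  have "(\<lambda>n. 20 * d n) \<longlonglongrightarrow> 20 * 0" using \<eta>(3) unfolding d_def by (intro tendsto_intros)
  then have "L2_int g \<le> 20 * 0" by (rule LIMSEQ_le_const) (use le in blast)
  then show ?thesis using lp_int_nonneg[of 2 ?M g] by simp
qed

lemma lp_int_2_eq_0: "g \<in> lp_space 2 M \<Longrightarrow> lp_int 2 M g = 0 \<Longrightarrow> AE x in M. g x = 0"
  using integral_nonneg_eq_0_iff_AE[of M "\<lambda>x. (norm (g x))\<^sup>2"] by (auto simp: lp_int_2 lp_space_2)

text \<open>Makes the choice in \<open>h01_grad\<close> harmless: under an integral it may be
  replaced by any gradient obtained as a limit.\<close>

lemma has_h01_grad_unique:
  assumes "has_h01_grad u g" "has_h01_grad u h"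
  shows "AE x in disc_measure. g x = h x"
proof -
  have d: "has_h01_grad (\<lambda>_. 0) (\<lambda>x. g x - h x)" using has_h01_grad_diff[OF assms] by simp
  then have "(\<lambda>x. g x - h x) \<in> L2_disc" by (simp add: has_h01_grad_iff)
  from lp_int_2_eq_0[OF this has_h01_grad_zero[OF d]] show ?thesis by simp
qed

lemma h01_grad: "u \<in> H01 \<Longrightarrow> has_h01_grad u (h01_grad u)"
  using someI_ex[of "has_h01_grad u"] by (simp add: H01_def h01_grad_def)

lemma h01_norm_eq: "h01_norm u = sqrt (L2_int (h01_grad u))"
  by (simp add: h01_norm_def h01_inner_def lp_int_2 power2_norm_eq_inner)

section \<open>Approximation by test functions of mean zero\<close>

lemma angular_mean_radial:
  assumes "f \<in> test_functions"
  shows "pull (angular_mean f) t \<theta> = pull (angular_mean f) t 0"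
  by (simp add: pull_def angular_mean_polar test_fn_continuous_on assms)

lemma AE_disc_nonzero: "AE x in disc_measure. x \<noteq> 0"
proof -
  have "AE x in lebesgue. x \<noteq> (0::real^2)" by (rule AE_completion[OF AE_lborel_singleton])
  then show ?thesis by (subst AE_restrict_space_iff) auto
qed

text \<open>Pythagoras: the angular mean is an orthogonal projection for
  \<open>dirichlet_inner\<close>, so it does not increase energy. In this form it makes the means of
  a Cauchy sequence Cauchy.\<close>

lemma dirichlet_angular_mean_diff_le:
  assumes f: "f \<in> test_functions" and g: "g \<in> test_functions"
  shows "dirichlet (\<lambda>x. angular_mean f x - angular_mean g x) \<le> dirichlet (\<lambda>x. f x - g x)"
proof -
  let ?m = "\<lambda>x. angular_mean f x - angular_mean g x"
  let ?z = "\<lambda>x. (f x - angular_mean f x) - (g x - angular_mean g x)"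
  note am = angular_mean_test_function
  have m: "?m \<in> test_functions" and z: "?z \<in> test_functions" by (intro test_fn_diff am f g)+
  have "mean_zero_fn ?z"
    by (intro mean_zero_fn_diff mean_zero_fn_diff_angular_mean test_fn_diff am f g)
  moreover have "pull ?m t \<theta> = pull ?m t 0" for t \<theta>
    using angular_mean_radial[OF f, of t \<theta>] angular_mean_radial[OF g, of t \<theta>] by (simp add: pull_def)
  ultimately have "dirichlet_inner ?z ?m = 0" by (intro dirichlet_inner_radial_mean_zero z m)
  then have "dirichlet (\<lambda>x. ?z x + ?m x) = dirichlet ?z + dirichlet ?m"
    using dirichlet_add[OF z m] by linarith
  moreover have "(\<lambda>x. ?z x + ?m x) = (\<lambda>x. f x - g x)" by auto
  ultimately show ?thesis using dirichlet_nonneg[of ?z] by simp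
qed

text \<open>The identity between the product of a vector with its orthogonal projection and the
  square of the projection. It converts a vanishing mixed product into vanishing energy of the
  means.\<close>

lemma dirichlet_inner_angular_mean:
  assumes f: "f \<in> test_functions"
  shows "dirichlet_inner f (angular_mean f) = dirichlet (angular_mean f)"
proof -
  let ?m = "angular_mean f" and ?z = "\<lambda>x. f x - angular_mean f x"
  have m: "?m \<in> test_functions" and z: "?z \<in> test_functions"
    by (intro test_fn_diff angular_mean_test_function f)+
  have "dirichlet_inner ?z ?m = 0"
    by (intro dirichlet_inner_radial_mean_zero z m mean_zero_fn_diff_angular_mean f angular_mean_radial)
  moreover have "dirichlet_inner ?z ?m = dirichlet_inner f ?m - dirichlet ?m"
    by (simp add: dirichlet_inner_def dirichlet_def grad_diff f m inner_diff_left power2_norm_eq_inner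
        integrable_grad_inner)
  ultimately show ?thesis by simp
qed

lemma Cauchy_lp_int_2:
  assumes f: "\<And>n. f n \<in> lp_space 2 M" and g: "g \<in> lp_space 2 M"
    and lim: "(\<lambda>n. lp_int 2 M (\<lambda>x. f n x - g x)) \<longlonglongrightarrow> 0" and "0 < e"
  shows "\<exists>N. \<forall>m\<ge>N. \<forall>n\<ge>N. lp_int 2 M (\<lambda>x. f m x - f n x) < e"
proof -
  obtain N where N: "\<And>n. N \<le> n \<Longrightarrow> lp_int 2 M (\<lambda>x. f n x - g x) < e / 8"
    using order_tendstoD(2)[OF lim, of "e / 8"] \<open>0 < e\<close> by (auto simp: eventually_sequentially)
  have "lp_int 2 M (\<lambda>x. f m x - f n x) < e" if "N \<le> m" "N \<le> n" for m n
  proof -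
    have "lp_int 2 M (\<lambda>x. f m x - f n x) = lp_int 2 M (\<lambda>x. (f m x - g x) - (f n x - g x))" by simp
    also have "\<dots> \<le> 4 * (lp_int 2 M (\<lambda>x. f m x - g x) + lp_int 2 M (\<lambda>x. f n x - g x))"
      by (intro lp_int_2_diff_le lp_int_diff(1) f g) auto
    also have "\<dots> < e" using N[OF that(1)] N[OF that(2)] by simp
    finally show ?thesis .
  qed
  then show ?thesis by blast
qed

text \<open>\<open>Poincare_disc\<close> makes a sequence that is Cauchy in energy Cauchy in L2 as
  well, so functions and gradients both have limits by \<open>lp_complete\<close>.\<close>

lemma test_functions_Cauchy_limit:
  assumes m: "\<And>n. m n \<in> test_functions"
    and cauchy: "\<And>e. 0 < e \<Longrightarrow> \<exists>N. \<forall>i\<ge>N. \<forall>j\<ge>N. dirichlet (\<lambda>x. m i x - m j x) < e"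
  obtains w G where "has_h01_grad w G" "(\<lambda>n. L2_int (\<lambda>x. m n x - w x)) \<longlonglongrightarrow> 0"
    "(\<lambda>n. L2_int (\<lambda>x. grad (m n) x - G x)) \<longlonglongrightarrow> 0"
proof -
  let ?M = disc_measure
  interpret finite_measure ?M by (rule finite_measure_disc)
  have sp: "m n \<in> L2_disc" "grad (m n) \<in> L2_disc" for n by (intro test_fn_lp_space m; simp)+
  have D: "dirichlet (\<lambda>x. m i x - m j x) = L2_int (\<lambda>x. grad (m i) x - grad (m j) x)" for i j
    by (simp add: dirichlet_def lp_int_2 grad_diff m)
  have P: "L2_int (\<lambda>x. m i x - m j x) \<le> dirichlet (\<lambda>x. m i x - m j x)" for i j
    using Poincare_disc[OF test_fn_diff[OF m m]] by (simp add: lp_int_2)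
  have "\<exists>w\<in>L2_disc. (\<lambda>n. L2_int (\<lambda>x. m n x - w x)) \<longlonglongrightarrow> 0"
  proof (rule lp_complete[OF sp(1)])
    fix e :: real assume "0 < e"
    then show "\<exists>N. \<forall>i\<ge>N. \<forall>j\<ge>N. L2_int (\<lambda>x. m i x - m j x) < e"
      using cauchy[of e] P by (meson le_less_trans)
  qed simp
  moreover have "\<exists>G\<in>L2_disc. (\<lambda>n. L2_int (\<lambda>x. grad (m n) x - G x)) \<longlonglongrightarrow> 0"
    using cauchy unfolding D by (intro lp_complete[OF sp(2)]) auto
  ultimately show ?thesis using that m unfolding has_h01_grad_iff by blast
qed

lemma lp_int_2_tendsto_inner:
  fixes a b :: "nat \<Rightarrow> 'a \<Rightarrow> 'b::{real_inner, banach, second_countable_topology}"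
  assumes a: "\<And>n. a n \<in> lp_space 2 M" "g \<in> lp_space 2 M" "(\<lambda>n. lp_int 2 M (\<lambda>x. a n x - g x)) \<longlonglongrightarrow> 0"
    and b: "\<And>n. b n \<in> lp_space 2 M" "h \<in> lp_space 2 M" "(\<lambda>n. lp_int 2 M (\<lambda>x. b n x - h x)) \<longlonglongrightarrow> 0"
  shows "(\<lambda>n. \<integral>x. a n x \<bullet> b n x \<partial>M) \<longlonglongrightarrow> (\<integral>x. g x \<bullet> h x \<partial>M)"
proof -
  let ?A = "\<lambda>n x. a n x - g x" and ?B = "\<lambda>n x. b n x - h x"
  have A: "?A n \<in> lp_space 2 M" and B: "?B n \<in> lp_space 2 M" for n
    by (intro lp_int_diff(1) a b; simp)+
  have eq: "(\<integral>x. a n x \<bullet> b n x \<partial>M) - (\<integral>x. g x \<bullet> h x \<partial>M) =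
     (\<integral>x. ?A n x \<bullet> ?B n x \<partial>M) + (\<integral>x. ?A n x \<bullet> h x \<partial>M) + (\<integral>x. g x \<bullet> ?B n x \<partial>M)" for n proof -
    have "(\<integral>x. ?A n x \<bullet> ?B n x \<partial>M) + (\<integral>x. ?A n x \<bullet> h x \<partial>M) + (\<integral>x. g x \<bullet> ?B n x \<partial>M)
      = (\<integral>x. (?A n x \<bullet> ?B n x + ?A n x \<bullet> h x) + g x \<bullet> ?B n x \<partial>M)"
      using L2_inner(1)[OF A[of n] B[of n]] L2_inner(1)[OF A[of n] b(2)] L2_inner(1)[OF a(2) B[of n]] by simp
    also have "\<dots> = (\<integral>x. a n x \<bullet> b n x - g x \<bullet> h x \<partial>M)"
      by (simp add: algebra_simps inner_diff_left inner_diff_right)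
    also have "\<dots> = (\<integral>x. a n x \<bullet> b n x \<partial>M) - (\<integral>x. g x \<bullet> h x \<partial>M)"
      using L2_inner(1)[OF a(1)[of n] b(1)[of n]] L2_inner(1)[OF a(2) b(2)] by simp
    finally show ?thesis ..
  qed
  have "(\<lambda>n. (\<integral>x. a n x \<bullet> b n x \<partial>M) - (\<integral>x. g x \<bullet> h x \<partial>M)) \<longlonglongrightarrow> 0"
  proof (rule Lim_null_comparison)
    show "(\<lambda>n. sqrt (lp_int 2 M (?A n)) * sqrt (lp_int 2 M (?B n)) + sqrt (lp_int 2 M (?A n)) * sqrt (lp_int 2 M h)
       + sqrt (lp_int 2 M g) * sqrt (lp_int 2 M (?B n))) \<longlonglongrightarrow> 0" proof -
      have "(\<lambda>n. sqrt (lp_int 2 M (?A n)) * sqrt (lp_int 2 M (?B n)) + sqrt (lp_int 2 M (?A n)) * sqrt (lp_int 2 M h)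
         + sqrt (lp_int 2 M g) * sqrt (lp_int 2 M (?B n)))
         \<longlonglongrightarrow> sqrt 0 * sqrt 0 + sqrt 0 * sqrt (lp_int 2 M h) + sqrt (lp_int 2 M g) * sqrt 0"
        by (intro tendsto_intros a b)
      then show ?thesis by simp
    qed
    show "\<forall>\<^sub>F n in sequentially. norm ((\<integral>x. a n x \<bullet> b n x \<partial>M) - (\<integral>x. g x \<bullet> h x \<partial>M)) \<le>
       sqrt (lp_int 2 M (?A n)) * sqrt (lp_int 2 M (?B n)) + sqrt (lp_int 2 M (?A n)) * sqrt (lp_int 2 M h)
       + sqrt (lp_int 2 M g) * sqrt (lp_int 2 M (?B n))" unfolding eq real_norm_def
      by (intro always_eventually allI order_trans[OF abs_triangle_ineq] add_mono L2_inner(2) A B a b)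
  qed
  then show ?thesis by (rule LIM_zero_cancel)
qed

text \<open>The passage from orthogonality to zero mean. The angular means \<open>m n\<close> of the
  approximants converge in energy to a radial \<open>w\<close>. Orthogonality of \<open>u\<close>
  and \<open>w\<close> says that the products of the gradients of \<open>\<phi> n\<close> and
  \<open>m n\<close> tend to 0, and these products are the energies of \<open>m n\<close>. Hence
  subtracting the means does not change the limits.\<close>

lemma H01_rad_perp_approx:
  assumes u: "u \<in> H01_rad_perp"
  obtains \<psi> where "\<And>n. \<psi> n \<in> test_functions" "\<And>n. mean_zero_fn (\<psi> n)"
    "(\<lambda>n. L2_int (\<lambda>x. \<psi> n x - u x)) \<longlonglongrightarrow> 0"
    "(\<lambda>n. L2_int (\<lambda>x. grad (\<psi> n) x - h01_grad u x)) \<longlonglongrightarrow> 0"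
proof -
  let ?M = disc_measure and ?g = "h01_grad u"
  interpret finite_measure ?M by (rule finite_measure_disc)
  have "has_h01_grad u ?g" using u by (intro h01_grad) (simp add: H01_rad_perp_def)
  then obtain \<phi> where \<phi>: "\<And>n. \<phi> n \<in> test_functions"
      "(\<lambda>n. L2_int (\<lambda>x. \<phi> n x - u x)) \<longlonglongrightarrow> 0"
      "(\<lambda>n. L2_int (\<lambda>x. grad (\<phi> n) x - ?g x)) \<longlonglongrightarrow> 0"
    and us: "u \<in> L2_disc" and gs: "?g \<in> L2_disc"
    unfolding has_h01_grad_iff by blast
  define m where "m = (\<lambda>n. angular_mean (\<phi> n))"
  have m: "m n \<in> test_functions" for n unfolding m_def by (intro angular_mean_test_function \<phi>)
  have sp: "\<phi> n \<in> L2_disc" "grad (\<phi> n) \<in> L2_disc" "m n \<in> L2_disc" "grad (m n) \<in> L2_disc" for n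
    by (intro test_fn_lp_space \<phi> m; simp)+
  have cauchy: "\<exists>N. \<forall>i\<ge>N. \<forall>j\<ge>N. dirichlet (\<lambda>x. m i x - m j x) < e" if "0 < e" for e
  proof -
    obtain N where "\<forall>i\<ge>N. \<forall>j\<ge>N. L2_int (\<lambda>x. grad (\<phi> i) x - grad (\<phi> j) x) < e"
      using Cauchy_lp_int_2[OF sp(2) gs \<phi>(3) \<open>0 < e\<close>] by blast
    moreover have "dirichlet (\<lambda>x. m i x - m j x) \<le> L2_int (\<lambda>x. grad (\<phi> i) x - grad (\<phi> j) x)" for i j
      using dirichlet_angular_mean_diff_le[OF \<phi>(1)[of i] \<phi>(1)[of j]]
      by (simp add: m_def dirichlet_def[of "\<lambda>x. \<phi> i x - \<phi> j x"] lp_int_2 grad_diff \<phi>)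
    ultimately show ?thesis by (meson le_less_trans)
  qed
  obtain w G where w: "has_h01_grad w G" "(\<lambda>n. L2_int (\<lambda>x. m n x - w x)) \<longlonglongrightarrow> 0"
    "(\<lambda>n. L2_int (\<lambda>x. grad (m n) x - G x)) \<longlonglongrightarrow> 0"
    using test_functions_Cauchy_limit[OF m cauchy] by blast
  have ws: "w \<in> L2_disc" and Gs: "G \<in> L2_disc" using w(1) by (auto simp: has_h01_grad_iff)
  have "w \<in> H01_rad"
  proof -
    obtain r where r: "AE x in ?M. (\<lambda>n. m (r n) x) \<longlonglongrightarrow> w x"
      using lp_tendsto_imp_AE_subseq[OF sp(3) ws _ w(2)] by auto
    \<comment> \<open>The profile is read off along the ray of angle 0, at t = - ln \<rho>;
      \<open>lim\<close> takes an unspecified value where the subsequence diverges, which affects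
      only a null set of points.\<close>
    define f where "f = (\<lambda>\<rho>. lim (\<lambda>n. pull (m (r n)) (- ln \<rho>) 0))"
    have "AE x in ?M. w x = f (norm x)" using r AE_disc_nonzero
    proof eventually_elim
      fix x :: "real^2" assume lim: "(\<lambda>n. m (r n) x) \<longlonglongrightarrow> w x" and "x \<noteq> 0"
      then obtain \<theta> where "x = polar (- ln (norm x)) \<theta>" using polar_exists_angle by blast
      then have "m n x = pull (m n) (- ln (norm x)) 0" for n
        using angular_mean_radial[OF \<phi>(1), of n "- ln (norm x)" \<theta>] unfolding m_def pull_def by metis
      then show "w x = f (norm x)" unfolding f_def using lim by (simp add: limI)
    qed
    with w(1) show ?thesis by (auto simp: H01_rad_def H01_def)
  qed
  then have wH: "w \<in> H01" and "h01_inner u w = 0"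
    using u by (auto simp: H01_rad_def H01_rad_perp_def)
  \<comment> \<open>\<open>G\<close> is some gradient of \<open>w\<close>, while
    \<open>h01_inner\<close> uses the chosen one.\<close>
  have "(\<integral>x. ?g x \<bullet> G x \<partial>?M) = h01_inner u w" unfolding h01_inner_def
    using has_h01_grad_unique[OF w(1) h01_grad[OF wH]]
  proof (intro integral_cong_AE)
    show "(\<lambda>x. ?g x \<bullet> G x) \<in> borel_measurable ?M"
      using L2_inner(1)[OF gs Gs] by (rule borel_measurable_integrable)
    have "h01_grad w \<in> L2_disc" using h01_grad[OF wH] by (simp add: has_h01_grad_iff)
    then show "(\<lambda>x. ?g x \<bullet> h01_grad w x) \<in> borel_measurable ?M"
      by (intro borel_measurable_integrable L2_inner(1) gs)
  qed (auto elim: eventually_mono)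
  with \<open>h01_inner u w = 0\<close> have "(\<integral>x. ?g x \<bullet> G x \<partial>?M) = 0" by simp
  then have "(\<lambda>n. dirichlet_inner (\<phi> n) (m n)) \<longlonglongrightarrow> 0"
    using lp_int_2_tendsto_inner[OF sp(2) gs \<phi>(3) sp(4) Gs w(3)] by (simp add: dirichlet_inner_def)
  then have D0: "(\<lambda>n. dirichlet (m n)) \<longlonglongrightarrow> 0" by (simp add: m_def dirichlet_inner_angular_mean \<phi>)
  have G0: "(\<lambda>n. L2_int (\<lambda>x. - grad (m n) x)) \<longlonglongrightarrow> 0"
    using D0 by (simp add: dirichlet_eq_lp_int lp_int_2)
  have M0: "(\<lambda>n. L2_int (\<lambda>x. - m n x)) \<longlonglongrightarrow> 0"
  proof (rule tendsto_sandwich[OF _ _ tendsto_const D0])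
    show "\<forall>\<^sub>F n in sequentially. L2_int (\<lambda>x. - m n x) \<le> dirichlet (m n)"
      using Poincare_disc[OF m] by (simp add: lp_int_2)
  qed (simp add: lp_int_nonneg)
  show ?thesis
  proof (rule that[of "\<lambda>n x. \<phi> n x - m n x"])
    show "(\<lambda>x. \<phi> n x - m n x) \<in> test_functions" for n by (intro test_fn_diff \<phi> m)
    show "mean_zero_fn (\<lambda>x. \<phi> n x - m n x)" for n
      unfolding m_def by (intro mean_zero_fn_diff_angular_mean \<phi>)
    have "(\<lambda>n. L2_int (\<lambda>x. (\<phi> n x - u x) + - m n x)) \<longlonglongrightarrow> 0"
      by (intro lp_int_2_tendsto_0_add lp_int_diff(1) lp_space_uminus sp us \<phi> M0) auto
    then show "(\<lambda>n. L2_int (\<lambda>x. \<phi> n x - m n x - u x)) \<longlonglongrightarrow> 0" by (simp add: algebra_simps)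
    have "(\<lambda>n. L2_int (\<lambda>x. (grad (\<phi> n) x - ?g x) + - grad (m n) x)) \<longlonglongrightarrow> 0"
      by (intro lp_int_2_tendsto_0_add lp_int_diff(1) lp_space_uminus sp gs \<phi> G0) auto
    then show "(\<lambda>n. L2_int (\<lambda>x. grad (\<lambda>x. \<phi> n x - m n x) x - ?g x)) \<longlonglongrightarrow> 0"
      by (simp add: grad_diff \<phi> m algebra_simps)
  qed
qed

section \<open>The logarithmic weight\<close>

text \<open>The truncation \<open>max 0 t\<close> keeps the base at least \<open>ln a\<close>, so
  the weight is continuous on the whole line as \<open>strip_weight\<close> demands; the disc
  corresponds to t > 0.\<close>

definition strip_log_weight :: "real \<Rightarrow> real \<Rightarrow> real \<Rightarrow> real" where
  "strip_log_weight a q t = (ln a + max 0 t) powr (-1 - q / 2)"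

lemma strip_weight_log:
  assumes "1 < a" "2 \<le> q"
  shows "strip_weight (strip_log_weight a q)"
proof
  have "0 < ln a" using assms by simp
  then show "continuous_on UNIV (strip_log_weight a q)" unfolding strip_log_weight_def
    by (intro continuous_on_powr continuous_intros) (smt (verit) max.cobounded1)+
  show "strip_log_weight a q t \<le> strip_log_weight a q s" if "0 \<le> s" "s \<le> t" for s t
    unfolding strip_log_weight_def using that \<open>0 < ln a\<close> assms by (intro powr_mono2' add_pos_nonneg add_mono) auto
qed (simp add: strip_log_weight_def)

lemma strip_log_weight_tendsto_0:
  assumes "1 < a" "2 \<le> q"
  shows "(strip_log_weight a q \<longlongrightarrow> 0) at_top"
  unfolding strip_log_weight_def using assms
proof (intro tendsto_neg_powr)
  show "filterlim (\<lambda>t. ln a + max 0 t) at_top at_top"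
    by (intro filterlim_tendsto_add_at_top[OF tendsto_const]
        filterlim_at_top_mono[OF filterlim_ident]) auto
qed auto

text \<open>The exponent is below -1, so the weight is integrable at infinity. This makes the
  weighted measure finite, on which completeness of its Lebesgue space rests.\<close>

lemma strip_log_weight_integral_le:
  assumes "1 < a" "2 \<le> q"
  shows "integral {0..T} (strip_log_weight a q) \<le> 2 / q * ln a powr (- q / 2)"
proof (cases "0 \<le> T")
  case True
  have a0: "0 < ln a" using assms by simp
  have "(strip_log_weight a q has_integral
    (- 2 / q * (ln a + T) powr (- q / 2)) - (- 2 / q * (ln a + 0) powr (- q / 2))) {0..T}"
  proof (rule fundamental_theorem_of_calculus[OF True])
    fix t assume t: "t \<in> {0..T}"
    have "((\<lambda>t. - 2 / q * (ln a + t) powr (- q / 2)) has_real_derivative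
        - 2 / q * ((- q / 2) * (ln a + t) powr (- q / 2 - 1))) (at t within {0..T})"
      using t a0 by (auto intro!: derivative_eq_intros)
    moreover have "- 2 / q * ((- q / 2) * (ln a + t) powr (- q / 2 - 1)) = strip_log_weight a q t"
    proof -
      have "- q / 2 - 1 = - 1 - q / 2" by simp
      then show ?thesis using t assms by (simp only: strip_log_weight_def) simp
    qed
    ultimately show "((\<lambda>t. - 2 / q * (ln a + t) powr (- q / 2)) has_vector_derivative strip_log_weight a q t) (at t within {0..T})"
      by (simp add: has_real_derivative_iff_has_vector_derivative)
  qed
  then have "integral {0..T} (strip_log_weight a q)
    = 2 / q * ln a powr (- q / 2) - 2 / q * (ln a + T) powr (- q / 2)"
    by (simp add: integral_unique)
  also have "\<dots> \<le> 2 / q * ln a powr (- q / 2)" using assms by simp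
  finally show ?thesis .
next
  case False
  then show ?thesis using assms by simp
qed

section \<open>The weighted measure on the disc\<close>

lemma borel_measurable_log_weight [measurable]: "log_weight a q \<in> borel_measurable borel"
  unfolding log_weight_def by measurable

lemma measurable_disc_borel: "f \<in> borel_measurable borel \<Longrightarrow> f \<in> borel_measurable disc_measure"
  by (intro measurable_restrict_space1 measurable_completion) simp

lemma sets_weighted: "sets (weighted_disc_measure a q) = sets disc_measure"
  by (simp add: weighted_disc_measure_def)

lemma log_weight_pos: "1 < a \<Longrightarrow> x \<in> unit_disc \<Longrightarrow> x \<noteq> 0 \<Longrightarrow> 0 < log_weight a q x"
  by (simp add: log_weight_def field_simps)

text \<open>The weight is positive off the origin, so both measures have the same null sets, and
  limits in the weighted space and in L2 can be compared.\<close>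

lemma AE_weighted_iff:
  assumes "1 < a"
  shows "(AE x in weighted_disc_measure a q. P x) \<longleftrightarrow> (AE x in disc_measure. P x)"
proof -
  have m: "(\<lambda>x. ennreal (log_weight a q x)) \<in> borel_measurable disc_measure"
    by (rule measurable_disc_borel) measurable
  have nz: "AE x in disc_measure. 0 < log_weight a q x"
    using AE_disc_nonzero AE_space by eventually_elim (use log_weight_pos[OF assms] in auto)
  have "(AE x in weighted_disc_measure a q. P x) \<longleftrightarrow> (AE x in disc_measure. 0 < ennreal (log_weight a q x) \<longrightarrow> P x)"
    unfolding weighted_disc_measure_def by (rule AE_density[OF m])
  also have "\<dots> \<longleftrightarrow> (AE x in disc_measure. P x)" using nz by (auto elim!: eventually_elim2)
  finally show ?thesis .
qed

lemma nn_integral_weighted_polar: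
  assumes "1 < a" and [measurable]: "f \<in> borel_measurable borel" and "\<And>x. 0 \<le> f x"
  shows "(\<integral>\<^sup>+x. ennreal (f x) \<partial>weighted_disc_measure a q) =
    strip_nn (\<lambda>t \<theta>. ennreal (strip_log_weight a q t * f (polar t \<theta>)))" proof -
  have w: "log_weight a q (polar t \<theta>) * f (polar t \<theta>) * exp (-2*t) = strip_log_weight a q t * f (polar t \<theta>)"
    if "0 < t" for t \<theta>
  proof -
    have "exp (-t) powr (-2) = exp (2*t)" by (simp add: powr_def)
    moreover have "ln (a / exp (-t)) = ln a + t" using \<open>1 < a\<close> by (simp add: ln_div)
    moreover have "exp (2*t) * exp (-2*t) = (1::real)" by (simp flip: exp_add)
    ultimately show ?thesis using that by (simp add: log_weight_def strip_log_weight_def mult_ac)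
  qed
  have "(\<integral>\<^sup>+x. ennreal (f x) \<partial>weighted_disc_measure a q) = (\<integral>\<^sup>+x. ennreal (log_weight a q x) * ennreal (f x) \<partial>disc_measure)"
    unfolding weighted_disc_measure_def
    by (rule nn_integral_density; rule measurable_disc_borel; measurable)
  also have "\<dots> = strip_nn (\<lambda>t \<theta>. (ennreal (log_weight a q (polar t \<theta>)) * ennreal (f (polar t \<theta>))) * ennreal (exp (-2*t)))"
    by (rule nn_integral_disc_polar) measurable
  also have "\<dots> = strip_nn (\<lambda>t \<theta>. ennreal (strip_log_weight a q t * f (polar t \<theta>)))"
  proof (rule nn_integral_cong)
    fix t :: real
    show "(\<integral>\<^sup>+\<theta>\<in>{0..2*pi}. (ennreal (log_weight a q (polar t \<theta>)) * ennreal (f (polar t \<theta>))) * ennreal (exp (-2*t)) \<partial>lborel) * indicator {0<..} t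
     = (\<integral>\<^sup>+\<theta>\<in>{0..2*pi}. ennreal (strip_log_weight a q t * f (polar t \<theta>)) \<partial>lborel) * indicator {0<..} t"
    proof (cases "0 < t")
      case True
      have "ennreal (log_weight a q (polar t \<theta>)) * ennreal (f (polar t \<theta>)) * ennreal (exp (-2*t))
        = ennreal (strip_log_weight a q t * f (polar t \<theta>))" for \<theta>
        using assms(3) unfolding w[OF True, symmetric] by (simp add: ennreal_mult log_weight_def)
      then show ?thesis by simp
    qed simp
  qed
  finally show ?thesis .
qed

lemma finite_measure_weighted:
  assumes "1 < a" "2 \<le> q"
  shows "finite_measure (weighted_disc_measure a q)"
proof
  interpret strip_weight "strip_log_weight a q" by (rule strip_weight_log[OF assms])
  have "emeasure (weighted_disc_measure a q) (space (weighted_disc_measure a q)) = (\<integral>\<^sup>+x. ennreal 1 \<partial>weighted_disc_measure a q)"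
    by simp
  also have "\<dots> = strip_nn (\<lambda>t \<theta>. ennreal (strip_log_weight a q t * 1))"
    using assms by (intro nn_integral_weighted_polar) auto
  also have "\<dots> \<le> ennreal (2 * pi * (2 / q * ln a powr (- q / 2)))"
  proof (rule nn_integral_half_strip_le)
    show "continuous2 (\<lambda>t \<theta>. strip_log_weight a q t * 1)" by (rule continuous2_weighted) simp
    show "strip_int (real n) (\<lambda>t \<theta>. strip_log_weight a q t * 1) \<le> 2 * pi * (2 / q * ln a powr (- q / 2))" for n
      using mult_left_mono[OF strip_log_weight_integral_le[OF assms, of "real n"], of "2*pi"]
      by (simp add: strip_int_def)
  qed (simp add: w_nonneg)
  finally show "emeasure (weighted_disc_measure a q) (space (weighted_disc_measure a q)) \<noteq> \<infinity>"
    by (auto simp: top_unique)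
qed

lemma weighted_lp_bound:
  assumes a: "1 < a" and q: "2 \<le> q" and f: "f \<in> test_functions" and B: "0 \<le> B"
    "\<And>n::nat. strip_int (real n) (\<lambda>t \<theta>. strip_log_weight a q t * \<bar>pull f t \<theta>\<bar> powr q) \<le> B"
  shows "f \<in> lp_space q (weighted_disc_measure a q)" "lp_int q (weighted_disc_measure a q) f \<le> B"
proof -
  let ?W = "weighted_disc_measure a q"
  interpret strip_weight "strip_log_weight a q" by (rule strip_weight_log[OF a q])
  interpret strip_fn "pull f" "pull_t f" "pull_\<theta> f" by (rule strip_fn_pull[OF f])
  have mf [measurable]: "f \<in> borel_measurable borel"
    by (intro borel_measurable_continuous_onI test_fn_continuous_on f)
  have mW: "f \<in> borel_measurable ?W"
    using measurable_disc_borel[OF mf] by (simp add: measurable_cong_sets[OF sets_weighted refl])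
  have "(\<integral>\<^sup>+x. ennreal (norm (f x) powr q) \<partial>?W) = strip_nn (\<lambda>t \<theta>. ennreal (strip_log_weight a q t * norm (f (polar t \<theta>)) powr q))"
    by (rule nn_integral_weighted_polar[OF a]) auto
  also have "\<dots> \<le> ennreal B" unfolding pull_def[symmetric] real_norm_def
    by (rule nn_integral_half_strip_le)
       (use q in \<open>auto intro!: continuous2_weighted continuous2_powr cont B w_nonneg mult_nonneg_nonneg\<close>)
  finally have le: "(\<integral>\<^sup>+x. ennreal (norm (f x) powr q) \<partial>?W) \<le> ennreal B" .
  have i: "integrable ?W (\<lambda>x. norm (f x) powr q)"
    using mW le by (intro integrableI_bounded) (auto simp: le_less_trans[OF _ ennreal_less_top])
  then show "f \<in> lp_space q ?W" using mW by (simp add: lp_space_def)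
  show "lp_int q ?W f \<le> B"
    using le i B(1) by (subst (asm) nn_integral_eq_integral) (auto simp: lp_int_def)
qed

lemma exponent_exists: "\<exists>k. q + 1 \<le> real (2 * Suc k)"
proof -
  obtain k :: nat where "q + 1 \<le> real k" using real_arch_simple by blast
  then show ?thesis by (intro exI[of _ k]) simp
qed

text \<open>For general \<open>k\<close> not homogeneous in the energy \<open>e\<close>, so it
  bounds no ratio of norms directly; continuity in \<open>e\<close> and the value 0 at 0 suffice for
  continuity of a linear inclusion.\<close>

definition emb_const :: "real \<Rightarrow> real \<Rightarrow> nat \<Rightarrow> real \<Rightarrow> real" where
  "emb_const a q k e = strip_log_weight a q 0 * (pow_const 0 e + pow_const k e)"

lemma test_fn_embedding:
  assumes a: "1 < a" and q: "2 \<le> q" "q + 1 \<le> real (2 * Suc k)"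
    and f: "f \<in> test_functions" "mean_zero_fn f"
  shows "f \<in> lp_space q (weighted_disc_measure a q)"
    "lp_int q (weighted_disc_measure a q) f \<le> emb_const a q k (dirichlet f)"
proof -
  interpret weighted_strip_fn "pull f" "pull_t f" "pull_\<theta> f" "strip_log_weight a q"
    by (simp add: weighted_strip_fn_def mean_zero_strip_fn_pull[OF f] strip_weight_log[OF a q(1)])
  have "strip_int T (\<lambda>t \<theta>. strip_log_weight a q t * \<bar>pull f t \<theta>\<bar> powr q) \<le> emb_const a q k (dirichlet f)" for T
    unfolding emb_const_def
    using q by (intro strip_weighted_powr_bound strip_energy_le_dirichlet f) auto
  moreover have "0 \<le> emb_const a q k (dirichlet f)"
    unfolding emb_const_def by (intro mult_nonneg_nonneg add_nonneg_nonneg w_nonneg pow_const_nonneg dirichlet_nonneg)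
  ultimately show "f \<in> lp_space q (weighted_disc_measure a q)"
    "lp_int q (weighted_disc_measure a q) f \<le> emb_const a q k (dirichlet f)"
    by (auto intro: weighted_lp_bound[OF a q(1) f(1)])
qed

lemma emb_const_tendsto_0:
  assumes "(d \<longlongrightarrow> 0) F"
  shows "((\<lambda>n. emb_const a q k (d n)) \<longlongrightarrow> 0) F"
proof -
  have "((\<lambda>n. emb_const a q k (d n)) \<longlongrightarrow> strip_log_weight a q 0 * (pow_const 0 0 + pow_const k 0)) F"
    unfolding emb_const_def
    by (intro tendsto_intros isCont_tendsto_compose[OF isCont_pow_const] assms)
  then show ?thesis by (simp only: pow_const_0) simp
qed

section \<open>Compactness\<close>

text \<open>Divided by \<open>h\<close> rather than by the area of the cell, so that its square is a
  term of \<open>strip_Poincare\<close>. The mesh is part of the index, which makes the cells of all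
  meshes one countable family.\<close>

definition cell_mean :: "(real^2 \<Rightarrow> real) \<Rightarrow> nat \<times> nat \<times> nat \<Rightarrow> real" where
  "cell_mean f = (\<lambda>(N, i, j). let h = 2*pi / real N in cell_integral (pull f) h i j / h)"

lemma cell_mean_diff:
  assumes f: "f \<in> test_functions" and g: "g \<in> test_functions"
  shows "cell_mean (\<lambda>x. f x - g x) p = cell_mean f p - cell_mean g p"
proof -
  note cont = strip_fn.cont(1)[OF strip_fn_pull]
  have 1: "integral {c..d} (pull (\<lambda>x. f x - g x) t) = integral {c..d} (pull f t) - integral {c..d} (pull g t)" for c d t
    using integral_diff[of "pull f t" "{c..d}" "pull g t"] continuous2_left[OF cont[OF f]] continuous2_left[OF cont[OF g]]
    by (simp add: pull_def[abs_def] cont_integrable)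
  have "integral {a..b} (\<lambda>t. integral {c..d} (pull (\<lambda>x. f x - g x) t))
    = integral {a..b} (\<lambda>t. integral {c..d} (pull f t)) - integral {a..b} (\<lambda>t. integral {c..d} (pull g t))" for a b c d
    unfolding 1 by (intro integral_diff cont_integrable cont_int_left cont f g)
  then show ?thesis by (cases p) (simp add: cell_mean_def Let_def diff_divide_distrib)
qed

lemma cell_mean_bound:
  assumes f: "f \<in> test_functions" "mean_zero_fn f" and N: "0 < N" "j < N" and e: "dirichlet f \<le> e"
  shows "\<bar>cell_mean f (N, i, j)\<bar> \<le> sqrt (pow_const 0 e)"
proof -
  interpret mean_zero_strip_fn "pull f" "pull_t f" "pull_\<theta> f"
    by (rule mean_zero_strip_fn_pull[OF f])
  define h where "h = 2*pi / real N"
  have "cell_mean f (N, i, j) = cell_integral (pull f) h i j / h"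
    by (simp only: cell_mean_def prod.case Let_def h_def)
  then have "(cell_mean f (N, i, j))\<^sup>2 =
    (cell_integral (pull f) h i j)\<^sup>2 / h\<^sup>2" by (simp only: power_divide)
  also have "\<dots> \<le> strip_int (real (Suc i)*h) (\<lambda>t \<theta>. (pull f t \<theta>)\<^sup>2)"
    by (rule cell_integral_bound[OF N(1) h_def _ N(2)]) simp
  also have "\<dots> \<le> 4 * pi\<^sup>2 * energy (real (Suc i)*h)" by (rule strip_Wirtinger)
  also have "\<dots> \<le> pow_const 0 e"
    using strip_energy_le_dirichlet[OF f(1), of "real (Suc i)*h"] e by simp
  finally have "\<bar>cell_mean f (N, i, j)\<bar>\<^sup>2 \<le> pow_const 0 e" by simp
  then show ?thesis by (rule real_le_rsqrt)
qed

lemma dirichlet_diff_le: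
  assumes f: "f \<in> test_functions" and g: "g \<in> test_functions"
  shows "dirichlet (\<lambda>x. f x - g x) \<le> 4 * (dirichlet f + dirichlet g)"
proof -
  have "dirichlet (\<lambda>x. f x - g x) = L2_int (\<lambda>x. grad f x - grad g x)"
    by (simp add: dirichlet_def lp_int_2 grad_diff f g)
  also have "\<dots> \<le> 4 * (dirichlet f + dirichlet g)"
    unfolding dirichlet_eq_lp_int by (intro lp_int_2_diff_le test_fn_lp_space f g; simp)
  finally show ?thesis .
qed

text \<open>A diagonal argument over the cells of all meshes yields one subsequence before any
  \<epsilon> is fixed. For given \<epsilon> a single grid is then chosen, and convergence of its
  finitely many cell means makes the differences small.\<close>

lemma mean_zero_compactness:
  assumes a: "1 < a" and q: "2 \<le> q"
    and \<phi>: "\<And>n. \<phi> n \<in> test_functions" "\<And>n. mean_zero_fn (\<phi> n)" "\<And>n. dirichlet (\<phi> n) \<le> e"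
  obtains r :: "nat \<Rightarrow> nat" where "strict_mono r"
    "\<And>\<epsilon>. 0 < \<epsilon> \<Longrightarrow> \<exists>n0. \<forall>m\<ge>n0. \<forall>n\<ge>n0.
       lp_int q (weighted_disc_measure a q) (\<lambda>x. \<phi> (r m) x - \<phi> (r n) x) < \<epsilon>" proof -
  let ?W = "weighted_disc_measure a q" and ?w = "strip_log_weight a q"
  interpret strip_weight ?w by (rule strip_weight_log[OF a q])
  define S :: "(nat \<times> nat \<times> nat) set" where "S = {(N, i, j). 0 < N \<and> j < N}"
  have "countable S" by simp
  moreover have "norm (cell_mean (\<phi> n) p) \<le> sqrt (pow_const 0 e)" if "p \<in> S" for n p
    using that cell_mean_bound[OF \<phi>(1,2) _ _ \<phi>(3)] by (auto simp: S_def)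
  ultimately obtain r where r: "strict_mono (r::nat\<Rightarrow>nat)"
    and conv: "\<And>p. p \<in> S \<Longrightarrow> \<exists>l. (\<lambda>n. cell_mean (\<phi> (r n)) p) \<longlonglongrightarrow> l"
    using function_convergent_subsequence[of S "\<lambda>n. cell_mean (\<phi> n)"] by blast
  obtain l where l: "\<And>p. p \<in> S \<Longrightarrow> (\<lambda>n. cell_mean (\<phi> (r n)) p) \<longlonglongrightarrow> l p" using conv by metis
  have "\<exists>n0. \<forall>m\<ge>n0. \<forall>n\<ge>n0. lp_int q ?W (\<lambda>x. \<phi> (r m) x - \<phi> (r n) x) < \<epsilon>" if "0 < \<epsilon>" for \<epsilon>
  proof -
    obtain k where k: "q + 1 \<le> real (2 * Suc k)" using exponent_exists by blast
    \<comment> \<open>\<open>dirichlet_diff_le\<close> gives \<open>4 * (e + e)\<close> for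
      differences.\<close>
    define e' where "e' = 8 * e"
    have e0: "0 \<le> e'" using dirichlet_nonneg[of "\<phi> 0"] \<phi>(3)[of 0] by (simp add: e'_def)
    note P0 = pow_const_nonneg[OF e0]
    \<comment> \<open>\<open>K\<close>, \<open>N\<close> and \<open>M\<close> each bring one term of
      \<open>strip_compactness_bound\<close> to at most \<epsilon> / 4, in this order, since the
      choice of \<open>N\<close> involves \<open>K\<close> and that of \<open>M\<close> the mesh
      \<open>h\<close>.\<close>
    define K where "K = max 1 (?w 0 * pow_const k e' / (\<epsilon> / 4))"
    have K: "1 \<le> K" by (simp add: K_def)
    have "?w 0 * pow_const k e' / (\<epsilon> / 4) \<le> K" by (simp add: K_def)
    then have bK: "?w 0 * (pow_const k e' / K) \<le> \<epsilon> / 4"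
      using K \<open>0 < \<epsilon>\<close> by (simp add: field_simps)
    define c where "c = ?w 0 * K powr (q - 2)"
    have c: "0 \<le> c" by (simp add: c_def w_nonneg)
    have "(\<lambda>N. c * ((2*pi / real N)\<^sup>2 * e')) \<longlonglongrightarrow> c * (0\<^sup>2 * e')"
      by (intro tendsto_intros lim_const_over_n)
    then have "\<forall>\<^sub>F N in sequentially. c * ((2*pi / real N)\<^sup>2 * e') < \<epsilon> / 4"
      using \<open>0 < \<epsilon>\<close> by (intro order_tendstoD(2)) auto
    then obtain N where N: "0 < N" "c * ((2*pi / real N)\<^sup>2 * e') < \<epsilon> / 4"
      using eventually_conj[OF _ eventually_gt_at_top[of 0]] eventually_happens'[OF sequentially_bot]
      by (metis (mono_tags, lifting))
    define h where "h = 2*pi / real N"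
    have h: "0 < h" using N by (simp add: h_def)
    have "filterlim (\<lambda>M. real M * h) at_top sequentially"
      using h by (intro filterlim_at_top_mult_tendsto_pos[OF tendsto_const] filterlim_real_sequentially)
    then have "(\<lambda>M. ?w (real M * h) * (pow_const 0 e' + pow_const k e')) \<longlonglongrightarrow> 0 * (pow_const 0 e' + pow_const k e')"
      by (intro tendsto_intros filterlim_compose[OF strip_log_weight_tendsto_0[OF a q]])
    then have "\<forall>\<^sub>F M in sequentially. ?w (real M * h) * (pow_const 0 e' + pow_const k e') < \<epsilon> / 4"
      using \<open>0 < \<epsilon>\<close> by (intro order_tendstoD(2)) auto
    then obtain M where M: "?w (real M * h) * (pow_const 0 e' + pow_const k e') < \<epsilon> / 4"
      using eventually_happens'[OF sequentially_bot] by blast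
    \<comment> \<open>Squared distance of the cell means from their limits on the chosen grid. The
      bound \<epsilon> / 16 enters four times and makes up the last quarter of \<epsilon>.\<close>
    define s where "s = (\<lambda>n. \<Sum>j<N. \<Sum>i<M. (cell_mean (\<phi> (r n)) (N, i, j) - l (N, i, j))\<^sup>2)"
    have "(\<lambda>n. c * s n) \<longlonglongrightarrow> c * (\<Sum>j<N. \<Sum>i<M. (l (N, i, j) - l (N, i, j))\<^sup>2)"
      unfolding s_def using N(1) by (intro tendsto_intros l) (auto simp: S_def)
    then have "\<forall>\<^sub>F n in sequentially. c * s n < \<epsilon> / 16"
      using \<open>0 < \<epsilon>\<close> by (intro order_tendstoD(2)) auto
    then obtain n0 where n0: "\<And>n. n0 \<le> n \<Longrightarrow> c * s n < \<epsilon> / 16"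
      by (auto simp: eventually_sequentially)
    have "lp_int q ?W (\<lambda>x. \<phi> (r m) x - \<phi> (r n) x) < \<epsilon>" if mn: "n0 \<le> m" "n0 \<le> n" for m n
    proof -
      let ?f = "\<lambda>x. \<phi> (r m) x - \<phi> (r n) x"
      have f: "?f \<in> test_functions" "mean_zero_fn ?f" by (intro test_fn_diff mean_zero_fn_diff \<phi>)+
      interpret F: weighted_strip_fn "pull ?f" "pull_t ?f" "pull_\<theta> ?f" ?w
        by (simp add: weighted_strip_fn_def mean_zero_strip_fn_pull[OF f] strip_weight_log[OF a q])
      have Df: "dirichlet ?f \<le> e'"
        using dirichlet_diff_le[OF \<phi>(1) \<phi>(1), of "r m" "r n"] \<phi>(3)[of "r m"] \<phi>(3)[of "r n"]
        by (simp add: e'_def)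
      have E: "F.energy T \<le> e'" for T using strip_energy_le_dirichlet[OF f(1), of T] Df by simp
      define C where "C = (\<Sum>j<N. \<Sum>i<M. (cell_integral (pull ?f) h i j)\<^sup>2 / h\<^sup>2)"
      have "C = (\<Sum>j<N. \<Sum>i<M. (cell_mean ?f (N, i, j))\<^sup>2)"
        by (simp only: C_def cell_mean_def h_def prod.case Let_def power_divide)
      also have "\<dots> \<le> (\<Sum>j<N. \<Sum>i<M. 2 * (cell_mean (\<phi> (r m)) (N, i, j) - l (N, i, j))\<^sup>2
          + 2 * (cell_mean (\<phi> (r n)) (N, i, j) - l (N, i, j))\<^sup>2)" proof (intro sum_mono)
        have "(x - y)\<^sup>2 \<le> 2 * (x - z)\<^sup>2 + 2 * (y - z)\<^sup>2" for x y z :: real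
        proof -
          have "2 * (x - z)\<^sup>2 + 2 * (y - z)\<^sup>2 - (x - y)\<^sup>2 = (x + y - 2 * z)\<^sup>2"
            unfolding power2_eq_square by algebra
          then show ?thesis using zero_le_power2[of "x + y - 2 * z"] by linarith
        qed
        then show "(cell_mean ?f (N, i, j))\<^sup>2 \<le> 2 * (cell_mean (\<phi> (r m)) (N, i, j) - l (N, i, j))\<^sup>2
          + 2 * (cell_mean (\<phi> (r n)) (N, i, j) - l (N, i, j))\<^sup>2" for i j
          unfolding cell_mean_diff[OF \<phi>(1) \<phi>(1)] .
      qed
      also have "\<dots> = 2 * s m + 2 * s n" by (simp add: s_def sum.distrib sum_distrib_left)
      finally have C: "C \<le> 2 * s m + 2 * s n" .
      define B where "B = ?w 0 * (K powr (q - 2) * (C + h\<^sup>2 * e') + pow_const k e' / K)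
        + ?w (real M*h) * (pow_const 0 e' + pow_const k e')"
      have "B = c * C + c * (h\<^sup>2 * e') + ?w 0 * (pow_const k e' / K)
        + ?w (real M*h) * (pow_const 0 e' + pow_const k e')"
        by (simp add: B_def c_def algebra_simps)
      also have "c * C \<le> c * (2 * s m + 2 * s n)" using C c by (rule mult_left_mono)
      also have "c * (2 * s m + 2 * s n) = 2 * (c * s m) + 2 * (c * s n)" by (simp add: algebra_simps)
      finally have "B < \<epsilon>" using n0[OF mn(1)] n0[OF mn(2)] N(2) bK M by (simp add: h_def)
      moreover have "lp_int q ?W ?f \<le> B"
      proof (rule weighted_lp_bound(2)[OF a q f(1)])
        have "0 \<le> C" unfolding C_def by (intro sum_nonneg) auto
        then show "0 \<le> B" unfolding B_def using K e0 P0
          by (intro add_nonneg_nonneg mult_nonneg_nonneg divide_nonneg_nonneg w_nonneg) auto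
        show "strip_int (real T) (\<lambda>t \<theta>. ?w t * \<bar>pull ?f t \<theta>\<bar> powr q) \<le> B" for T :: nat
          unfolding B_def C_def by (rule F.strip_compactness_bound[OF E q k K N(1) h_def])
      qed
      ultimately show ?thesis by simp
    qed
    then show ?thesis by blast
  qed
  with r show ?thesis using that by blast
qed

section \<open>From test functions to the orthogonal complement\<close>

lemma emb_const_small:
  fixes a q \<epsilon> :: real and k :: nat
  assumes "0 < \<epsilon>"
  obtains \<delta> where "0 < \<delta>" "\<And>d. 0 \<le> d \<Longrightarrow> d < \<delta> \<Longrightarrow> emb_const a q k d < \<epsilon>"
proof -
  have "\<forall>\<^sub>F d in nhds 0. emb_const a q k d < \<epsilon>"
    by (rule order_tendstoD(2)[OF emb_const_tendsto_0 assms]) (simp add: filterlim_ident)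
  then obtain \<delta> where "0 < \<delta>" "\<And>d. dist d 0 < \<delta> \<Longrightarrow> emb_const a q k d < \<epsilon>"
    by (auto simp: eventually_nhds_metric)
  then show ?thesis using that by (auto simp: dist_real_def)
qed

text \<open>The estimate for test functions makes the sequence Cauchy in the weighted space. Its
  limit there is \<open>u\<close> itself, because along a common subsequence both limits are
  attained almost everywhere.\<close>

lemma H01_rad_perp_weighted:
  assumes a: "1 < a" and q: "2 \<le> q" and us: "u \<in> L2_disc"
    and gs: "g \<in> L2_disc"
    and \<psi>: "\<And>n. \<psi> n \<in> test_functions" "\<And>n. mean_zero_fn (\<psi> n)"
    "(\<lambda>n. L2_int (\<lambda>x. \<psi> n x - u x)) \<longlonglongrightarrow> 0"
    "(\<lambda>n. L2_int (\<lambda>x. grad (\<psi> n) x - g x)) \<longlonglongrightarrow> 0"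
  shows "u \<in> lp_space q (weighted_disc_measure a q)"
    "(\<lambda>n. lp_int q (weighted_disc_measure a q) (\<lambda>x. \<psi> n x - u x)) \<longlonglongrightarrow> 0"
proof -
  let ?M = disc_measure and ?W = "weighted_disc_measure a q"
  interpret M: finite_measure ?M by (rule finite_measure_disc)
  interpret W: finite_measure ?W by (rule finite_measure_weighted[OF a q])
  obtain k where k: "q + 1 \<le> real (2 * Suc k)" using exponent_exists by blast
  have sp: "\<psi> n \<in> L2_disc" "grad (\<psi> n) \<in> L2_disc" for n by (intro test_fn_lp_space \<psi>; simp)+
  have spW: "\<psi> n \<in> lp_space q ?W" for n by (intro test_fn_embedding(1)[OF a q k] \<psi>)
  have "\<exists>v\<in>lp_space q ?W. (\<lambda>n. lp_int q ?W (\<lambda>x. \<psi> n x - v x)) \<longlonglongrightarrow> 0"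
  proof (rule W.lp_complete[OF spW])
    fix \<epsilon> :: real assume "0 < \<epsilon>"
    then obtain \<delta> where \<delta>: "0 < \<delta>" "\<And>d. 0 \<le> d \<Longrightarrow> d < \<delta> \<Longrightarrow> emb_const a q k d < \<epsilon>"
      using emb_const_small[of \<epsilon> a q k] by blast
    obtain N where N: "\<forall>m\<ge>N. \<forall>n\<ge>N. L2_int (\<lambda>x. grad (\<psi> m) x - grad (\<psi> n) x) < \<delta>"
      using Cauchy_lp_int_2[OF sp(2) gs \<psi>(4) \<delta>(1)] by blast
    have "lp_int q ?W (\<lambda>x. \<psi> m x - \<psi> n x) < \<epsilon>" if "N \<le> m" "N \<le> n" for m n
    proof -
      have "lp_int q ?W (\<lambda>x. \<psi> m x - \<psi> n x) \<le> emb_const a q k (dirichlet (\<lambda>x. \<psi> m x - \<psi> n x))"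
        by (intro test_fn_embedding(2)[OF a q k] test_fn_diff mean_zero_fn_diff \<psi>)
      also have "\<dots> < \<epsilon>"
        using N that by (intro \<delta>(2) dirichlet_nonneg) (simp add: dirichlet_def lp_int_2 grad_diff \<psi>)
      finally show ?thesis .
    qed
    then show "\<exists>N. \<forall>m\<ge>N. \<forall>n\<ge>N. lp_int q ?W (\<lambda>x. \<psi> m x - \<psi> n x) < \<epsilon>" by blast
  qed (use q in simp)
  then obtain v where v: "v \<in> lp_space q ?W" "(\<lambda>n. lp_int q ?W (\<lambda>x. \<psi> n x - v x)) \<longlonglongrightarrow> 0" by blast
  have "AE x in ?M. u x = v x"
  proof -
    obtain r where r: "strict_mono r" "AE x in ?M. (\<lambda>n. \<psi> (r n) x) \<longlonglongrightarrow> v x"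
      using W.lp_tendsto_imp_AE_subseq[OF spW v(1) _ v(2)] q unfolding AE_weighted_iff[OF a] by auto
    have "(\<lambda>n. L2_int (\<lambda>x. \<psi> (r n) x - u x)) \<longlonglongrightarrow> 0"
      using LIMSEQ_subseq_LIMSEQ[OF \<psi>(3) r(1)] by (simp add: o_def)
    then obtain r' where r': "strict_mono r'" "AE x in ?M. (\<lambda>n. \<psi> (r (r' n)) x) \<longlonglongrightarrow> u x"
      using M.lp_tendsto_imp_AE_subseq[OF sp(1) us, of r] by auto
    show ?thesis using r(2) r'(2)
    proof eventually_elim
      fix x assume "(\<lambda>n. \<psi> (r n) x) \<longlonglongrightarrow> v x" and u: "(\<lambda>n. \<psi> (r (r' n)) x) \<longlonglongrightarrow> u x"
      then have "(\<lambda>n. \<psi> (r (r' n)) x) \<longlonglongrightarrow> v x"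
        using LIMSEQ_subseq_LIMSEQ[OF _ r'(1)] by (fastforce simp: o_def)
      with u show "u x = v x" by (rule LIMSEQ_unique)
    qed
  qed
  then have ae: "AE x in ?W. u x = v x" by (simp add: AE_weighted_iff[OF a])
  have mu: "u \<in> borel_measurable ?W"
    using lp_space_measurable[OF us] by (simp add: measurable_cong_sets[OF sets_weighted refl])
  note mv = lp_space_measurable[OF v(1)] and m\<psi> = lp_space_measurable[OF spW]
  have "integrable ?W (\<lambda>x. norm (u x) powr q) \<longleftrightarrow> integrable ?W (\<lambda>x. norm (v x) powr q)"
    using mu mv ae by (intro integrable_cong_AE) auto
  with lp_space_integrable[OF v(1)] mu show "u \<in> lp_space q ?W" by (simp add: lp_space_def)
  have "lp_int q ?W (\<lambda>x. \<psi> n x - u x) = lp_int q ?W (\<lambda>x. \<psi> n x - v x)" for n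
    unfolding lp_int_def using mu mv m\<psi>[of n] ae by (intro integral_cong_AE) auto
  with v(2) show "(\<lambda>n. lp_int q ?W (\<lambda>x. \<psi> n x - u x)) \<longlonglongrightarrow> 0" by simp
qed

text \<open>Reduces continuity to continuity at 0. \<open>h01_grad\<close> of a difference is the
  difference of the gradients only almost everywhere, so linearity goes through
  \<open>has_h01_grad_unique\<close>.\<close>

lemma H01_rad_perp_diff:
  assumes "u \<in> H01_rad_perp" "v \<in> H01_rad_perp"
  shows "(\<lambda>x. u x - v x) \<in> H01_rad_perp"
proof -
  have u: "has_h01_grad u (h01_grad u)" and v: "has_h01_grad v (h01_grad v)"
    using assms by (auto simp: H01_rad_perp_def intro: h01_grad)
  note d = has_h01_grad_diff[OF u v]
  then have uv: "(\<lambda>x. u x - v x) \<in> H01" by (auto simp: H01_def)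
  note d' = h01_grad[OF uv]
  have "h01_inner (\<lambda>x. u x - v x) w = 0" if w: "w \<in> H01_rad" for w
  proof -
    have sp: "h01_grad u \<in> L2_disc" "h01_grad v \<in> L2_disc"
      "h01_grad (\<lambda>x. u x - v x) \<in> L2_disc" "h01_grad w \<in> L2_disc"
      using u v d' h01_grad[of w] w by (auto simp: has_h01_grad_iff H01_rad_def)
    have "h01_inner (\<lambda>x. u x - v x) w = (\<integral>x. (h01_grad u x - h01_grad v x) \<bullet> h01_grad w x \<partial>disc_measure)"
      unfolding h01_inner_def
      using has_h01_grad_unique[OF d' d] L2_inner(1)[OF sp(3,4)] L2_inner(1)[OF lp_int_diff(1)[OF sp(1,2)] sp(4)]
      by (intro integral_cong_AE borel_measurable_integrable) (auto elim: eventually_mono)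
    also have "\<dots> = h01_inner u w - h01_inner v w"
      using L2_inner(1)[OF sp(1,4)] L2_inner(1)[OF sp(2,4)] by (simp add: h01_inner_def inner_diff_left)
    also have "\<dots> = 0" using assms w by (simp add: H01_rad_perp_def)
    finally show ?thesis .
  qed
  with uv show ?thesis by (simp add: H01_rad_perp_def)
qed

text \<open>Estimates for test functions carry over to \<open>u\<close> with error \<epsilon> once a
  single test function is near it both in energy and in the weighted space; one far out in the
  approximating sequence serves.\<close>

lemma H01_rad_perp_approx_weighted:
  assumes a: "1 < a" and q: "2 \<le> q" and u: "u \<in> H01_rad_perp" and "0 < \<epsilon>"
  obtains \<psi> where "\<psi> \<in> test_functions" "mean_zero_fn \<psi>" "dirichlet \<psi> \<le> 4 * ((h01_norm u)\<^sup>2 + \<epsilon>)"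
    "u \<in> lp_space q (weighted_disc_measure a q)"
    "lp_int q (weighted_disc_measure a q) (\<lambda>x. \<psi> x - u x) < \<epsilon>"
proof -
  let ?M = disc_measure and ?W = "weighted_disc_measure a q" and ?g = "h01_grad u"
  have sp: "u \<in> L2_disc" "?g \<in> L2_disc"
    using u h01_grad[of u] by (auto simp: H01_rad_perp_def has_h01_grad_iff)
  obtain \<psi> where \<psi>: "\<And>n. \<psi> n \<in> test_functions" "\<And>n. mean_zero_fn (\<psi> n)"
    "(\<lambda>n. L2_int (\<lambda>x. \<psi> n x - u x)) \<longlonglongrightarrow> 0"
    "(\<lambda>n. L2_int (\<lambda>x. grad (\<psi> n) x - ?g x)) \<longlonglongrightarrow> 0" using H01_rad_perp_approx[OF u] by blast
  note W = H01_rad_perp_weighted[OF a q sp \<psi>]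
  have "\<forall>\<^sub>F n in sequentially. L2_int (\<lambda>x. grad (\<psi> n) x - ?g x) < \<epsilon> \<and> lp_int q ?W (\<lambda>x. \<psi> n x - u x) < \<epsilon>"
    by (intro eventually_conj order_tendstoD(2)[OF \<psi>(4)] order_tendstoD(2)[OF W(2)] \<open>0 < \<epsilon>\<close>)
  then obtain n where n: "L2_int (\<lambda>x. grad (\<psi> n) x - ?g x) < \<epsilon>" "lp_int q ?W (\<lambda>x. \<psi> n x - u x) < \<epsilon>"
    using eventually_happens'[OF sequentially_bot] by blast
  have "dirichlet (\<psi> n) = L2_int (\<lambda>x. ?g x + (grad (\<psi> n) x - ?g x))"
    by (simp add: dirichlet_eq_lp_int)
  also have "\<dots> \<le> 4 * (L2_int ?g + L2_int (\<lambda>x. grad (\<psi> n) x - ?g x))"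
    by (intro lp_int_2_add_le lp_int_diff(1) sp test_fn_lp_space \<psi>) auto
  also have "\<dots> \<le> 4 * ((h01_norm u)\<^sup>2 + \<epsilon>)"
    using n(1) lp_int_nonneg[of 2 ?M ?g] by (simp add: h01_norm_eq)
  finally show ?thesis using that[of "\<psi> n"] \<psi> W(1) n(2) by blast
qed

lemma H01_rad_perp_embedding_continuous:
  assumes a: "1 < a" and q: "2 \<le> q" and "0 < e"
  obtains d where "0 < d"
    "\<And>u. u \<in> H01_rad_perp \<Longrightarrow> h01_norm u < d \<Longrightarrow> lp_norm q (weighted_disc_measure a q) u < e"
proof -
  let ?W = "weighted_disc_measure a q"
  obtain k where k: "q + 1 \<le> real (2 * Suc k)" using exponent_exists by blast
  \<comment> \<open>The divisors undo \<open>2 powr q\<close> from \<open>lp_int_diff\<close> and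
    the sum of two terms.\<close>
  define \<epsilon> where "\<epsilon> = e powr q / (2 powr q * 2)"
  have \<epsilon>: "0 < \<epsilon>" using \<open>0 < e\<close> by (simp add: \<epsilon>_def)
  obtain \<delta> where \<delta>: "0 < \<delta>" "\<And>d. 0 \<le> d \<Longrightarrow> d < \<delta> \<Longrightarrow> emb_const a q k d < \<epsilon>"
    using emb_const_small[OF \<epsilon>] by blast
  \<comment> \<open>With this radius the approximant has energy below
    \<open>4 * (\<delta> / 8 + \<delta> / 8)\<close>, which is \<delta>.\<close>
  show ?thesis
  proof (rule that[of "sqrt (\<delta> / 8)"])
    show "0 < sqrt (\<delta> / 8)" using \<delta> by simp
    fix u assume u: "u \<in> H01_rad_perp" and small: "h01_norm u < sqrt (\<delta> / 8)"
    have "0 \<le> h01_norm u" by (simp add: h01_norm_eq lp_int_nonneg)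
    then have "(h01_norm u)\<^sup>2 < \<delta> / 8"
      using small \<delta>(1) power_strict_mono[of "h01_norm u" "sqrt (\<delta> / 8)" 2] by simp
    obtain \<psi> where \<psi>: "\<psi> \<in> test_functions" "mean_zero_fn \<psi>"
      "dirichlet \<psi> \<le> 4 * ((h01_norm u)\<^sup>2 + min \<epsilon> (\<delta> / 8))" "u \<in> lp_space q ?W"
      "lp_int q ?W (\<lambda>x. \<psi> x - u x) < min \<epsilon> (\<delta> / 8)"
      using H01_rad_perp_approx_weighted[OF a q u, of "min \<epsilon> (\<delta> / 8)"] \<epsilon> \<delta>(1) by auto
    have "dirichlet \<psi> < \<delta>" using \<psi>(3) \<open>(h01_norm u)\<^sup>2 < \<delta> / 8\<close> by (simp add: min_def split: if_splits)
    then have "emb_const a q k (dirichlet \<psi>) < \<epsilon>" by (intro \<delta>(2) dirichlet_nonneg)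
    then have 1: "lp_int q ?W \<psi> < \<epsilon>" using test_fn_embedding(2)[OF a q k \<psi>(1,2)] by simp
    have sp: "\<psi> \<in> lp_space q ?W" by (rule test_fn_embedding(1)[OF a q k \<psi>(1,2)])
    have "lp_int q ?W u = lp_int q ?W (\<lambda>x. \<psi> x - (\<psi> x - u x))" by simp
    also have "\<dots> \<le> 2 powr q * (lp_int q ?W \<psi> + lp_int q ?W (\<lambda>x. \<psi> x - u x))"
      using q by (intro lp_int_diff sp \<psi>) auto
    also have "\<dots> < 2 powr q * (2 * \<epsilon>)" using 1 \<psi>(5) by simp
    also have "\<dots> = e powr q" by (simp add: \<epsilon>_def)
    finally show "lp_norm q ?W u < e" using q \<open>0 < e\<close> by (intro lp_norm_less) auto
  qed
qed

text \<open>Each \<open>s n\<close> is replaced by a test function whose \<open>lp_int\<close>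
  distance is below \<open>inverse (real (Suc n))\<close> and whose energy stays bounded. A
  convergent subsequence of these is one for \<open>s\<close>, because the distances tend to
  0.\<close>

lemma H01_rad_perp_embedding_compact:
  assumes a: "1 < a" and q: "2 \<le> q"
    and s: "\<And>n. s n \<in> H01_rad_perp" "\<And>n. h01_norm (s n) \<le> C"
  obtains r v where "strict_mono (r :: nat \<Rightarrow> nat)" "v \<in> lp_space q (weighted_disc_measure a q)"
    "(\<lambda>n. lp_norm q (weighted_disc_measure a q) (\<lambda>x. s (r n) x - v x)) \<longlonglongrightarrow> 0"
proof -
  let ?W = "weighted_disc_measure a q"
  interpret W: finite_measure ?W by (rule finite_measure_weighted[OF a q])
  obtain k where k: "q + 1 \<le> real (2 * Suc k)" using exponent_exists by blast
  have "\<forall>n. \<exists>\<phi>. \<phi> \<in> test_functions \<and> mean_zero_fn \<phi> \<and> dirichlet \<phi> \<le> 4 * (C\<^sup>2 + 1) \<and>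
    s n \<in> lp_space q ?W \<and> lp_int q ?W (\<lambda>x. \<phi> x - s n x) < inverse (real (Suc n))" proof fix n
    obtain \<psi> where \<psi>: "\<psi> \<in> test_functions" "mean_zero_fn \<psi>"
      "dirichlet \<psi> \<le> 4 * ((h01_norm (s n))\<^sup>2 + inverse (real (Suc n)))" "s n \<in> lp_space q ?W"
      "lp_int q ?W (\<lambda>x. \<psi> x - s n x) < inverse (real (Suc n))"
      using H01_rad_perp_approx_weighted[OF a q s(1)[of n], of "inverse (real (Suc n))"] by auto
    have "(h01_norm (s n))\<^sup>2 \<le> C\<^sup>2" by (intro power_mono s) (simp add: h01_norm_eq lp_int_nonneg)
    then have "dirichlet \<psi> \<le> 4 * (C\<^sup>2 + 1)"
      by (intro order_trans[OF \<psi>(3)] mult_left_mono add_mono) (auto simp: field_simps)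
    with \<psi> show "\<exists>\<phi>. \<phi> \<in> test_functions \<and> mean_zero_fn \<phi> \<and> dirichlet \<phi> \<le> 4 * (C\<^sup>2 + 1) \<and>
      s n \<in> lp_space q ?W \<and> lp_int q ?W (\<lambda>x. \<phi> x - s n x) < inverse (real (Suc n))" by blast qed
  from choice[OF this] obtain \<phi> where \<phi>: "\<And>n. \<phi> n \<in> test_functions" "\<And>n. mean_zero_fn (\<phi> n)"
      "\<And>n. dirichlet (\<phi> n) \<le> 4 * (C\<^sup>2 + 1)" "\<And>n. s n \<in> lp_space q ?W"
      "\<And>n. lp_int q ?W (\<lambda>x. \<phi> n x - s n x) < inverse (real (Suc n))" by blast
  obtain r :: "nat \<Rightarrow> nat" where r: "strict_mono r"
    and cauchy: "\<And>\<epsilon>. 0 < \<epsilon> \<Longrightarrow> \<exists>n0. \<forall>m\<ge>n0. \<forall>n\<ge>n0. lp_int q ?W (\<lambda>x. \<phi> (r m) x - \<phi> (r n) x) < \<epsilon>"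
    using mean_zero_compactness[OF a q, of \<phi>, OF \<phi>(1-3)] by blast
  have sp: "\<phi> n \<in> lp_space q ?W" for n by (rule test_fn_embedding(1)[OF a q k \<phi>(1,2)])
  have "\<exists>v\<in>lp_space q ?W. (\<lambda>n. lp_int q ?W (\<lambda>x. \<phi> (r n) x - v x)) \<longlonglongrightarrow> 0"
    using q cauchy by (intro W.lp_complete[of "\<lambda>n. \<phi> (r n)"] sp) simp_all
  then obtain v where v: "v \<in> lp_space q ?W" "(\<lambda>n. lp_int q ?W (\<lambda>x. \<phi> (r n) x - v x)) \<longlonglongrightarrow> 0"
    by blast
  have "(\<lambda>n. lp_int q ?W (\<lambda>x. \<phi> n x - s n x)) \<longlonglongrightarrow> 0" using \<phi>(5) less_imp_le
    by (intro tendsto_sandwich[OF _ _ tendsto_const LIMSEQ_inverse_real_of_nat] always_eventually allI)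
       (auto simp: lp_int_nonneg)
  from LIMSEQ_subseq_LIMSEQ[OF this r]
  have "(\<lambda>n. lp_int q ?W (\<lambda>x. \<phi> (r n) x - s (r n) x)) \<longlonglongrightarrow> 0" by (simp add: o_def)
  then have lim: "(\<lambda>n. 2 powr q * (lp_int q ?W (\<lambda>x. \<phi> (r n) x - v x) + lp_int q ?W (\<lambda>x. \<phi> (r n) x - s (r n) x))) \<longlonglongrightarrow> 0"
    by (intro tendsto_mult_right_zero tendsto_add_zero v(2))
  have "(\<lambda>n. lp_int q ?W (\<lambda>x. s (r n) x - v x)) \<longlonglongrightarrow> 0"
  proof (rule tendsto_sandwich[OF _ _ tendsto_const lim])
    have "lp_int q ?W (\<lambda>x. s (r n) x - v x) \<le>
      2 powr q * (lp_int q ?W (\<lambda>x. \<phi> (r n) x - v x) + lp_int q ?W (\<lambda>x. \<phi> (r n) x - s (r n) x))" for n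
    proof -
      have "lp_int q ?W (\<lambda>x. s (r n) x - v x) = lp_int q ?W (\<lambda>x. (\<phi> (r n) x - v x) - (\<phi> (r n) x - s (r n) x))"
        by simp
      also have "\<dots> \<le> 2 powr q * (lp_int q ?W (\<lambda>x. \<phi> (r n) x - v x) + lp_int q ?W (\<lambda>x. \<phi> (r n) x - s (r n) x))"
        using q by (intro lp_int_diff sp \<phi> v) auto
      finally show ?thesis .
    qed
    then show "\<forall>\<^sub>F n in sequentially. lp_int q ?W (\<lambda>x. s (r n) x - v x) \<le>
      2 powr q * (lp_int q ?W (\<lambda>x. \<phi> (r n) x - v x) + lp_int q ?W (\<lambda>x. \<phi> (r n) x - s (r n) x))"
      by simp
  qed (simp add: lp_int_nonneg)
  then show ?thesis using that[OF r v(1)] q by (simp add: lp_norm_tendsto_0_iff)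
qed

theorem theorem1:
  fixes a q :: real
  assumes "a > 1" and "q \<ge> 2"
  shows "compact_embedding H01_rad_perp h01_norm
           (lp_space q (weighted_disc_measure a q)) (lp_norm q (weighted_disc_measure a q))"
  unfolding compact_embedding_def
proof (intro conjI ballI allI impI)
  show "H01_rad_perp \<subseteq> lp_space q (weighted_disc_measure a q)"
    using H01_rad_perp_approx_weighted[OF assms, of _ 1] by auto
next
  fix u :: "real^2 \<Rightarrow> real" and e :: real assume u: "u \<in> H01_rad_perp" and "0 < e"
  obtain d where "0 < d"
    "\<And>u. u \<in> H01_rad_perp \<Longrightarrow> h01_norm u < d \<Longrightarrow> lp_norm q (weighted_disc_measure a q) u < e"
    using H01_rad_perp_embedding_continuous[OF assms \<open>0 < e\<close>] by blast
  then show "\<exists>d>0. \<forall>v\<in>H01_rad_perp. h01_norm (\<lambda>x. v x - u x) < d \<longrightarrow>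
      lp_norm q (weighted_disc_measure a q) (\<lambda>x. v x - u x) < e"
    using H01_rad_perp_diff[OF _ u] by blast
next
  fix s :: "nat \<Rightarrow> real^2 \<Rightarrow> real"
  assume "(\<forall>n. s n \<in> H01_rad_perp) \<and> (\<exists>C. \<forall>n. h01_norm (s n) \<le> C)"
  then obtain C where "\<And>n. s n \<in> H01_rad_perp" "\<And>n. h01_norm (s n) \<le> C" by blast
  from H01_rad_perp_embedding_compact[OF assms this]
  obtain r v where "strict_mono r" "v \<in> lp_space q (weighted_disc_measure a q)"
    "(\<lambda>n. lp_norm q (weighted_disc_measure a q) (\<lambda>x. s (r n) x - v x)) \<longlonglongrightarrow> 0" .
  then show "\<exists>r. strict_mono r \<and> (\<exists>v\<in>lp_space q (weighted_disc_measure a q).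
      (\<lambda>n. lp_norm q (weighted_disc_measure a q) (\<lambda>x. s (r n) x - v x)) \<longlonglongrightarrow> 0)"
    by (intro exI[of _ r] conjI bexI[of _ v])
qed

end
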